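(* Let $P_0,P_1$ be probability measures on $\mathbb{R}$ with finite means $\mu_0,\mu_1$ and let $r_1\in\mathbb{R}$, satisfying Assumptions A, B and C (case $l=1$) stated in the context. Let $I_0,I_1$ be the associated Legendre–Fenchel transforms. Then the instantaneous processes $\{X^{N;I}_n\}_{n=0}^\infty$, $N\ge1$, almost surely satisfy $$\lim_{N\to\infty}\limsup_{n\to\infty}\frac{X^{N;I}_n}{n}=\lim_{N\to\infty}\liminf_{n\to\infty}\frac{X^{N;I}_n}{n}=\begin{cases}\mu_0,&\text{if } I_0(r_1)>I_1(r_1);\\ \mu_1,&\text{if } I_1(r_1)>I_0(r_1).\end{cases}$$
   Context: Setting (case $l=1$, two increment distributions). $P_0,P_1$ are probability measures on $\mathbb{R}$ with finite means $\mu_i=\int x\,P_i(dx)$, $r_1\in\mathbb{R}$ is the threshold, and $N\in\mathbb{N}$ is the history window. Assumption A: $\mu_0<r_1<\mu_1$. Assumption B: $P_0([r_1,\infty))>0$ and $P_1((-\infty,r_1))>0$. Assumption C: there is $t_0>0$ such that $M_i(\pm t_0)<\infty$ for $i=0,1$, where $M_i(t)=\int e^{tx}P_i(dx)$. Legendre–Fenchel transform: $I_i(r)=\sup_{\lambda\in\mathbb{R}}\big(\lambda r-\log M_i(\lambda)\big)$, $r\in\mathbb{R}$. Instantaneous process $\{X^{N;I}_n\}_{n\ge0}$: $X^{N;I}_0=0$. At each time $n\ge0$ the process has a regime $J_n\in\{0,1\}$ and, conditionally on the past (positions and regimes up to time $n$), the increment $X^{N;I}_{n+1}-X^{N;I}_n$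 has distribution $P_{J_n}$. For the first $N$ jumps, $J_0=\dots=J_{N-1}=i_*$ for some fixed starting regime $i_*\in\{0,1\}$. For $n\ge N$, let $A_n=\frac{X^{N;I}_n-X^{N;I}_{n-N}}{N}$. If $J_{n-1}=0$, then $J_n=0$ if $A_n<r_1$ and $J_n=1$ if $A_n\ge r_1$. If $J_{n-1}=1$, then $J_n=1$ if $A_n\ge r_1$ and $J_n=0$ if $A_n<r_1$. *)

theory Defs
  imports "HOL-Probability.Probability"
begin

definition moment_gen :: "real measure \<Rightarrow> real \<Rightarrow> ennreal" where
  "moment_gen P t = (\<integral>\<^sup>+x. ennreal (exp (t * x)) \<partial>P)"

text \<open>
  The logarithm on \<open>[0, \<infinity>]\<close>, with \<open>log 0 = -\<infinity>\<close> and \<open>log \<infinity> = \<infinity>\<close>.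
\<close>

definition ext_ln :: "ennreal \<Rightarrow> ereal" where
  "ext_ln m = (if m = 0 then - \<infinity> else if m = \<infinity> then \<infinity> else ereal (ln (enn2real m)))"

text \<open>
  Parameters \<open>t\<close> at which the moment generating function is infinite contribute \<open>-\<infinity>\<close> to
  the supremum.
\<close>

definition legendre_transform :: "real measure \<Rightarrow> real \<Rightarrow> ereal" where
  "legendre_transform P r = (SUP t. ereal (t * r) - ext_ln (moment_gen P t))"

text \<open>
  The \<open>\<sigma>\<close>-algebra generated by the positions and regimes up to and including time \<open>n\<close>.
\<close>

definition past ::
    "'a measure \<Rightarrow> (nat \<Rightarrow> 'a \<Rightarrow> real) \<Rightarrow> (nat \<Rightarrow> 'a \<Rightarrow> nat) \<Rightarrow> nat \<Rightarrow> 'a measure" where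
  "past M X J n =
     vimage_algebra (space M) (\<lambda>\<omega>. \<lambda>k\<in>{..n}. (X k \<omega>, J k \<omega>))
       (Pi\<^sub>M {..n} (\<lambda>_. borel \<Otimes>\<^sub>M count_space UNIV))"

text \<open>
  The instantaneous process with history window \<open>N\<close>, threshold \<open>r\<close>, increment distributions
  \<open>P 0\<close>, \<open>P 1\<close> and starting regime \<open>i\<^sub>0\<close>: \<open>X n\<close> is the position and \<open>J n\<close> the regime at
  time \<open>n\<close>. The assumption \<open>increment\<close> says that the regular conditional distribution of
  \<open>X (n + 1) - X n\<close> given the past is \<open>P (J n)\<close>.
\<close>

locale instantaneous_process = prob_space M
  for M :: "'a measure" and P :: "nat \<Rightarrow> real measure" and r :: real and i\<^sub>0 :: nat and N :: nat
    and X :: "nat \<Rightarrow> 'a \<Rightarrow> real" and J :: "nat \<Rightarrow> 'a \<Rightarrow> nat" +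
  assumes X_measurable: "\<And>n. X n \<in> borel_measurable M"
    and J_measurable: "\<And>n. J n \<in> measurable M (count_space UNIV)"
    and X_zero: "\<And>\<omega>. \<omega> \<in> space M \<Longrightarrow> X 0 \<omega> = 0"
    and increment: "\<And>n B. B \<in> sets borel \<Longrightarrow>
      AE \<omega> in M. real_cond_exp M (past M X J n)
          (\<lambda>\<omega>. indicator B (X (Suc n) \<omega> - X n \<omega>)) \<omega> = measure (P (J n \<omega>)) B"
    and J_start: "\<And>n \<omega>. \<omega> \<in> space M \<Longrightarrow> n < N \<Longrightarrow> J n \<omega> = i\<^sub>0"
    and J_from_0: "\<And>n \<omega>. \<omega> \<in> space M \<Longrightarrow> n \<ge> N \<Longrightarrow> J (n - 1) \<omega> = 0 \<Longrightarrow>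
      J n \<omega> = (if (X n \<omega> - X (n - N) \<omega>) / real N < r then 0 else 1)"
    and J_from_1: "\<And>n \<omega>. \<omega> \<in> space M \<Longrightarrow> n \<ge> N \<Longrightarrow> J (n - 1) \<omega> = 1 \<Longrightarrow>
      J n \<omega> = (if (X n \<omega> - X (n - N) \<omega>) / real N \<ge> r then 1 else 0)"
begin

text \<open>
  The conditional expectation operator is only meaningful for a sub-\<open>\<sigma>\<close>-algebra.
\<close>

lemma subalgebra_past: "subalgebra M (past M X J n)"
proof -
  note [measurable] = X_measurable J_measurable
  have "(\<lambda>\<omega>. \<lambda>k\<in>{..n}. (X k \<omega>, J k \<omega>))
      \<in> measurable M (Pi\<^sub>M {..n} (\<lambda>_. borel \<Otimes>\<^sub>M count_space UNIV))"
    by measurable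
  then show ?thesis
    unfolding past_def subalgebra_def
    using sets_image_in_sets[OF refl] by (simp add: sets_image_in_sets)
qed

end

end

theory Submission
  imports Defs
begin

text \<open>
  Centre the increments at the threshold and orient the axis so that the increments of the regime \<open>g\<close>
  with the larger rate \<open>I\<^bsub>g\<^esub>\<close> have positive mean and those of the other regime \<open>b\<close> have negative mean. Call
  a time fresh if the last \<open>N\<close> increments were all drawn in regime \<open>g\<close>. Leaving \<open>g\<close> at a fresh time
  requires \<open>N\<close> independent increments with nonpositive sum, which by Chernoff's bound happens at a rate
  of at most \<open>exp (- N I\<^bsub>g\<^esub>)\<close>. Conversely, from every history whatsoever a fresh time is reached
  within \<open>2N\<close> steps with probability at least \<open>exp (- N (I\<^bsub>b\<^esub> + o(1)))\<close>: replace the law of the increments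
  in regime \<open>b\<close> by an exponentially tilted law of slightly positive mean. Under the new dynamics
  all windows that have forgotten the history have positive sum, and the likelihood ratio is controlled
  because only the first \<open>N\<close> steps can be tilted. Comparing the number of transitions in both directions,
  the fraction of time spent in \<open>b\<close> is at most of order \<open>N exp (- N (I\<^bsub>g\<^esub> - I\<^bsub>b\<^esub> - o(1)))\<close>, and the strong law of
  large numbers turns this into the limit of \<open>X\<^bsub>n\<^esub> / n\<close>.
\<close>

section \<open>Random walks with switching step distributions\<close>

text \<open>Bounds valid from every history are stated without conditional expectations: an
  inequality given \<open>F n\<close> becomes an inequality of integrals against every nonnegative
  \<open>F n\<close>-measurable weight \<open>H\<close>, and absorbing one more factor into
  \<open>H\<close> iterates it.

  Two obstacles shape the escape estimate. The moment generating function of the bad law may be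
  infinite away from 0, so tilting it directly need not reach mean zero; it is truncated before it
  is tilted. Moreover, the bad law may have no mass beyond the threshold but an atom on it. Then the
  controlled bad increments vanish, a window sum is positive only through good increments, and the
  fluctuations of a few good steps could spoil its sign. Hence the first \<open>K\<close> good
  increments are forced upwards, with \<open>K\<close> a small multiple of \<open>N\<close>; a
  window with few good steps then has nonnegative sum and enters the good regime by the tie
  convention.

  Atypical controlled paths are excluded by one exponential Markov bound for each of the
  polynomially many windows inside \<open>2 * N\<close> steps and one for the likelihood
  ratio.\<close>

locale switching_walk = prob_space M
  for M :: "'a measure" and F :: "nat \<Rightarrow> 'a measure" and J :: "nat \<Rightarrow> 'a \<Rightarrow> bool"
    and Y :: "nat \<Rightarrow> 'a \<Rightarrow> real" and R :: "bool \<Rightarrow> real measure" +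
  assumes subalg: "\<And>n. subalgebra M (F n)"
    and F_Suc: "\<And>n. sets (F n) \<subseteq> sets (F (Suc n))"
    and J_F: "\<And>n. J n \<in> measurable (F n) (count_space UNIV)"
    and Y_F: "\<And>n. Y n \<in> borel_measurable (F (Suc n))"
    and R: "\<And>i. real_distribution (R i)"
    and law: "\<And>n i A B. A \<in> sets (F n) \<Longrightarrow> (\<And>\<omega>. \<omega> \<in> A \<Longrightarrow> J n \<omega> = i) \<Longrightarrow> B \<in> sets borel \<Longrightarrow>
      emeasure M {\<omega>\<in>A. Y n \<omega> \<in> B} = emeasure M A * emeasure (R i) B"
begin

section \<open>Measurability with respect to the filtration, and integrating out increments\<close>

lemma space_F [simp]: "space (F n) = space M"
  using subalg[of n] by (simp add: subalgebra_def)

lemma sets_F: "m \<le> n \<Longrightarrow> sets (F m) \<subseteq> sets (F n)"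
  by (induction rule: dec_induct) (use F_Suc in blast)+

lemma measurable_F_mono: "f \<in> measurable (F m) N \<Longrightarrow> m \<le> n \<Longrightarrow> f \<in> measurable (F n) N"
  by (rule measurable_from_subalg[of _ "F m"]) (simp_all add: subalgebra_def sets_F)

lemma measurable_F_M: "f \<in> measurable (F m) N \<Longrightarrow> f \<in> measurable M N"
  by (rule measurable_from_subalg[OF subalg])

lemma sets_R [measurable_cong, simp]: "sets (R i) = sets borel"
  using R[of i] by (simp add: real_distribution.events_eq_borel)

lemma space_R [simp]: "space (R i) = UNIV"
  using sets_eq_imp_space_eq[OF sets_R[of i]] by simp

lemma measurable_J: "k \<le> n \<Longrightarrow> Measurable.pred (F n) (J k)"
  using measurable_F_mono[OF J_F] by simp

lemma measurable_Y: "k < n \<Longrightarrow> Y k \<in> borel_measurable (F n)"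
  using measurable_F_mono[OF Y_F, of k n] by simp

lemma measurable_J_M [measurable]: "Measurable.pred M (J k)"
  using measurable_F_M[OF J_F] by simp

lemma measurable_Y_M [measurable]: "Y k \<in> borel_measurable M"
  using measurable_F_M[OF Y_F] by simp

lemma measurable_eval:
  assumes "f \<in> borel_measurable (F k \<Otimes>\<^sub>M borel)" "k < n"
  shows "(\<lambda>\<omega>. f (\<omega>, Y k \<omega>)) \<in> borel_measurable (F n)"
proof -
  have "(\<lambda>\<omega>. \<omega>) \<in> measurable (F n) (F k)"
    using assms by (intro measurable_F_mono[OF measurable_ident_sets[OF refl]]) simp
  then have "(\<lambda>\<omega>. (\<omega>, Y k \<omega>)) \<in> measurable (F n) (F k \<Otimes>\<^sub>M borel)"
    using measurable_Y[OF assms(2)] by (rule measurable_Pair)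
  from measurable_compose[OF this assms(1)] show ?thesis .
qed

lemma measurable_pair_R:
  assumes "f \<in> borel_measurable (F n \<Otimes>\<^sub>M borel)" and "sets M1 = sets (F n)"
  shows "f \<in> borel_measurable (M1 \<Otimes>\<^sub>M R i)"
proof -
  have "sets (M1 \<Otimes>\<^sub>M R i) = sets (F n \<Otimes>\<^sub>M borel)"
    using assms(2) by (intro sets_pair_measure_cong) simp_all
  from measurable_cong_sets[OF this refl] assms(1) show ?thesis by blast
qed

lemma measurable_nn_integral_R:
  assumes "f \<in> borel_measurable (F n \<Otimes>\<^sub>M borel)"
  shows "(\<lambda>\<omega>. \<integral>\<^sup>+y. f (\<omega>, y) \<partial>R i) \<in> borel_measurable (F n)"
proof -
  interpret Ri: real_distribution "R i" by (rule R)
  show ?thesis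
    by (rule Ri.borel_measurable_nn_integral_fst[OF measurable_pair_R[OF assms refl]])
qed

text \<open>On \<open>{J n = i}\<close> the joint law of the history and the next increment is a
  product: \<open>law\<close> gives this on rectangles, uniqueness of product measures extends it,
  and Tonelli's theorem yields the formula. The function \<open>f\<close> may depend on the history
  up to time \<open>n\<close> and on the one new increment.\<close>

lemma step_regime:
  assumes f: "f \<in> borel_measurable (F n \<Otimes>\<^sub>M borel)"
  shows "(\<integral>\<^sup>+\<omega>. indicator {\<omega>\<in>space M. J n \<omega> = i} \<omega> * f (\<omega>, Y n \<omega>) \<partial>M) =
    (\<integral>\<^sup>+\<omega>. indicator {\<omega>\<in>space M. J n \<omega> = i} \<omega> * (\<integral>\<^sup>+y. f (\<omega>, y) \<partial>R i) \<partial>M)"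
proof -
  interpret Ri: real_distribution "R i" by (rule R)
  define S where "S = {\<omega>\<in>space M. J n \<omega> = i}"
  have SF: "S \<in> sets (F n)"
    using measurable_sets[OF J_F[of n], of "{i}"] by (simp add: S_def vimage_def Int_def conj_commute)
  have SM: "S \<in> sets M" using SF subalg[of n] by (auto simp: subalgebra_def)
  define M1 where "M1 = density (restr_to_subalg M (F n)) (indicator S)"
  define D where "D = distr (density M (indicator S)) (F n \<Otimes>\<^sub>M borel) (\<lambda>\<omega>. (\<omega>, Y n \<omega>))"
  have sM1: "sets M1 = sets (F n)"
    using sets_restr_to_subalg[OF subalg] by (simp add: M1_def)
  have spM1: "space M1 = space M" using sets_eq_imp_space_eq[OF sM1] by simp
  have S1: "indicator S \<in> borel_measurable (restr_to_subalg M (F n))"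
    using SF sets_restr_to_subalg[OF subalg, of n] by (intro borel_measurable_indicator) simp
  have pM: "(\<lambda>\<omega>. (\<omega>, Y n \<omega>)) \<in> measurable M (F n \<Otimes>\<^sub>M borel)"
    by (rule measurable_Pair[OF measurable_F_M[OF measurable_ident_sets[OF refl]] measurable_Y_M])
  have eM1: "emeasure M1 A = emeasure M (S \<inter> A)" if "A \<in> sets (F n)" for A
  proof -
    have "emeasure M1 A = emeasure (restr_to_subalg M (F n)) (S \<inter> A)"
      unfolding M1_def using that SF sets_restr_to_subalg[OF subalg, of n]
      by (intro emeasure_restricted) auto
    also have "\<dots> = emeasure M (S \<inter> A)"
      by (rule emeasure_restr_to_subalg[OF subalg]) (use SF that in auto)
    finally show ?thesis .
  qed
  have fin: "finite_measure M1"
    by (rule finite_measureI) (simp add: spM1 eM1 sets.top[of "F n", simplified])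
  interpret M1: finite_measure M1 by (rule fin)
  have eq: "M1 \<Otimes>\<^sub>M R i = D"
  proof (rule pair_measure_eqI)
    show "sigma_finite_measure M1" "sigma_finite_measure (R i)"
      by unfold_locales
    show "sets (M1 \<Otimes>\<^sub>M R i) = sets D"
      unfolding D_def by (simp cong: sets_pair_measure_cong add: sM1)
    fix A B assume A: "A \<in> sets M1" and B: "B \<in> sets (R i)"
    then have A': "A \<in> sets (F n)" and B': "B \<in> sets borel" by (auto simp: sM1)
    then have AM: "A \<in> sets M" using subalg[of n] by (auto simp: subalgebra_def)
    have "emeasure D (A \<times> B) = emeasure (density M (indicator S)) ((\<lambda>\<omega>. (\<omega>, Y n \<omega>)) -` (A \<times> B) \<inter> space M)"
      unfolding D_def using pM A' B' by (subst emeasure_distr) auto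
    also have "(\<lambda>\<omega>. (\<omega>, Y n \<omega>)) -` (A \<times> B) \<inter> space M = {\<omega>\<in>A. Y n \<omega> \<in> B}"
      using sets.sets_into_space[OF AM] by auto
    also have "emeasure (density M (indicator S)) \<dots> = emeasure M (S \<inter> {\<omega>\<in>A. Y n \<omega> \<in> B})"
      using SM AM B' by (intro emeasure_restricted) auto
    also have "S \<inter> {\<omega>\<in>A. Y n \<omega> \<in> B} = {\<omega>\<in>S \<inter> A. Y n \<omega> \<in> B}" by auto
    also have "emeasure M \<dots> = emeasure M (S \<inter> A) * emeasure (R i) B"
      by (rule law[of _ n]) (use SF A' B' in \<open>auto simp: S_def\<close>)
    finally show "emeasure M1 A * emeasure (R i) B = emeasure D (A \<times> B)"
      by (simp add: eM1 A')
  qed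
  have f': "f \<in> borel_measurable (M1 \<Otimes>\<^sub>M R i)"
    by (rule measurable_pair_R[OF f sM1])
  have f2: "(\<lambda>\<omega>. \<integral>\<^sup>+y. f (\<omega>, y) \<partial>R i) \<in> borel_measurable (F n)"
    by (rule measurable_nn_integral_R[OF f])
  have f3: "(\<lambda>\<omega>. \<integral>\<^sup>+y. f (\<omega>, y) \<partial>R i) \<in> borel_measurable (restr_to_subalg M (F n))"
    using f2 measurable_cong_sets[OF sets_restr_to_subalg[OF subalg, of n] refl] by blast
  have "(\<integral>\<^sup>+\<omega>. indicator S \<omega> * f (\<omega>, Y n \<omega>) \<partial>M) = integral\<^sup>N D f"
    unfolding D_def using pM f SM measurable_compose[OF pM f]
    by (subst nn_integral_distr) (auto simp: nn_integral_density)
  also have "\<dots> = (\<integral>\<^sup>+\<omega>. (\<integral>\<^sup>+y. f (\<omega>, y) \<partial>R i) \<partial>M1)"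
    unfolding eq[symmetric] by (rule Ri.nn_integral_fst[OF f', symmetric])
  also have "\<dots> = (\<integral>\<^sup>+\<omega>. indicator S \<omega> * (\<integral>\<^sup>+y. f (\<omega>, y) \<partial>R i) \<partial>restr_to_subalg M (F n))"
    unfolding M1_def by (rule nn_integral_density[OF S1 f3])
  also have "\<dots> = (\<integral>\<^sup>+\<omega>. indicator S \<omega> * (\<integral>\<^sup>+y. f (\<omega>, y) \<partial>R i) \<partial>M)"
    using SF f2 by (intro nn_integral_subalgebra2[OF subalg]) auto
  finally show ?thesis by (simp add: S_def)
qed

lemma step:
  assumes f: "f \<in> borel_measurable (F n \<Otimes>\<^sub>M borel)"
  shows "(\<integral>\<^sup>+\<omega>. f (\<omega>, Y n \<omega>) \<partial>M) = (\<integral>\<^sup>+\<omega>. (\<integral>\<^sup>+y. f (\<omega>, y) \<partial>R (J n \<omega>)) \<partial>M)"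
proof -
  have m1: "(\<lambda>\<omega>. f (\<omega>, Y n \<omega>)) \<in> borel_measurable M"
    using measurable_F_M[OF measurable_eval[OF f]] by blast
  have m2: "(\<lambda>\<omega>. \<integral>\<^sup>+y. f (\<omega>, y) \<partial>R i) \<in> borel_measurable M" for i
    by (rule measurable_F_M[OF measurable_nn_integral_R[OF f]])
  let ?S = "\<lambda>i. {\<omega>\<in>space M. J n \<omega> = i}"
  have "(\<integral>\<^sup>+\<omega>. f (\<omega>, Y n \<omega>) \<partial>M) =
      (\<integral>\<^sup>+\<omega>. indicator (?S True) \<omega> * f (\<omega>, Y n \<omega>) + indicator (?S False) \<omega> * f (\<omega>, Y n \<omega>) \<partial>M)"
    by (intro nn_integral_cong) (auto simp: indicator_def)
  also have "\<dots> = (\<integral>\<^sup>+\<omega>. indicator (?S True) \<omega> * f (\<omega>, Y n \<omega>) \<partial>M) + (\<integral>\<^sup>+\<omega>. indicator (?S False) \<omega> * f (\<omega>, Y n \<omega>) \<partial>M)"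
    using m1 by (intro nn_integral_add) auto
  also have "\<dots> = (\<integral>\<^sup>+\<omega>. indicator (?S True) \<omega> * (\<integral>\<^sup>+y. f (\<omega>, y) \<partial>R True) \<partial>M) + (\<integral>\<^sup>+\<omega>. indicator (?S False) \<omega> * (\<integral>\<^sup>+y. f (\<omega>, y) \<partial>R False) \<partial>M)"
    by (simp only: step_regime[OF f])
  also have "\<dots> = (\<integral>\<^sup>+\<omega>. indicator (?S True) \<omega> * (\<integral>\<^sup>+y. f (\<omega>, y) \<partial>R True) + indicator (?S False) \<omega> * (\<integral>\<^sup>+y. f (\<omega>, y) \<partial>R False) \<partial>M)"
    using m2 by (intro nn_integral_add[symmetric]) auto
  also have "\<dots> = (\<integral>\<^sup>+\<omega>. (\<integral>\<^sup>+y. f (\<omega>, y) \<partial>R (J n \<omega>)) \<partial>M)"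
    by (intro nn_integral_cong) (auto simp: indicator_def)
  finally show ?thesis .
qed

lemma step_mult:
  assumes f: "f \<in> borel_measurable (F n \<Otimes>\<^sub>M borel)" and H: "H \<in> borel_measurable (F n)"
  shows "(\<integral>\<^sup>+\<omega>. H \<omega> * f (\<omega>, Y n \<omega>) \<partial>M) = (\<integral>\<^sup>+\<omega>. H \<omega> * (\<integral>\<^sup>+y. f (\<omega>, y) \<partial>R (J n \<omega>)) \<partial>M)"
proof -
  have [measurable]: "f \<in> borel_measurable (F n \<Otimes>\<^sub>M borel)" "H \<in> borel_measurable (F n)" by fact+
  have sec: "(\<lambda>y. f (\<omega>, y)) \<in> borel_measurable (R i)" if "\<omega> \<in> space M" for \<omega> i
    using measurable_compose[OF measurable_Pair1'[of \<omega> "F n" borel] f] that by simp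
  have "(\<integral>\<^sup>+\<omega>. H \<omega> * f (\<omega>, Y n \<omega>) \<partial>M) = (\<integral>\<^sup>+\<omega>. (\<lambda>z. H (fst z) * f z) (\<omega>, Y n \<omega>) \<partial>M)" by simp
  also have "\<dots> = (\<integral>\<^sup>+\<omega>. (\<integral>\<^sup>+y. H \<omega> * f (\<omega>, y) \<partial>R (J n \<omega>)) \<partial>M)"
    by (subst step) simp_all
  also have "\<dots> = (\<integral>\<^sup>+\<omega>. H \<omega> * (\<integral>\<^sup>+y. f (\<omega>, y) \<partial>R (J n \<omega>)) \<partial>M)"
    by (intro nn_integral_cong nn_integral_cmult sec)
  finally show ?thesis .
qed

lemma measurable_prod_eval:
  assumes f: "\<And>k. f k \<in> borel_measurable (F k \<Otimes>\<^sub>M borel)" and H: "H \<in> borel_measurable (F n)"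
  shows "(\<lambda>\<omega>. H \<omega> * (\<Prod>k=n..<n+m. f k (\<omega>, Y k \<omega>) :: ennreal)) \<in> borel_measurable (F (n + m))"
  using measurable_F_mono[OF H, of "n+m"] measurable_eval[OF f]
  by (intro borel_measurable_times_ennreal borel_measurable_prod_ennreal) auto

text \<open>The weighted product is a supermartingale: its last factor is integrated out given the
  history. Both the Chernoff bounds under the original law and those under the changed law come from
  here.\<close>

lemma nn_integral_prod_le:
  assumes f: "\<And>k. f k \<in> borel_measurable (F k \<Otimes>\<^sub>M borel)" and H: "H \<in> borel_measurable (F n)"
    and le: "\<And>k \<omega>. \<omega> \<in> space M \<Longrightarrow> (\<integral>\<^sup>+y. f k (\<omega>, y) \<partial>R (J k \<omega>)) \<le> 1"
  shows "(\<integral>\<^sup>+\<omega>. H \<omega> * (\<Prod>k=n..<n+m. f k (\<omega>, Y k \<omega>)) \<partial>M) \<le> (\<integral>\<^sup>+\<omega>. H \<omega> \<partial>M)"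
proof (induction m)
  case (Suc m)
  have "(\<integral>\<^sup>+\<omega>. H \<omega> * (\<Prod>k=n..<n+Suc m. f k (\<omega>, Y k \<omega>)) \<partial>M) =
      (\<integral>\<^sup>+\<omega>. (H \<omega> * (\<Prod>k=n..<n+m. f k (\<omega>, Y k \<omega>))) * f (n+m) (\<omega>, Y (n+m) \<omega>) \<partial>M)"
    by (simp add: mult.assoc)
  also have "\<dots> = (\<integral>\<^sup>+\<omega>. (H \<omega> * (\<Prod>k=n..<n+m. f k (\<omega>, Y k \<omega>))) *
      (\<integral>\<^sup>+y. f (n+m) (\<omega>, y) \<partial>R (J (n+m) \<omega>)) \<partial>M)"
    by (rule step_mult[OF f measurable_prod_eval[OF f H]])
  also have "\<dots> \<le> (\<integral>\<^sup>+\<omega>. H \<omega> * (\<Prod>k=n..<n+m. f k (\<omega>, Y k \<omega>)) \<partial>M)"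
    by (intro nn_integral_mono) (use le mult_left_mono in fastforce)
  finally show ?case using Suc by (rule order_trans)
qed simp

text \<open>The martingale counterpart; with conditional densities as factors it says that a
  likelihood ratio preserves total mass.\<close>

lemma nn_integral_prod_eq:
  assumes f: "\<And>k. f k \<in> borel_measurable (F k \<Otimes>\<^sub>M borel)" and H: "H \<in> borel_measurable (F n)"
    and eq: "\<And>k \<omega>. \<omega> \<in> space M \<Longrightarrow> (\<integral>\<^sup>+y. f k (\<omega>, y) \<partial>R (J k \<omega>)) = 1"
  shows "(\<integral>\<^sup>+\<omega>. H \<omega> * (\<Prod>k=n..<n+m. f k (\<omega>, Y k \<omega>)) \<partial>M) = (\<integral>\<^sup>+\<omega>. H \<omega> \<partial>M)"
proof (induction m)
  case (Suc m)
  have "(\<integral>\<^sup>+\<omega>. H \<omega> * (\<Prod>k=n..<n+Suc m. f k (\<omega>, Y k \<omega>)) \<partial>M) =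
      (\<integral>\<^sup>+\<omega>. (H \<omega> * (\<Prod>k=n..<n+m. f k (\<omega>, Y k \<omega>))) * f (n+m) (\<omega>, Y (n+m) \<omega>) \<partial>M)"
    by (simp add: mult.assoc)
  also have "\<dots> = (\<integral>\<^sup>+\<omega>. (H \<omega> * (\<Prod>k=n..<n+m. f k (\<omega>, Y k \<omega>))) *
      (\<integral>\<^sup>+y. f (n+m) (\<omega>, y) \<partial>R (J (n+m) \<omega>)) \<partial>M)"
    by (rule step_mult[OF f measurable_prod_eval[OF f H]])
  also have "\<dots> = (\<integral>\<^sup>+\<omega>. H \<omega> * (\<Prod>k=n..<n+m. f k (\<omega>, Y k \<omega>)) \<partial>M)"
    by (intro nn_integral_cong) (simp add: eq)
  finally show ?case using Suc by simp
qed simp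


section \<open>One-sided strong laws from exponential moments\<close>

text \<open>Since \<open>V n\<close> is known only at time \<open>n + L\<close>, consecutive terms
  cannot be handled as martingale increments. Indices in one residue class modulo \<open>L\<close>
  are at least \<open>L\<close> apart, so each class sum has an exponential supermartingale bound.
  The resulting tails are summable in \<open>T\<close>, and Borel-Cantelli applies to the union over
  the \<open>L\<close> classes.\<close>

lemma lagged_strong_law:
  fixes V :: "nat \<Rightarrow> 'a \<Rightarrow> real"
  assumes L: "0 < L" and V: "\<And>n. V n \<in> borel_measurable (F (n + L))"
    and mgf: "\<And>\<epsilon>. 0 < \<epsilon> \<Longrightarrow> \<exists>s>0. \<forall>n. \<forall>H\<in>borel_measurable (F n). (\<integral>\<^sup>+\<omega>. H \<omega> \<partial>M) < \<infinity> \<longrightarrow>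
      (\<integral>\<^sup>+\<omega>. H \<omega> * ennreal (exp (s * V n \<omega>)) \<partial>M) \<le> ennreal (exp (s * \<epsilon>)) * (\<integral>\<^sup>+\<omega>. H \<omega> \<partial>M)"
  shows "AE \<omega> in M. \<forall>\<epsilon>>0. \<forall>\<^sub>F T in sequentially. (\<Sum>n<T. V n \<omega>) \<le> \<epsilon> * real T"
proof -
  define S where "S a T \<omega> = (\<Sum>n | n < T \<and> n mod L = a. V n \<omega>)" for a T \<omega>
  have S_Suc: "S a (Suc T) \<omega> = S a T \<omega> + (if T mod L = a then V T \<omega> else 0)" for a T \<omega>
  proof -
    have "{n. n < Suc T \<and> n mod L = a} = {n. n < T \<and> n mod L = a} \<union> (if T mod L = a then {T} else {})"
      by (auto simp: less_Suc_eq)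
    then show ?thesis by (auto simp: S_def add.commute)
  qed
  have VM [measurable]: "V n \<in> borel_measurable M" for n
    using measurable_F_M[OF V] .
  have SM [measurable]: "S a T \<in> borel_measurable M" for a T
    unfolding S_def by measurable
  have sum_S: "(\<Sum>n<T. V n \<omega>) = (\<Sum>a<L. S a T \<omega>)" for T \<omega>
  proof -
    have "(\<Sum>a<L. S a T \<omega>) = (\<Sum>a<L. \<Sum>n | n \<in> {..<T} \<and> n mod L = a. V n \<omega>)"
      by (simp add: S_def)
    also have "\<dots> = (\<Sum>n<T. V n \<omega>)"
      by (rule sum.group) (use L in auto)
    finally show ?thesis by simp
  qed
  \<comment> \<open>Earlier indices in the class of \<open>T\<close> are at most
    \<open>T - L\<close>, so their terms are already known at time \<open>T\<close>.\<close>
  have S_F: "S (T mod L) T \<in> borel_measurable (F T)" for T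
  proof -
    have "V n \<in> borel_measurable (F T)" if "n < T" "n mod L = T mod L" for n
    proof (rule measurable_F_mono[OF V])
      have "L dvd T - n" using that by (metis less_imp_le mod_eq_dvd_iff_nat)
      then have "L \<le> T - n" using that by (intro dvd_imp_le) auto
      then show "n + L \<le> T" using that by simp
    qed
    then show ?thesis unfolding S_def by (intro borel_measurable_sum) auto
  qed
  have ev: "AE \<omega> in M. \<forall>\<^sub>F T in sequentially. (\<Sum>n<T. V n \<omega>) \<le> 2 * real L * \<epsilon> * real T"
    if \<epsilon>: "0 < \<epsilon>" for \<epsilon>
  proof -
    obtain s where s: "0 < s" and mgf_s: "\<And>n H. H \<in> borel_measurable (F n) \<Longrightarrow> (\<integral>\<^sup>+\<omega>. H \<omega> \<partial>M) < \<infinity> \<Longrightarrow>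
        (\<integral>\<^sup>+\<omega>. H \<omega> * ennreal (exp (s * V n \<omega>)) \<partial>M) \<le> ennreal (exp (s * \<epsilon>)) * (\<integral>\<^sup>+\<omega>. H \<omega> \<partial>M)"
      using mgf[OF \<epsilon>] by blast
    \<comment> \<open>The exponent counts all \<open>T\<close> steps although only about
      \<open>T / L\<close> of them belong to the class. This costs the factor \<open>L\<close> in
      the slope \<open>2 * real L * \<epsilon>\<close>, which is absorbed because
      \<open>\<epsilon>\<close> is arbitrary.\<close>
    have bound: "(\<integral>\<^sup>+\<omega>. ennreal (exp (s * S a T \<omega>)) \<partial>M) \<le> ennreal (exp (s * \<epsilon> * real T))" for a T
    proof (induction T)
      case 0
      show ?case by (simp add: S_def emeasure_space_1)
    next
      case (Suc T)
      show ?case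
      proof (cases "T mod L = a")
        case False
        have "exp (s * \<epsilon> * real T) \<le> exp (s * \<epsilon> * real (Suc T))"
          using s \<epsilon> by simp
        with Suc show ?thesis using False by (auto simp: S_Suc intro: order_trans ennreal_leI)
      next
        case True
        have "(\<integral>\<^sup>+\<omega>. ennreal (exp (s * S a (Suc T) \<omega>)) \<partial>M) =
            (\<integral>\<^sup>+\<omega>. ennreal (exp (s * S a T \<omega>)) * ennreal (exp (s * V T \<omega>)) \<partial>M)"
          using True by (simp add: S_Suc ennreal_mult'[symmetric] exp_add[symmetric] distrib_left)
        also have "\<dots> \<le> ennreal (exp (s * \<epsilon>)) * (\<integral>\<^sup>+\<omega>. ennreal (exp (s * S a T \<omega>)) \<partial>M)"
          using S_F[of T] True Suc by (intro mgf_s) (auto simp: order_le_less_trans)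
        also have "\<dots> \<le> ennreal (exp (s * \<epsilon>)) * ennreal (exp (s * \<epsilon> * real T))"
          using Suc by (intro mult_left_mono) auto
        also have "\<dots> = ennreal (exp (s * \<epsilon> * real (Suc T)))"
          by (simp add: ennreal_mult'[symmetric] exp_add[symmetric] algebra_simps)
        finally show ?thesis .
      qed
    qed
    have tail: "emeasure M {\<omega>\<in>space M. 2 * \<epsilon> * real T \<le> S a T \<omega>} \<le> ennreal (exp (- (s * \<epsilon>)) ^ T)" for a T
    proof -
      have "emeasure M {\<omega>\<in>space M. 2 * \<epsilon> * real T \<le> S a T \<omega>} =
          (\<integral>\<^sup>+\<omega>. indicator {\<omega>\<in>space M. 2 * \<epsilon> * real T \<le> S a T \<omega>} \<omega> \<partial>M)"
        by simp
      also have "\<dots> \<le> (\<integral>\<^sup>+\<omega>. ennreal (exp (- (2 * s * \<epsilon> * real T))) * ennreal (exp (s * S a T \<omega>)) \<partial>M)"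
      proof (intro nn_integral_mono)
        fix \<omega>
        show "indicator {\<omega>\<in>space M. 2 * \<epsilon> * real T \<le> S a T \<omega>} \<omega> \<le>
            ennreal (exp (- (2 * s * \<epsilon> * real T))) * ennreal (exp (s * S a T \<omega>))"
        proof (cases "2 * \<epsilon> * real T \<le> S a T \<omega>")
          case True
          then have "s * (2 * \<epsilon> * real T) \<le> s * S a T \<omega>" using s by (intro mult_left_mono) auto
          then have "1 \<le> exp (- (2 * s * \<epsilon> * real T) + s * S a T \<omega>)" by (simp add: algebra_simps)
          then show ?thesis
            by (auto simp: indicator_def ennreal_mult'[symmetric] exp_add[symmetric])
        qed simp
      qed
      also have "\<dots> = ennreal (exp (- (2 * s * \<epsilon> * real T))) * (\<integral>\<^sup>+\<omega>. ennreal (exp (s * S a T \<omega>)) \<partial>M)"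
        by (intro nn_integral_cmult) measurable
      also have "\<dots> \<le> ennreal (exp (- (2 * s * \<epsilon> * real T))) * ennreal (exp (s * \<epsilon> * real T))"
        by (intro mult_left_mono bound) auto
      also have "\<dots> = ennreal (exp (- (s * \<epsilon>)) ^ T)"
        by (simp add: ennreal_mult'[symmetric] exp_add[symmetric] exp_of_nat_mult[symmetric] algebra_simps)
      finally show ?thesis .
    qed
    define Bad where "Bad T = {\<omega>\<in>space M. 2 * real L * \<epsilon> * real T < (\<Sum>n<T. V n \<omega>)}" for T
    have Bad_M [measurable]: "Bad T \<in> sets M" for T
      unfolding Bad_def by measurable
    have Bad_le: "measure M (Bad T) \<le> real L * exp (- (s * \<epsilon>)) ^ T" for T
    proof -
      have sub: "Bad T \<subseteq> (\<Union>a<L. {\<omega>\<in>space M. 2 * \<epsilon> * real T \<le> S a T \<omega>})"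
      proof
        fix \<omega> assume \<omega>: "\<omega> \<in> Bad T"
        show "\<omega> \<in> (\<Union>a<L. {\<omega>\<in>space M. 2 * \<epsilon> * real T \<le> S a T \<omega>})"
        proof (rule ccontr)
          assume "\<not> ?thesis"
          then have "S a T \<omega> \<le> 2 * \<epsilon> * real T" if "a < L" for a
            using \<omega> that by (auto simp: Bad_def not_le intro: less_imp_le)
          then have "(\<Sum>a<L. S a T \<omega>) \<le> (\<Sum>a<L. 2 * \<epsilon> * real T)"
            by (intro sum_mono) auto
          then show False using \<omega> by (auto simp: Bad_def sum_S algebra_simps)
        qed
      qed
      have "emeasure M (Bad T) \<le> emeasure M (\<Union>a<L. {\<omega>\<in>space M. 2 * \<epsilon> * real T \<le> S a T \<omega>})"
        by (rule emeasure_mono[OF sub]) measurable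
      also have "\<dots> \<le> (\<Sum>a<L. emeasure M {\<omega>\<in>space M. 2 * \<epsilon> * real T \<le> S a T \<omega>})"
        by (intro emeasure_subadditive_finite) auto
      also have "\<dots> \<le> (\<Sum>a<L. ennreal (exp (- (s * \<epsilon>)) ^ T))"
        by (intro sum_mono tail)
      also have "\<dots> = ennreal (real L * exp (- (s * \<epsilon>)) ^ T)"
        by (subst sum_ennreal) auto
      finally show ?thesis
        by (simp add: emeasure_eq_measure ennreal_le_iff)
    qed
    have "summable (\<lambda>T. real L * exp (- (s * \<epsilon>)) ^ T)"
      using s \<epsilon> by (intro summable_mult summable_geometric) auto
    then have "summable (\<lambda>T. measure M (Bad T))"
      by (rule summable_comparison_test'[where N = 0]) (use Bad_le in auto)
    then have "AE \<omega> in M. \<forall>\<^sub>F T in sequentially. \<omega> \<in> space M - Bad T"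
      by (intro borel_cantelli_AE1) (auto simp: emeasure_eq_measure)
    then show ?thesis
      by (rule AE_mp) (auto simp: Bad_def not_less elim: eventually_mono)
  qed
  \<comment> \<open>Countably many slopes \<open>1 / (j + 1)\<close> bring the quantifier over
    \<open>\<epsilon>\<close> inside the almost sure statement.\<close>
  have "AE \<omega> in M. \<forall>j. \<forall>\<^sub>F T in sequentially.
      (\<Sum>n<T. V n \<omega>) \<le> 2 * real L * (1 / (2 * real L * real (Suc j))) * real T"
    unfolding AE_all_countable using L by (intro allI ev) simp
  then show ?thesis
  proof (rule AE_mp, intro AE_I2 impI allI)
    fix \<omega> and \<epsilon> :: real assume *: "\<forall>j. \<forall>\<^sub>F T in sequentially.
      (\<Sum>n<T. V n \<omega>) \<le> 2 * real L * (1 / (2 * real L * real (Suc j))) * real T" and \<epsilon>: "0 < \<epsilon>"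
    obtain j where j: "1 / real (Suc j) < \<epsilon>" using \<epsilon> nat_approx_posE by blast
    have "\<forall>\<^sub>F T in sequentially. (\<Sum>n<T. V n \<omega>) \<le> 1 / real (Suc j) * real T"
      using *[rule_format, of j] L by simp
    then show "\<forall>\<^sub>F T in sequentially. (\<Sum>n<T. V n \<omega>) \<le> \<epsilon> * real T"
    proof eventually_elim
      case (elim T)
      have "1 / real (Suc j) * real T \<le> \<epsilon> * real T"
        using j by (intro mult_right_mono) auto
      with elim show ?case by linarith
    qed
  qed
qed

end

lemma exp_le_quadratic:
  fixes x :: real
  assumes "\<bar>x\<bar> \<le> 1"
  shows "exp x \<le> 1 + x + x\<^sup>2"
proof (cases "0 \<le> x")
  case True
  then show ?thesis using assms by (intro exp_bound) auto
next
  case False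
  have "exp x = 1 / exp (- x)" by (simp add: exp_minus field_simps)
  also have "\<dots> \<le> 1 / (1 - x)"
    using False exp_ge_add_one_self[of "-x"] by (intro divide_left_mono) auto
  also have "\<dots> \<le> 1 + x + x\<^sup>2"
  proof -
    have "x ^ 3 \<le> 0" using False by (simp add: power_le_zero_eq)
    then have "1 \<le> (1 + x + x\<^sup>2) * (1 - x)"
      by (simp add: algebra_simps power2_eq_square power3_eq_cube)
    then show ?thesis using False by (simp add: divide_simps)
  qed
  finally show ?thesis .
qed

context switching_walk
begin

text \<open>In the expansion of \<open>exp (s * (A n - B n))\<close> the first-order term is
  nonpositive in conditional mean, and the quadratic remainder is at most \<open>s\<^sup>2\<close>,
  hence at most \<open>s * \<epsilon>\<close> for \<open>s \<le> \<epsilon>\<close>.\<close>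

lemma bounded_strong_law:
  fixes A B :: "nat \<Rightarrow> 'a \<Rightarrow> real"
  assumes L: "0 < L" and A: "\<And>n. A n \<in> borel_measurable (F (n + L))" and B: "\<And>n. B n \<in> borel_measurable (F (n + L))"
    and A01: "\<And>n \<omega>. 0 \<le> A n \<omega>" "\<And>n \<omega>. A n \<omega> \<le> 1" and B01: "\<And>n \<omega>. 0 \<le> B n \<omega>" "\<And>n \<omega>. B n \<omega> \<le> 1"
    and le: "\<And>n H. H \<in> borel_measurable (F n) \<Longrightarrow> (\<integral>\<^sup>+\<omega>. H \<omega> \<partial>M) < \<infinity> \<Longrightarrow>
      (\<integral>\<^sup>+\<omega>. H \<omega> * ennreal (A n \<omega>) \<partial>M) \<le> (\<integral>\<^sup>+\<omega>. H \<omega> * ennreal (B n \<omega>) \<partial>M)"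
  shows "AE \<omega> in M. \<forall>\<epsilon>>0. \<forall>\<^sub>F T in sequentially. (\<Sum>n<T. A n \<omega> - B n \<omega>) \<le> \<epsilon> * real T"
proof (rule lagged_strong_law[OF L])
  show "(\<lambda>\<omega>. A n \<omega> - B n \<omega>) \<in> borel_measurable (F (n + L))" for n
    using A B by (rule borel_measurable_diff)
  fix \<epsilon> :: real assume \<epsilon>: "0 < \<epsilon>"
  define s where "s = min 1 \<epsilon>"
  have s: "0 < s" "s \<le> 1" "s \<le> \<epsilon>" using \<epsilon> by (auto simp: s_def)
  show "\<exists>s>0. \<forall>n. \<forall>H\<in>borel_measurable (F n). (\<integral>\<^sup>+\<omega>. H \<omega> \<partial>M) < \<infinity> \<longrightarrow>
      (\<integral>\<^sup>+\<omega>. H \<omega> * ennreal (exp (s * (A n \<omega> - B n \<omega>))) \<partial>M) \<le> ennreal (exp (s * \<epsilon>)) * (\<integral>\<^sup>+\<omega>. H \<omega> \<partial>M)"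
  proof (intro exI[of _ s] conjI allI ballI impI s(1))
    fix n H assume H: "H \<in> borel_measurable (F n)" and fin: "(\<integral>\<^sup>+\<omega>. H \<omega> \<partial>M) < \<infinity>"
    note [measurable] = measurable_F_M[OF H] measurable_F_M[OF A] measurable_F_M[OF B]
    have "(\<integral>\<^sup>+\<omega>. H \<omega> * ennreal (B n \<omega>) \<partial>M) \<le> (\<integral>\<^sup>+\<omega>. H \<omega> * 1 \<partial>M)"
      by (intro nn_integral_mono mult_left_mono) (use B01 in auto)
    with fin have finB: "(\<integral>\<^sup>+\<omega>. H \<omega> * ennreal (B n \<omega>) \<partial>M) < \<infinity>"
      by (simp add: order_le_less_trans)
    \<comment> \<open>Each first-order term stands on the side where it is added, since subtraction
      in \<open>ennreal\<close> is not reversible; \<open>finB\<close> permits the cancellation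
      after integrating.\<close>
    have pt: "ennreal (exp (s * (A n \<omega> - B n \<omega>))) + ennreal s * ennreal (B n \<omega>) \<le>
        ennreal (exp (s * \<epsilon>)) + ennreal s * ennreal (A n \<omega>)" for \<omega>
    proof -
      have AB: "\<bar>A n \<omega> - B n \<omega>\<bar> \<le> 1" using A01[of n \<omega>] B01[of n \<omega>] by linarith
      have "\<bar>s * (A n \<omega> - B n \<omega>)\<bar> \<le> s * 1"
        unfolding abs_mult using AB s by (auto intro: mult_left_mono)
      then have "exp (s * (A n \<omega> - B n \<omega>)) \<le> 1 + s * (A n \<omega> - B n \<omega>) + (s * (A n \<omega> - B n \<omega>))\<^sup>2"
        using s by (intro exp_le_quadratic) linarith
      also have "(s * (A n \<omega> - B n \<omega>))\<^sup>2 \<le> s\<^sup>2"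
        using \<open>\<bar>s * (A n \<omega> - B n \<omega>)\<bar> \<le> s * 1\<close> s by (intro power2_le_iff_abs_le[THEN iffD2]) auto
      also have "s\<^sup>2 \<le> s * \<epsilon>" using s by (simp add: power2_eq_square)
      finally have "exp (s * (A n \<omega> - B n \<omega>)) + s * B n \<omega> \<le> exp (s * \<epsilon>) + s * A n \<omega>"
        using exp_ge_add_one_self[of "s * \<epsilon>"] unfolding right_diff_distrib by linarith
      then show ?thesis
        using s A01[of n \<omega>] B01[of n \<omega>]
        by (simp add: ennreal_mult[symmetric] ennreal_plus[symmetric] del: ennreal_plus)
    qed
    let ?I = "\<integral>\<^sup>+\<omega>. H \<omega> * ennreal (exp (s * (A n \<omega> - B n \<omega>))) \<partial>M"
    have "?I + ennreal s * (\<integral>\<^sup>+\<omega>. H \<omega> * ennreal (B n \<omega>) \<partial>M) =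
        (\<integral>\<^sup>+\<omega>. H \<omega> * (ennreal (exp (s * (A n \<omega> - B n \<omega>))) + ennreal s * ennreal (B n \<omega>)) \<partial>M)"
      by (subst nn_integral_cmult[symmetric], measurable, subst nn_integral_add[symmetric], measurable)
        (simp add: distrib_left mult_ac)
    also have "\<dots> \<le> (\<integral>\<^sup>+\<omega>. H \<omega> * (ennreal (exp (s * \<epsilon>)) + ennreal s * ennreal (A n \<omega>)) \<partial>M)"
      by (intro nn_integral_mono mult_left_mono pt) auto
    also have "\<dots> = ennreal (exp (s * \<epsilon>)) * (\<integral>\<^sup>+\<omega>. H \<omega> \<partial>M) + ennreal s * (\<integral>\<^sup>+\<omega>. H \<omega> * ennreal (A n \<omega>) \<partial>M)"
      by (subst nn_integral_cmult[symmetric], measurable, subst nn_integral_cmult[symmetric], measurable,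
          subst nn_integral_add[symmetric], measurable) (simp add: distrib_left mult_ac)
    also have "\<dots> \<le> ennreal (exp (s * \<epsilon>)) * (\<integral>\<^sup>+\<omega>. H \<omega> \<partial>M) + ennreal s * (\<integral>\<^sup>+\<omega>. H \<omega> * ennreal (B n \<omega>) \<partial>M)"
      by (intro add_left_mono mult_left_mono le[OF H fin]) auto
    finally show "?I \<le> ennreal (exp (s * \<epsilon>)) * (\<integral>\<^sup>+\<omega>. H \<omega> \<partial>M)"
      using finB by (subst (asm) ennreal_add_left_cancel_le[symmetric, of "ennreal s * (\<integral>\<^sup>+\<omega>. H \<omega> * ennreal (B n \<omega>) \<partial>M)"] add.commute)
        (auto simp: add.commute ennreal_mult_eq_top_iff)
  qed
qed

text \<open>The increments are unbounded, so the exponential moment bound is assumed. It is assumed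
  for all small \<open>s\<close> because one \<open>s\<close> must serve both regimes.\<close>

lemma regime_strong_law:
  fixes u :: "bool \<Rightarrow> real \<Rightarrow> real"
  assumes u: "\<And>i. u i \<in> borel_measurable borel"
    and mgf: "\<And>i \<epsilon>. 0 < \<epsilon> \<Longrightarrow> \<forall>\<^sub>F s in at_right 0. (\<integral>\<^sup>+y. ennreal (exp (s * (u i y - \<epsilon>))) \<partial>R i) \<le> 1"
  shows "AE \<omega> in M. \<forall>\<epsilon>>0. \<forall>\<^sub>F T in sequentially. (\<Sum>n<T. u (J n \<omega>) (Y n \<omega>)) \<le> \<epsilon> * real T"
proof (rule lagged_strong_law[of 1])
  have u_if: "u j y = (if j then u True y else u False y)" for j y by simp
  note [measurable] = u measurable_J[of n n for n]
  show "(\<lambda>\<omega>. u (J n \<omega>) (Y n \<omega>)) \<in> borel_measurable (F (n + 1))" for n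
  proof -
    have [measurable]: "Measurable.pred (F (n+1)) (J n)" "Y n \<in> borel_measurable (F (n+1))"
      using measurable_J[of n "n+1"] measurable_Y[of n "n+1"] by auto
    show ?thesis by (subst u_if) measurable
  qed
  fix \<epsilon> :: real assume \<epsilon>: "0 < \<epsilon>"
  have "\<forall>\<^sub>F s in at_right (0::real). 0 < s" by (rule eventually_at_right_less)
  with mgf[OF \<epsilon>, of True] mgf[OF \<epsilon>, of False]
  have "\<forall>\<^sub>F s in at_right 0. 0 < s \<and> (\<forall>i. (\<integral>\<^sup>+y. ennreal (exp (s * (u i y - \<epsilon>))) \<partial>R i) \<le> 1)"
    by eventually_elim (simp add: all_bool_eq)
  then obtain s where s: "0 < s" and le: "\<And>i. (\<integral>\<^sup>+y. ennreal (exp (s * (u i y - \<epsilon>))) \<partial>R i) \<le> 1"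
    using eventually_happens'[OF trivial_limit_at_right_real] by blast
  have le': "(\<integral>\<^sup>+y. ennreal (exp (s * u i y)) \<partial>R i) \<le> ennreal (exp (s * \<epsilon>))" for i
  proof -
    have "(\<integral>\<^sup>+y. ennreal (exp (s * u i y)) \<partial>R i) =
        (\<integral>\<^sup>+y. ennreal (exp (s * \<epsilon>)) * ennreal (exp (s * (u i y - \<epsilon>))) \<partial>R i)"
      by (simp add: ennreal_mult'[symmetric] exp_add[symmetric] algebra_simps)
    also have "\<dots> = ennreal (exp (s * \<epsilon>)) * (\<integral>\<^sup>+y. ennreal (exp (s * (u i y - \<epsilon>))) \<partial>R i)"
      by (intro nn_integral_cmult) measurable
    also have "\<dots> \<le> ennreal (exp (s * \<epsilon>)) * 1"
      by (intro mult_left_mono le) auto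
    finally show ?thesis by simp
  qed
  show "\<exists>s>0. \<forall>n. \<forall>H\<in>borel_measurable (F n). (\<integral>\<^sup>+\<omega>. H \<omega> \<partial>M) < \<infinity> \<longrightarrow>
      (\<integral>\<^sup>+\<omega>. H \<omega> * ennreal (exp (s * u (J n \<omega>) (Y n \<omega>))) \<partial>M) \<le> ennreal (exp (s * \<epsilon>)) * (\<integral>\<^sup>+\<omega>. H \<omega> \<partial>M)"
  proof (intro exI[of _ s] conjI allI ballI impI s(1))
    fix n and H :: "'a \<Rightarrow> ennreal" assume H: "H \<in> borel_measurable (F n)"
    define f where "f z = ennreal (exp (s * u (J n (fst z)) (snd z)))" for z :: "'a \<times> real"
    have f: "f \<in> borel_measurable (F n \<Otimes>\<^sub>M borel)"
      unfolding f_def by (subst u_if) measurable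
    have "(\<integral>\<^sup>+\<omega>. H \<omega> * f (\<omega>, Y n \<omega>) \<partial>M) = (\<integral>\<^sup>+\<omega>. H \<omega> * (\<integral>\<^sup>+y. f (\<omega>, y) \<partial>R (J n \<omega>)) \<partial>M)"
      by (rule step_mult[OF f H])
    also have "\<dots> \<le> (\<integral>\<^sup>+\<omega>. H \<omega> * ennreal (exp (s * \<epsilon>)) \<partial>M)"
      by (intro nn_integral_mono mult_left_mono) (auto simp: f_def le')
    also have "\<dots> = ennreal (exp (s * \<epsilon>)) * (\<integral>\<^sup>+\<omega>. H \<omega> \<partial>M)"
      by (subst mult.commute, intro nn_integral_cmult measurable_F_M[OF H])
    finally show "(\<integral>\<^sup>+\<omega>. H \<omega> * ennreal (exp (s * u (J n \<omega>) (Y n \<omega>))) \<partial>M) \<le>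
        ennreal (exp (s * \<epsilon>)) * (\<integral>\<^sup>+\<omega>. H \<omega> \<partial>M)"
      by (simp add: f_def)
  qed
qed simp

end

section \<open>The fraction of time in the bad regime\<close>

lemma sum_shift_diff_le:
  fixes f :: "nat \<Rightarrow> real"
  assumes "\<And>n. 0 \<le> f n" "\<And>n. f n \<le> 1"
  shows "(\<Sum>n<T. f (n + L) - f n) \<le> real L"
proof -
  have split: "sum f {..<a + b} = sum f {..<a} + (\<Sum>n<b. f (a + n))" for a b
    by (induction b) auto
  have "(\<Sum>n<T. f (n + L)) + sum f {..<L} = sum f {..<L + T}"
    by (subst split) (simp add: add.commute)
  also have "{..<L + T} = {..<T + L}" by (simp add: add.commute)
  also have "sum f {..<T + L} = sum f {..<T} + (\<Sum>n<L. f (T + n))"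
    by (rule split)
  also have "(\<Sum>n<L. f (T + n)) \<le> (\<Sum>n<L. 1)"
    by (intro sum_mono assms)
  finally show ?thesis
    using sum_nonneg[of "{..<L}" f] assms by (simp add: sum_subtractf)
qed

text \<open>Each index lies in at most \<open>L\<close> of the windows. The shift by
  \<open>N\<close> on the right costs at most \<open>N\<close> and matches the form in which the
  crossing rate is known: a crossing at \<open>n + N\<close> is estimated from the history up to
  \<open>n\<close>.\<close>

lemma sum_window_le:
  fixes c :: "nat \<Rightarrow> real"
  assumes c: "\<And>n. 0 \<le> c n" "\<And>n. c n \<le> 1"
  shows "(\<Sum>n<T. \<Sum>k<L. c (n + k)) \<le> real L * (real N + (\<Sum>n<T + L. c (n + N)))"
proof -
  have total: "(\<Sum>n<T + L. c n) \<le> real N + (\<Sum>n<T + L. c (n + N))"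
    using sum_shift_diff_le[of "\<lambda>n. 1 - c n" N "T + L"] c by (simp add: sum_subtractf)
  have "(\<Sum>n<T. \<Sum>k<L. c (n + k)) = (\<Sum>k<L. \<Sum>n<T. c (n + k))"
    by (rule sum.swap)
  also have "\<dots> \<le> (\<Sum>k<L. \<Sum>n<T + L. c n)"
  proof (intro sum_mono)
    fix k assume k: "k \<in> {..<L}"
    have "(\<Sum>n<T. c (n + k)) = (\<Sum>n\<in>(\<lambda>n. n + k) ` {..<T}. c n)"
      by (subst sum.reindex) auto
    also have "\<dots> \<le> (\<Sum>n<T + L. c n)"
      by (intro sum_mono2) (use k c in auto)
    finally show "(\<Sum>n<T. c (n + k)) \<le> (\<Sum>n<T + L. c n)" .
  qed
  also have "\<dots> = real L * (\<Sum>n<T + L. c n)" by simp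
  also have "\<dots> \<le> real L * (real N + (\<Sum>n<T + L. c (n + N)))"
    by (intro mult_left_mono total) simp
  finally show ?thesis .
qed

text \<open>The balance is \<open>v n * f (n + L) = (f (n + L) - f n) + f n * v (n + L)\<close>. The
  bracket telescopes up to a boundary term, so gains of freshness are paid for by losses, and each
  loss is charged to a crossing counted by \<open>c\<close>.\<close>

lemma sum_escape_le:
  fixes f c v :: "nat \<Rightarrow> real"
  assumes f: "\<And>n. 0 \<le> f n" "\<And>n. f n \<le> 1" and v: "\<And>n. v n = 1 - f n"
    and c: "\<And>n. 0 \<le> c n" "\<And>n. c n \<le> 1"
    and cross: "\<And>n. f n * v (n + L) \<le> (\<Sum>k<L. c (n + k))"
    and p: "0 < p"
    and e1: "(\<Sum>n<T. p * v n - v n * f (n + L)) \<le> e * real T"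
    and e2: "(\<Sum>n<T + L. c (n + N) - q) \<le> e * real (T + L)"
  shows "p * (\<Sum>n<T. v n) \<le> (e + real L * (q + e)) * real T + (real L + real L * (real N + (q + e) * real L))"
proof -
  have "p * (\<Sum>n<T. v n) \<le> e * real T + (\<Sum>n<T. v n * f (n + L))"
    using e1 by (simp add: sum_subtractf sum_distrib_left)
  also have "(\<Sum>n<T. v n * f (n + L)) = (\<Sum>n<T. f (n + L) - f n) + (\<Sum>n<T. f n * v (n + L))"
    unfolding sum.distrib[symmetric] by (intro sum.cong) (auto simp: v algebra_simps)
  also have "\<dots> \<le> real L + (\<Sum>n<T. \<Sum>k<L. c (n + k))"
    by (intro add_mono sum_shift_diff_le sum_mono cross f)
  also have "\<dots> \<le> real L + real L * (real N + (\<Sum>n<T + L. c (n + N)))"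
    by (intro add_left_mono sum_window_le c)
  also have "\<dots> \<le> real L + real L * (real N + (q + e) * real (T + L))"
    using e2 by (intro add_left_mono mult_left_mono) (auto simp: sum_subtractf algebra_simps)
  finally show ?thesis by (simp add: algebra_simps)
qed

section \<open>Freshness and the occupation time of the bad regime\<close>

context switching_walk
begin

text \<open>Truncated subtraction cuts the window off at time 0, so time 0 is fresh
  vacuously.\<close>

definition fresh :: "nat \<Rightarrow> nat \<Rightarrow> 'a \<Rightarrow> bool" where
  "fresh N n \<omega> \<longleftrightarrow> (\<forall>k\<in>{n - N..<n}. J k \<omega>)"

lemma pred_fresh: "n \<le> m \<Longrightarrow> Measurable.pred (F m) (fresh N n)"
  unfolding fresh_def using measurable_J[of _ m]
  by (intro pred_intros_finite) auto

text \<open>Freshness persists as long as the regime is good. Losing it therefore requires a first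
  bad time, and the walk is still fresh at that time.\<close>

lemma fresh_cross:
  fixes f c :: "nat \<Rightarrow> real" and \<omega> :: 'a and N :: nat
  defines "f \<equiv> \<lambda>n. of_bool (fresh N n \<omega>)" and "c \<equiv> \<lambda>n. of_bool (fresh N n \<omega> \<and> \<not> J n \<omega>)"
  shows "f n * (1 - f (n + L)) \<le> (\<Sum>k<L. c (n + k))"
proof (cases "\<exists>k<L. c (n + k) = 1")
  case True
  then obtain k where k: "k < L" "c (n + k) = 1" by blast
  have "1 = c (n + k)" using k by simp
  also have "\<dots> \<le> (\<Sum>k<L. c (n + k))"
    by (rule member_le_sum) (use k in \<open>auto simp: c_def\<close>)
  finally show ?thesis by (auto simp: f_def)
next
  case False
  show ?thesis
  proof (cases "fresh N n \<omega>")
    case True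
    have "k \<le> L \<Longrightarrow> fresh N (n + k) \<omega>" for k
    proof (induction k)
      case (Suc k)
      then have fr: "fresh N (n + k) \<omega>" by simp
      with False Suc have Jk: "J (n + k) \<omega>" by (auto simp: c_def)
      show ?case unfolding fresh_def
      proof
        fix j assume "j \<in> {n + Suc k - N..<n + Suc k}"
        then have "j = n + k \<or> j \<in> {n + k - N..<n + k}" by auto
        then show "J j \<omega>" using fr Jk by (auto simp: fresh_def)
      qed
    qed (use True in simp)
    from this[of L] show ?thesis by (auto simp: f_def c_def intro: sum_nonneg)
  next
    case False
    then show ?thesis by (auto simp: f_def c_def intro: sum_nonneg)
  qed
qed

text \<open>A bad time is either stale or a crossing out of a fresh state. Staleness ends within
  \<open>2 * N\<close> steps with probability at least \<open>p\<close>, and it begins only through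
  a crossing. A crossing is seen by up to \<open>2 * N\<close> overlapping windows, which produces
  the factor \<open>2 * real N\<close> in front of \<open>q / p\<close>; the summand
  \<open>q\<close> counts the crossings themselves.\<close>

lemma regime_fraction:
  assumes N: "1 \<le> N" and p: "0 < p" "p \<le> 1" and q: "0 \<le> q" "q \<le> 1"
    and escape: "\<And>n H. H \<in> borel_measurable (F n) \<Longrightarrow> (\<integral>\<^sup>+\<omega>. H \<omega> \<partial>M) < \<infinity> \<Longrightarrow>
      ennreal p * (\<integral>\<^sup>+\<omega>. H \<omega> \<partial>M) \<le> (\<integral>\<^sup>+\<omega>. H \<omega> * ennreal (of_bool (fresh N (n + 2 * N) \<omega>)) \<partial>M)"
    and cross: "\<And>n H. H \<in> borel_measurable (F n) \<Longrightarrow> (\<integral>\<^sup>+\<omega>. H \<omega> \<partial>M) < \<infinity> \<Longrightarrow>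
      (\<integral>\<^sup>+\<omega>. H \<omega> * ennreal (of_bool (fresh N (n + N) \<omega> \<and> \<not> J (n + N) \<omega>)) \<partial>M) \<le> ennreal q * (\<integral>\<^sup>+\<omega>. H \<omega> \<partial>M)"
  shows "AE \<omega> in M. \<forall>\<epsilon>>0. \<forall>\<^sub>F T in sequentially.
    (\<Sum>n<T. of_bool (\<not> J n \<omega>)) \<le> (2 * real N * q / p + q + \<epsilon>) * real T"
proof -
  define f where "f \<omega> n = (of_bool (fresh N n \<omega>) :: real)" for \<omega> n
  define c where "c \<omega> n = (of_bool (fresh N n \<omega> \<and> \<not> J n \<omega>) :: real)" for \<omega> n
  define L where "L = 2 * N"
  have L: "0 < L" using N by (simp add: L_def)
  have mf: "(\<lambda>\<omega>. f \<omega> n) \<in> borel_measurable (F m)" if "n \<le> m" for n m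
    unfolding f_def using pred_fresh[OF that] by measurable
  have mc: "(\<lambda>\<omega>. c \<omega> n) \<in> borel_measurable (F m)" if "n \<le> m" for n m
    unfolding c_def using pred_fresh[OF that] measurable_J[OF that] by measurable
  have one: "AE \<omega> in M. \<forall>\<epsilon>>0. \<forall>\<^sub>F T in sequentially.
      (\<Sum>n<T. p * (1 - f \<omega> n) - (1 - f \<omega> n) * f \<omega> (n + L)) \<le> \<epsilon> * real T"
  proof (rule bounded_strong_law[OF L])
    show "(\<lambda>\<omega>. p * (1 - f \<omega> n)) \<in> borel_measurable (F (n + L))"
      "(\<lambda>\<omega>. (1 - f \<omega> n) * f \<omega> (n + L)) \<in> borel_measurable (F (n + L))" for n
      using mf[of n "n + L"] mf[of "n + L" "n + L"] by measurable
    fix n and H :: "'a \<Rightarrow> ennreal"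
    assume H: "H \<in> borel_measurable (F n)" and fin: "(\<integral>\<^sup>+\<omega>. H \<omega> \<partial>M) < \<infinity>"
    \<comment> \<open>The escape bound holds for every weight, so the weight can be restricted to
      stale histories.\<close>
    let ?H = "\<lambda>\<omega>. H \<omega> * ennreal (1 - f \<omega> n)"
    have H': "?H \<in> borel_measurable (F n)"
      using H mf[of n n] by measurable
    have "(\<integral>\<^sup>+\<omega>. ?H \<omega> \<partial>M) \<le> (\<integral>\<^sup>+\<omega>. H \<omega> * 1 \<partial>M)"
      by (intro nn_integral_mono mult_left_mono) (auto simp: f_def)
    with fin have fin': "(\<integral>\<^sup>+\<omega>. ?H \<omega> \<partial>M) < \<infinity>" by (simp add: order_le_less_trans)
    have "(\<integral>\<^sup>+\<omega>. H \<omega> * ennreal (p * (1 - f \<omega> n)) \<partial>M) = (\<integral>\<^sup>+\<omega>. ennreal p * ?H \<omega> \<partial>M)"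
      using p by (intro nn_integral_cong) (auto simp: ennreal_mult' mult_ac)
    also have "\<dots> = ennreal p * (\<integral>\<^sup>+\<omega>. ?H \<omega> \<partial>M)"
      by (rule nn_integral_cmult[OF measurable_F_M[OF H']])
    also have "\<dots> \<le> (\<integral>\<^sup>+\<omega>. ?H \<omega> * ennreal (f \<omega> (n + L)) \<partial>M)"
      using escape[OF H' fin'] by (simp add: f_def L_def)
    also have "\<dots> = (\<integral>\<^sup>+\<omega>. H \<omega> * ennreal ((1 - f \<omega> n) * f \<omega> (n + L)) \<partial>M)"
      by (intro nn_integral_cong) (auto simp: f_def)
    finally show "(\<integral>\<^sup>+\<omega>. H \<omega> * ennreal (p * (1 - f \<omega> n)) \<partial>M) \<le>
        (\<integral>\<^sup>+\<omega>. H \<omega> * ennreal ((1 - f \<omega> n) * f \<omega> (n + L)) \<partial>M)" .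
  qed (use p in \<open>auto simp: f_def\<close>)
  have two: "AE \<omega> in M. \<forall>\<epsilon>>0. \<forall>\<^sub>F T in sequentially. (\<Sum>n<T. c \<omega> (n + N) - q) \<le> \<epsilon> * real T"
  proof (rule bounded_strong_law[of N])
    fix n and H :: "'a \<Rightarrow> ennreal"
    assume H: "H \<in> borel_measurable (F n)" and fin: "(\<integral>\<^sup>+\<omega>. H \<omega> \<partial>M) < \<infinity>"
    have "ennreal q * (\<integral>\<^sup>+\<omega>. H \<omega> \<partial>M) = (\<integral>\<^sup>+\<omega>. H \<omega> * ennreal q \<partial>M)"
      by (subst nn_integral_cmult[symmetric, OF measurable_F_M[OF H]]) (simp add: mult.commute)
    with cross[OF H fin] show "(\<integral>\<^sup>+\<omega>. H \<omega> * ennreal (c \<omega> (n + N)) \<partial>M) \<le> (\<integral>\<^sup>+\<omega>. H \<omega> * ennreal q \<partial>M)"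
      by (simp add: c_def)
  qed (use N q in \<open>auto simp: c_def[symmetric] intro: mc, auto simp: c_def\<close>)
  from one two show ?thesis
  proof eventually_elim
    case (elim \<omega>)
    show ?case
    proof (intro allI impI)
      fix \<epsilon> :: real assume \<epsilon>: "0 < \<epsilon>"
      \<comment> \<open>The denominator \<open>(1 + real L) / p + 1\<close> is the total coefficient
        of \<open>e * real T\<close> in the final estimate; the other half of
        \<open>\<epsilon>\<close> absorbs the constant \<open>C\<close>.\<close>
      define e where "e = \<epsilon> / 2 / ((1 + real L) / p + 1)"
      have den: "0 < (1 + real L) / p + 1" using p by (intro add_nonneg_pos) auto
      have e: "0 < e" "e * ((1 + real L) / p + 1) = \<epsilon> / 2"
        unfolding e_def using \<epsilon> den by (simp_all only: divide_pos_pos half_gt_zero nonzero_eq_divide_eq[symmetric] less_imp_neq[symmetric] not_False_eq_True)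
      define C where "C = (real L + real L * (real N + (q + e) * real L)) / p + real N"
      have ev1: "\<forall>\<^sub>F T in sequentially. (\<Sum>n<T. p * (1 - f \<omega> n) - (1 - f \<omega> n) * f \<omega> (n + L)) \<le> e * real T"
        using elim(1) e by blast
      have ev2: "\<forall>\<^sub>F T in sequentially. (\<Sum>n<T. c \<omega> (n + N) - q) \<le> e * real T"
        using elim(2) e by blast
      then have ev3: "\<forall>\<^sub>F T in sequentially. (\<Sum>n<T + L. c \<omega> (n + N) - q) \<le> e * real (T + L)"
        by (rule eventually_compose_filterlim) (rule filterlim_add_const_nat_at_top)
      have ev4: "\<forall>\<^sub>F T in sequentially. C \<le> \<epsilon> / 2 * real T"
        using eventually_ge_at_top[of "nat \<lceil>2 * C / \<epsilon>\<rceil>"]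
      proof eventually_elim
        case (elim T)
        then have "2 * C / \<epsilon> \<le> real T" by linarith
        then show ?case using \<epsilon> by (simp add: field_simps)
      qed
      from ev1 ev2 ev3 ev4 show "\<forall>\<^sub>F T in sequentially.
          (\<Sum>n<T. of_bool (\<not> J n \<omega>)) \<le> (2 * real N * q / p + q + \<epsilon>) * real T"
      proof eventually_elim
        case (elim T)
        have "p * (\<Sum>n<T. 1 - f \<omega> n) \<le>
            (e + real L * (q + e)) * real T + (real L + real L * (real N + (q + e) * real L))"
        proof (rule sum_escape_le[where c = "c \<omega>" and f = "f \<omega>"])
          show "f \<omega> n * (1 - f \<omega> (n + L)) \<le> (\<Sum>k<L. c \<omega> (n + k))" for n
            unfolding f_def c_def by (rule fresh_cross)
        qed (use p elim(1,3) in \<open>auto simp: f_def c_def\<close>)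
        then have v: "(\<Sum>n<T. 1 - f \<omega> n) \<le>
            ((e + real L * (q + e)) * real T + (real L + real L * (real N + (q + e) * real L))) / p"
          using p by (simp add: pos_le_divide_eq mult.commute)
        have "(\<Sum>n<T. c \<omega> n) \<le> real N + (\<Sum>n<T. c \<omega> (n + N))"
          using sum_shift_diff_le[of "\<lambda>n. 1 - c \<omega> n" N T] by (auto simp: sum_subtractf c_def)
        also have "\<dots> \<le> real N + (q + e) * real T"
          using elim(2) by (simp add: sum_subtractf algebra_simps)
        finally have c: "(\<Sum>n<T. c \<omega> n) \<le> real N + (q + e) * real T" .
        have "(\<Sum>n<T. of_bool (\<not> J n \<omega>)) \<le> (\<Sum>n<T. (1 - f \<omega> n) + c \<omega> n)"
          by (intro sum_mono) (auto simp: f_def c_def)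
        also have "\<dots> \<le> ((e + real L * (q + e)) * real T + (real L + real L * (real N + (q + e) * real L))) / p +
            (real N + (q + e) * real T)"
          using v c by (simp add: sum.distrib)
        also have "\<dots> = (2 * real N * q / p + q + e * ((1 + real L) / p + 1)) * real T + C"
          using p by (simp add: C_def L_def field_simps)
        also have "\<dots> \<le> (2 * real N * q / p + q + \<epsilon>) * real T"
          using elim(4) unfolding e(2) by (simp add: algebra_simps)
        finally show ?case .
      qed
    qed
  qed
qed

end

section \<open>Escape from the bad regime by a change of measure\<close>

lemma prod_indicator_exp:
  assumes "finite A"
  shows "(\<Prod>k\<in>A. ennreal (indicator (S k) (y k) * exp (x k))) =
    ennreal (of_bool (\<forall>k\<in>A. y k \<in> S k) * exp (\<Sum>k\<in>A. x k))"
  using assms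
proof (induction A rule: finite_induct)
  case (insert k A)
  then show ?case
    by (auto simp: ennreal_mult'[symmetric] exp_add indicator_def)
qed simp

lemma sum_restrict_interval:
  fixes g :: "nat \<Rightarrow> real"
  assumes "m \<le> i" "j \<le> n"
  shows "(\<Sum>k=m..<n. if i \<le> k \<and> k < j then g k else 0) = (\<Sum>k=i..<j. g k)"
proof -
  have "(\<Sum>k=m..<n. if i \<le> k \<and> k < j then g k else 0) = (\<Sum>k\<in>{k\<in>{m..<n}. i \<le> k \<and> k < j}. g k)"
    by (subst sum.inter_filter) auto
  also have "{k\<in>{m..<n}. i \<le> k \<and> k < j} = {i..<j}" using assms by auto
  finally show ?thesis .
qed

section \<open>The controlled path: deterministic analysis\<close>

definition good_count :: "(nat \<Rightarrow> bool) \<Rightarrow> nat \<Rightarrow> nat \<Rightarrow> nat" where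
  "good_count g m n = card {k\<in>{m..<n}. g k}"

lemma good_count_Suc:
  "m \<le> n \<Longrightarrow> good_count g m (Suc n) = good_count g m n + of_bool (g n)"
proof -
  assume "m \<le> n"
  then have "{k\<in>{m..<Suc n}. g k} = {k\<in>{m..<n}. g k} \<union> (if g n then {n} else {})"
    by (auto simp: less_Suc_eq)
  then show ?thesis by (auto simp: good_count_def)
qed

lemma good_count_mono: "n \<le> n' \<Longrightarrow> good_count g m n \<le> good_count g m n'"
  unfolding good_count_def by (intro card_mono) auto

lemma good_count_split_le: "good_count g m n \<le> (m' - m) + good_count g m' n"
proof -
  have "{k\<in>{m..<n}. g k} \<subseteq> {m..<m'} \<union> {k\<in>{m'..<n}. g k}" by auto
  then have "card {k\<in>{m..<n}. g k} \<le> card ({m..<m'} \<union> {k\<in>{m'..<n}. g k})"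
    by (intro card_mono) auto
  also have "\<dots> \<le> card {m..<m'} + card {k\<in>{m'..<n}. g k}" by (rule card_Un_le)
  finally show ?thesis by (simp add: good_count_def)
qed

text \<open>
  The control used to steer the walk into the good regime. Its stage at time \<open>k\<close> is \<open>0\<close> in the bad
  regime; in the good regime it is \<open>1\<close> for the first \<open>K\<close> visits, where the increments are forced to
  be large, and \<open>2\<close> afterwards, where the dynamics is left unchanged.
\<close>

definition stage :: "(nat \<Rightarrow> bool) \<Rightarrow> nat \<Rightarrow> nat \<Rightarrow> nat \<Rightarrow> nat" where
  "stage g K m k = (if \<not> g k then 0 else if good_count g m k < K then 1 else 2)"

text \<open>The minimum is the inductive invariant: a step is forced exactly when it is good and
  fewer than \<open>K\<close> good steps precede it.\<close>

lemma sum_forced_le: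
  "m \<le> n \<Longrightarrow> (\<Sum>k=m..<n. of_bool (stage g K m k = 1)) \<le> min K (good_count g m n)"
proof (induction n rule: dec_induct)
  case (step n)
  then show ?case by (auto simp: good_count_Suc stage_def)
qed simp

text \<open>A window starting at \<open>n + m\<close> contains only controlled increments, whatever
  happened before \<open>n\<close>. If the bad stage drifts upwards, every window has drift at least
  \<open>\<delta> * N\<close>, which exceeds its fluctuation. In the degenerate case the drift of a
  window is \<open>c\<close> times its number \<open>w\<close> of good steps. Either this suffices,
  or there have been so few good steps since \<open>n\<close> that all of them are forced; then
  every increment is nonnegative and \<open>tie\<close> applies.\<close>

lemma controlled_path_stays_good:
  fixes g :: "nat \<Rightarrow> bool" and y :: "nat \<Rightarrow> real" and dom :: "nat \<Rightarrow> real set" and d :: "nat \<Rightarrow> real"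
  assumes dom: "\<And>k. k \<in> {n..<n+2*N} \<Longrightarrow> y k \<in> dom (stage g K n k)"
    and dev: "\<And>i j. n \<le> i \<Longrightarrow> j \<le> n + 2 * N \<Longrightarrow> (\<Sum>k=i..<j. d (stage g K n k) - y k) < \<delta> * real N"
    and rule: "\<And>m. 0 < (\<Sum>k=m..<m+N. y k) \<Longrightarrow> g (m + N)"
    and tie: "\<And>m. \<not> 0 < d 0 \<Longrightarrow> 0 \<le> (\<Sum>k=m..<m+N. y k) \<Longrightarrow> g (m + N)"
    and d: "d 1 = c" "d 2 = c" "dom 1 = {c..}" "0 < c" "\<delta> \<le> c"
    and d0: "0 < d 0 \<and> \<delta> \<le> d 0 \<or> d 0 = 0 \<and> dom 0 \<subseteq> {0}"
    and K: "2 * \<delta> * real N \<le> c * real K"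
    and m: "m \<le> N"
  shows "g (n + m + N)"
  using m
proof (induction m rule: less_induct)
  case (less m)
  let ?\<theta> = "stage g K n"
  define W where "W = {n+m..<n+m+N}"
  have dev': "(\<Sum>k\<in>W. d (?\<theta> k)) - \<delta> * real N < (\<Sum>k\<in>W. y k)"
    using dev[of "n+m" "n+m+N"] less.prems by (simp add: W_def sum_subtractf)
  show ?case
  proof (cases "0 < d 0")
    case True
    then have "\<delta> \<le> d (?\<theta> k)" for k using d d0 by (auto simp: stage_def)
    then have "(\<Sum>k\<in>W. \<delta>) \<le> (\<Sum>k\<in>W. d (?\<theta> k))" by (intro sum_mono)
    then have "\<delta> * real N \<le> (\<Sum>k\<in>W. d (?\<theta> k))" by (simp add: W_def mult.commute)
    with dev' have "0 < (\<Sum>k\<in>W. y k)" by linarith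
    then show ?thesis unfolding W_def by (rule rule)
  next
    case False
    then have d0': "d 0 = 0" "dom 0 \<subseteq> {0}" using d0 by auto
    define w where "w = good_count g (n+m) (n+m+N)"
    have "(\<Sum>k\<in>W. d (?\<theta> k)) = (\<Sum>k\<in>W. if g k then c else 0)"
      using d d0' by (intro sum.cong) (auto simp: stage_def)
    also have "\<dots> = c * real w"
      unfolding w_def good_count_def W_def by (subst sum.inter_filter[symmetric]) auto
    finally have drift: "(\<Sum>k\<in>W. d (?\<theta> k)) = c * real w" .
    show ?thesis
    proof (cases "\<delta> * real N \<le> c * real w")
      case True
      with dev' drift have "0 < (\<Sum>k\<in>W. y k)" by linarith
      then show ?thesis unfolding W_def by (rule rule)
    next
      case few: False
      \<comment> \<open>By induction the last \<open>m\<close> times of the window are good, so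
        \<open>m \<le> w\<close>. The at most \<open>m\<close> good steps before the window are
        thereby dominated by those inside it, and the total \<open>m + w \<le> 2 * w\<close> stays
        below \<open>K\<close>; this explains the factor 2 in \<open>K\<close>.\<close>
      have "{n+N..<n+N+m} \<subseteq> {k\<in>{n+m..<n+m+N}. g k}"
      proof
        fix k assume k: "k \<in> {n+N..<n+N+m}"
        then have "g (n + (k - (n + N)) + N)" using less.prems by (intro less.IH) auto
        then show "k \<in> {k\<in>{n+m..<n+m+N}. g k}" using k less.prems by (auto simp: algebra_simps)
      qed
      then have "card {n+N..<n+N+m} \<le> w" unfolding w_def good_count_def by (intro card_mono) auto
      then have mw: "m \<le> w" by simp
      have "c * (2 * real w) < c * real K" using few K by linarith
      then have wK: "2 * w < K" using d by simp
      have "0 \<le> y k" if k: "k \<in> W" for k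
      proof -
        have "good_count g n k \<le> good_count g n (n+m+N)"
          using k by (intro good_count_mono) (auto simp: W_def)
        also have "\<dots> \<le> m + w"
          using good_count_split_le[of g n "n+m+N" "n+m"] by (simp add: w_def)
        also have "\<dots> < K" using mw wK by simp
        finally have "?\<theta> k = 0 \<or> ?\<theta> k = 1" by (auto simp: stage_def)
        moreover have "y k \<in> dom (?\<theta> k)"
          using k less.prems by (intro dom) (auto simp: W_def)
        ultimately show "0 \<le> y k" using d d0' by auto
      qed
      then have "0 \<le> (\<Sum>k\<in>W. y k)" by (intro sum_nonneg)
      then show ?thesis unfolding W_def using False by (intro tie) auto
    qed
  qed
qed

text \<open>From time \<open>n + N\<close> on the regime is good, so at most \<open>N\<close> steps
  are tilted; at most \<open>K\<close> are forced, and unchanged steps cost nothing.\<close>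

lemma controlled_path_cost:
  fixes a :: "nat \<Rightarrow> real"
  assumes good: "\<And>m. m < N \<Longrightarrow> g (n + m + N)" and a: "0 \<le> a 0" "0 \<le> a 1" "a 2 = 0"
  shows "(\<Sum>k=n..<n+2*N. a (stage g K n k)) \<le> a 0 * real N + a 1 * real K"
proof -
  have "(\<Sum>k=n..<n+2*N. a (stage g K n k)) =
      (\<Sum>k=n..<n+2*N. a 0 * of_bool (\<not> g k) + a 1 * of_bool (stage g K n k = 1))"
    using a by (intro sum.cong) (auto simp: stage_def)
  also have "\<dots> = a 0 * (\<Sum>k=n..<n+2*N. of_bool (\<not> g k)) + a 1 * (\<Sum>k=n..<n+2*N. of_bool (stage g K n k = 1))"
    by (simp add: sum.distrib sum_distrib_left)
  also have "(\<Sum>k=n..<n+2*N. of_bool (\<not> g k) :: real) \<le> real N"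
  proof -
    have "g k" if "k \<in> {n+N..<n+2*N}" for k
      using good[of "k - (n + N)"] that by (auto simp: algebra_simps)
    then have "(\<Sum>k=n..<n+2*N. of_bool (\<not> g k) :: real) = (\<Sum>k=n..<n+N. of_bool (\<not> g k))"
      by (intro sum.mono_neutral_right) auto
    also have "\<dots> \<le> (\<Sum>k=n..<n+N. 1)" by (intro sum_mono) auto
    finally show ?thesis by simp
  qed
  also have "(\<Sum>k=n..<n+2*N. of_bool (stage g K n k = 1) :: real) \<le> real K"
  proof -
    have "(\<Sum>k=n..<n+2*N. of_bool (stage g K n k = 1)) \<le> min K (good_count g n (n+2*N))"
      by (rule sum_forced_le) simp
    then have "real (\<Sum>k=n..<n+2*N. of_bool (stage g K n k = 1)) \<le> real K"
      by (intro of_nat_mono) simp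
    then show ?thesis by simp
  qed
  finally show ?thesis using a by (auto intro: add_mono mult_left_mono)
qed

section \<open>Chernoff's bound for crossings and the change of measure for escapes\<close>

context switching_walk
begin

text \<open>At a crossing out of a fresh state, \<open>N\<close> good increments have nonpositive
  sum \<open>S\<close>, so \<open>exp (- t * S)\<close> is at least 1. The factor \<open>f k\<close>
  carries the indicator of the good regime; it vanishes on paths that visit the bad regime inside
  the window, and only the moment bound for \<open>R True\<close> is involved.\<close>

lemma crossing_le:
  assumes t: "0 \<le> t" and mgf: "(\<integral>\<^sup>+y. ennreal (exp (- (t * y))) \<partial>R True) \<le> ennreal (exp (- b))"
    and leave: "\<And>n \<omega>. \<omega> \<in> space M \<Longrightarrow> \<not> J (n + N) \<omega> \<Longrightarrow> (\<Sum>k=n..<n+N. Y k \<omega>) \<le> 0"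
    and H: "H \<in> borel_measurable (F n)"
  shows "(\<integral>\<^sup>+\<omega>. H \<omega> * ennreal (of_bool (fresh N (n + N) \<omega> \<and> \<not> J (n + N) \<omega>)) \<partial>M) \<le>
    ennreal (exp (- (b * real N))) * (\<integral>\<^sup>+\<omega>. H \<omega> \<partial>M)"
proof -
  define f where "f k z = ennreal (of_bool (J k (fst z)) * exp (b - t * snd z))" for k and z :: "'a \<times> real"
  have f: "f k \<in> borel_measurable (F k \<Otimes>\<^sub>M borel)" for k
    unfolding f_def using measurable_J[of k k] by measurable
  have "(\<integral>\<^sup>+y. ennreal (exp (b - t * y)) \<partial>R True) = (\<integral>\<^sup>+y. ennreal (exp b) * ennreal (exp (- (t * y))) \<partial>R True)"
    by (simp add: ennreal_mult'[symmetric] exp_add[symmetric])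
  also have "\<dots> = ennreal (exp b) * (\<integral>\<^sup>+y. ennreal (exp (- (t * y))) \<partial>R True)"
    by (intro nn_integral_cmult) measurable
  also have "\<dots> \<le> ennreal (exp b) * ennreal (exp (- b))"
    by (intro mult_left_mono mgf) simp
  also have "\<dots> = 1"
    by (simp add: ennreal_mult'[symmetric] exp_add[symmetric])
  finally have f1: "(\<integral>\<^sup>+y. f k (\<omega>, y) \<partial>R (J k \<omega>)) \<le> 1" for k \<omega>
    by (cases "J k \<omega>") (auto simp: f_def)
  have "(\<integral>\<^sup>+\<omega>. H \<omega> * ennreal (of_bool (fresh N (n + N) \<omega> \<and> \<not> J (n + N) \<omega>)) \<partial>M) \<le>
      (\<integral>\<^sup>+\<omega>. ennreal (exp (- (b * real N))) * (H \<omega> * (\<Prod>k=n..<n+N. f k (\<omega>, Y k \<omega>))) \<partial>M)"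
  proof (intro nn_integral_mono)
    fix \<omega> assume \<omega>: "\<omega> \<in> space M"
    have "ennreal (of_bool (fresh N (n + N) \<omega> \<and> \<not> J (n + N) \<omega>)) \<le>
        ennreal (exp (- (b * real N))) * (\<Prod>k=n..<n+N. f k (\<omega>, Y k \<omega>))"
    proof (cases "fresh N (n + N) \<omega> \<and> \<not> J (n + N) \<omega>")
      case True
      have "(\<Prod>k=n..<n+N. f k (\<omega>, Y k \<omega>)) = (\<Prod>k=n..<n+N. ennreal (indicator UNIV (Y k \<omega>) * exp (b - t * Y k \<omega>)))"
        using True by (intro prod.cong) (auto simp: f_def fresh_def)
      also have "\<dots> = ennreal (exp (\<Sum>k=n..<n+N. b - t * Y k \<omega>))"
        by (subst prod_indicator_exp) auto
      also have "(\<Sum>k=n..<n+N. b - t * Y k \<omega>) = b * real N - t * (\<Sum>k=n..<n+N. Y k \<omega>)"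
        by (simp add: sum_subtractf sum_distrib_left)
      finally have eq: "ennreal (exp (- (b * real N))) * (\<Prod>k=n..<n+N. f k (\<omega>, Y k \<omega>)) =
          ennreal (exp (- (t * (\<Sum>k=n..<n+N. Y k \<omega>))))"
        by (simp add: ennreal_mult'[symmetric] exp_add[symmetric])
      have "t * (\<Sum>k=n..<n+N. Y k \<omega>) \<le> 0"
        using t leave[OF \<omega>, of n] True by (intro mult_nonneg_nonpos) auto
      then show ?thesis unfolding eq using True by simp
    next
      case False
      then show ?thesis by auto
    qed
    from mult_left_mono[OF this, of "H \<omega>"]
    show "H \<omega> * ennreal (of_bool (fresh N (n + N) \<omega> \<and> \<not> J (n + N) \<omega>)) \<le>
        ennreal (exp (- (b * real N))) * (H \<omega> * (\<Prod>k=n..<n+N. f k (\<omega>, Y k \<omega>)))"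
      by (simp add: mult_ac)
  qed
  also have "\<dots> = ennreal (exp (- (b * real N))) * (\<integral>\<^sup>+\<omega>. H \<omega> * (\<Prod>k=n..<n+N. f k (\<omega>, Y k \<omega>)) \<partial>M)"
    by (intro nn_integral_cmult measurable_F_M[OF measurable_prod_eval[OF f H]])
  also have "\<dots> \<le> ennreal (exp (- (b * real N))) * (\<integral>\<^sup>+\<omega>. H \<omega> \<partial>M)"
    by (intro mult_left_mono nn_integral_prod_le f H f1) auto
  finally show ?thesis .
qed

lemma measurable_stage: "(\<lambda>\<omega>. stage (\<lambda>k. J k \<omega>) K n k) \<in> measurable (F k) (count_space UNIV)"
proof -
  have [measurable]: "Measurable.pred (F k) (J k)" by (rule measurable_J) simp
  have "(\<lambda>\<omega>. good_count (\<lambda>k. J k \<omega>) n k) = (\<lambda>\<omega>. \<Sum>j\<in>{n..<k}. of_bool (J j \<omega>))"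
    by (auto simp: good_count_def sum.inter_filter[symmetric] of_bool_def intro!: ext)
  moreover have "(\<lambda>\<omega>. \<Sum>j\<in>{n..<k}. of_bool (J j \<omega>) :: nat) \<in> measurable (F k) (count_space UNIV)"
  proof (rule measurable_sum_nat)
    fix j assume "j \<in> {n..<k}"
    then have [measurable]: "Measurable.pred (F k) (J j)" by (intro measurable_J) simp
    show "(\<lambda>\<omega>. of_bool (J j \<omega>) :: nat) \<in> measurable (F k) (count_space UNIV)" by measurable
  qed
  ultimately have [measurable]: "(\<lambda>\<omega>. good_count (\<lambda>k. J k \<omega>) n k) \<in> measurable (F k) (count_space UNIV)"
    by simp
  show ?thesis unfolding stage_def by measurable
qed


lemma measurable_staged:
  assumes "\<And>j. g j \<in> borel_measurable borel"
  shows "(\<lambda>z. g (stage (\<lambda>k. J k (fst z)) K n k) (snd z)) \<in> borel_measurable (F k \<Otimes>\<^sub>M borel)"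
proof (rule measurable_compose_countable)
  show "(\<lambda>z. g j (snd z)) \<in> borel_measurable (F k \<Otimes>\<^sub>M borel)" for j
    using assms by measurable
  show "(\<lambda>z. stage (\<lambda>k. J k (fst z)) K n k) \<in> measurable (F k \<Otimes>\<^sub>M borel) (count_space UNIV)"
    by (rule measurable_compose[OF measurable_fst measurable_stage])
qed

text \<open>The stage is nonzero exactly in the good regime, so the law
  \<open>R (j \<noteq> 0)\<close> attached to a stage is the law of the actual increment.\<close>

lemma stage_law:
  assumes "\<And>j. j \<in> {0, 1, 2} \<Longrightarrow> P j (R (j \<noteq> 0))"
  shows "P (stage (\<lambda>k. J k \<omega>) K n k) (R (J k \<omega>))"
  using assms[of 0] assms[of 1] assms[of 2] by (cases "J k \<omega>") (auto simp: stage_def)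

text \<open>
  Change of measure: \<open>1\<^bsub>dom j\<^esub> exp (l j)\<close> is the density of the controlled increment at stage \<open>j\<close>,
  \<open>d j\<close> a lower bound for its drift and \<open>a j\<close> an upper bound for its relative entropy, both in
  exponential form. Up to an event of small controlled probability the controlled path reaches a
  fresh good state, and the likelihood ratio is at most \<open>exp (a 0 * N + a 1 * K + \<delta> * N)\<close>.
\<close>

lemma escape_ge:
  fixes l :: "nat \<Rightarrow> real \<Rightarrow> real" and d a :: "nat \<Rightarrow> real" and dom :: "nat \<Rightarrow> real set"
  assumes s: "0 < s"
    and dom_meas: "\<And>j. dom j \<in> sets borel" and l_meas: "\<And>j. l j \<in> borel_measurable borel"
    and density: "\<And>j. j \<in> {0, 1, 2} \<Longrightarrow>
      (\<integral>\<^sup>+y. ennreal (indicator (dom j) y * exp (l j y)) \<partial>R (j \<noteq> 0)) = 1"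
    and drift: "\<And>j. j \<in> {0, 1, 2} \<Longrightarrow>
      (\<integral>\<^sup>+y. ennreal (indicator (dom j) y * exp (l j y + s * (d j - y))) \<partial>R (j \<noteq> 0)) \<le> 1"
    and entropy: "\<And>j. j \<in> {0, 1, 2} \<Longrightarrow>
      (\<integral>\<^sup>+y. ennreal (indicator (dom j) y * exp (l j y + s * (l j y - a j))) \<partial>R (j \<noteq> 0)) \<le> 1"
    and rule: "\<And>n \<omega>. \<omega> \<in> space M \<Longrightarrow> 0 < (\<Sum>k=n..<n+N. Y k \<omega>) \<Longrightarrow> J (n + N) \<omega>"
    and tie: "\<And>n \<omega>. \<omega> \<in> space M \<Longrightarrow> \<not> 0 < d 0 \<Longrightarrow> 0 \<le> (\<Sum>k=n..<n+N. Y k \<omega>) \<Longrightarrow> J (n + N) \<omega>"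
    and d: "d 1 = c" "d 2 = c" "dom 1 = {c..}" "0 < c" "\<delta> \<le> c"
    and d0: "0 < d 0 \<and> \<delta> \<le> d 0 \<or> d 0 = 0 \<and> dom 0 \<subseteq> {0}"
    and K: "2 * \<delta> * real N \<le> c * real K"
    and a: "0 \<le> a 0" "0 \<le> a 1" "a 2 = 0"
    and N: "((2 * real N + 1)\<^sup>2 + 1) * exp (- (s * \<delta> * real N)) \<le> 1 / 2"
    and H: "H \<in> borel_measurable (F n)" and fin: "(\<integral>\<^sup>+\<omega>. H \<omega> \<partial>M) < \<infinity>"
  shows "ennreal (exp (- (a 0 * real N + a 1 * real K + \<delta> * real N)) / 2) * (\<integral>\<^sup>+\<omega>. H \<omega> \<partial>M) \<le>
    (\<integral>\<^sup>+\<omega>. H \<omega> * ennreal (of_bool (fresh N (n + 2 * N) \<omega>)) \<partial>M)"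
proof -
  define \<theta> where "\<theta> \<omega> k = stage (\<lambda>k. J k \<omega>) K n k" for \<omega> k
  define B where "B = {n..<n+2*N}"
  define Q where "Q = a 0 * real N + a 1 * real K + \<delta> * real N"
  \<comment> \<open>A factor of the likelihood ratio with an additional weight \<open>exp u\<close>.
    The choice \<open>zero\<close> gives the ratio itself, \<open>dr i i'\<close> tests for a
    shortfall of the increments below their drift at times from \<open>i\<close> to
    \<open>i' - 1\<close>, and \<open>en\<close> tests for an excess of the log-likelihood ratio
    over its budget \<open>a\<close>.\<close>
  define f where "f u k z = ennreal (indicator (dom (\<theta> (fst z) k)) (snd z) *
    exp (l (\<theta> (fst z) k) (snd z) + u k (\<theta> (fst z) k) (snd z)))"
    for u :: "nat \<Rightarrow> nat \<Rightarrow> real \<Rightarrow> real" and k and z :: "'a \<times> real"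
  define zero where "zero = (\<lambda>(k::nat) (j::nat) (y::real). 0::real)"
  define dr where "dr i i' = (\<lambda>k j y. if i \<le> k \<and> k < i' then s * (d j - y) else 0)" for i i' :: nat
  define en where "en = (\<lambda>(k::nat) j y. s * (l j y - a j))"
  define Z where "Z u \<omega> = (\<Prod>k=n..<n+2*N. f u k (\<omega>, Y k \<omega>))" for u \<omega>
  have f_meas: "f u k \<in> borel_measurable (F k \<Otimes>\<^sub>M borel)" if "\<And>k j. u k j \<in> borel_measurable borel" for u k
    unfolding f_def \<theta>_def
    by (rule measurable_staged[where g = "\<lambda>j y. ennreal (indicator (dom j) y * exp (l j y + u k j y))"])
      (use that dom_meas l_meas in measurable)
  have zero_meas: "zero k j \<in> borel_measurable borel" and dr_meas: "dr i i' k j \<in> borel_measurable borel"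
    and en_meas: "en k j \<in> borel_measurable borel" for k j i i'
    unfolding zero_def dr_def en_def using l_meas by measurable
  have Z_eq: "Z u \<omega> = ennreal (of_bool (\<forall>k\<in>B. Y k \<omega> \<in> dom (\<theta> \<omega> k)) *
      exp ((\<Sum>k\<in>B. l (\<theta> \<omega> k) (Y k \<omega>)) + (\<Sum>k\<in>B. u k (\<theta> \<omega> k) (Y k \<omega>))))" for u \<omega>
    unfolding Z_def f_def fst_conv snd_conv by (subst prod_indicator_exp) (auto simp: B_def sum.distrib)
  have Z_meas: "(\<lambda>\<omega>. H \<omega> * Z u \<omega>) \<in> borel_measurable M" if "\<And>k j. u k j \<in> borel_measurable borel" for u
    unfolding Z_def using f_meas[OF that] H by (intro measurable_F_M[OF measurable_prod_eval]) auto
  have int0: "(\<integral>\<^sup>+\<omega>. H \<omega> * Z zero \<omega> \<partial>M) = (\<integral>\<^sup>+\<omega>. H \<omega> \<partial>M)"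
    unfolding Z_def
  proof (rule nn_integral_prod_eq[OF f_meas H])
    show "(\<integral>\<^sup>+y. f zero k (\<omega>, y) \<partial>R (J k \<omega>)) = 1" for k \<omega>
      unfolding f_def zero_def \<theta>_def fst_conv snd_conv add_0_right
      by (rule stage_law[where P = "\<lambda>j r. (\<integral>\<^sup>+y. ennreal (indicator (dom j) y * exp (l j y)) \<partial>r) = 1"])
        (rule density)
  qed (rule zero_meas)
  have int_dr: "(\<integral>\<^sup>+\<omega>. H \<omega> * Z (dr i i') \<omega> \<partial>M) \<le> (\<integral>\<^sup>+\<omega>. H \<omega> \<partial>M)" for i i'
    unfolding Z_def
  proof (rule nn_integral_prod_le[OF f_meas H])
    fix k \<omega>
    have le: "(\<integral>\<^sup>+y. ennreal (indicator (dom j) y * exp (l j y + dr i i' k j y)) \<partial>R (j \<noteq> 0)) \<le> 1"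
      if j: "j \<in> {0, 1, 2}" for j
    proof (cases "i \<le> k \<and> k < i'")
      case True
      then have "dr i i' k j = (\<lambda>y. s * (d j - y))" by (simp add: dr_def)
      then show ?thesis using drift[OF j] by simp
    next
      case False
      then have "dr i i' k j = (\<lambda>y. 0)" by (simp only: dr_def if_False)
      then show ?thesis using density[OF j] by simp
    qed
    show "(\<integral>\<^sup>+y. f (dr i i') k (\<omega>, y) \<partial>R (J k \<omega>)) \<le> 1"
      unfolding f_def \<theta>_def fst_conv snd_conv
      by (rule stage_law[where P = "\<lambda>j r. (\<integral>\<^sup>+y. ennreal (indicator (dom j) y * exp (l j y + dr i i' k j y)) \<partial>r) \<le> 1"])
        (rule le)
  qed (rule dr_meas)
  have int_en: "(\<integral>\<^sup>+\<omega>. H \<omega> * Z en \<omega> \<partial>M) \<le> (\<integral>\<^sup>+\<omega>. H \<omega> \<partial>M)"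
    unfolding Z_def
  proof (rule nn_integral_prod_le[OF f_meas H])
    show "(\<integral>\<^sup>+y. f en k (\<omega>, y) \<partial>R (J k \<omega>)) \<le> 1" for k \<omega>
      unfolding f_def \<theta>_def fst_conv snd_conv en_def
      by (rule stage_law[where P = "\<lambda>j r. (\<integral>\<^sup>+y. ennreal (indicator (dom j) y * exp (l j y + s * (l j y - a j))) \<partial>r) \<le> 1"])
        (rule entropy)
  qed (rule en_meas)
  define E where "E = ennreal (exp (- (s * \<delta> * real N)))"
  define I where "I = {n..n+2*N} \<times> {n..n+2*N}"
  \<comment> \<open>A union bound written pointwise. Outside the domains the ratio vanishes; on an
    atypical event the tested deviation is at least \<open>\<delta> * N\<close>, so the weight
    \<open>exp u\<close> compensates the factor \<open>E\<close>; on a typical path the final state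
    is fresh and the ratio is at most \<open>exp Q\<close>.\<close>
  have pointwise: "Z zero \<omega> \<le> (\<Sum>(i, i')\<in>I. E * Z (dr i i') \<omega>) + E * Z en \<omega> +
      ennreal (exp Q) * ennreal (of_bool (fresh N (n + 2 * N) \<omega>))" (is "_ \<le> ?D + ?E + ?F")
    if \<omega>: "\<omega> \<in> space M" for \<omega>
  proof -
    let ?L = "\<Sum>k\<in>B. l (\<theta> \<omega> k) (Y k \<omega>)"
    consider (outside) "\<not> (\<forall>k\<in>B. Y k \<omega> \<in> dom (\<theta> \<omega> k))"
      | (drift) i i' where "\<forall>k\<in>B. Y k \<omega> \<in> dom (\<theta> \<omega> k)" "(i, i') \<in> I"
          "\<delta> * real N \<le> (\<Sum>k=i..<i'. d (\<theta> \<omega> k) - Y k \<omega>)"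
      | (entropy) "\<forall>k\<in>B. Y k \<omega> \<in> dom (\<theta> \<omega> k)" "\<delta> * real N \<le> (\<Sum>k\<in>B. l (\<theta> \<omega> k) (Y k \<omega>) - a (\<theta> \<omega> k))"
      | (typical) "\<forall>k\<in>B. Y k \<omega> \<in> dom (\<theta> \<omega> k)"
          "\<And>i i'. (i, i') \<in> I \<Longrightarrow> (\<Sum>k=i..<i'. d (\<theta> \<omega> k) - Y k \<omega>) < \<delta> * real N"
          "(\<Sum>k\<in>B. l (\<theta> \<omega> k) (Y k \<omega>) - a (\<theta> \<omega> k)) < \<delta> * real N"
      by (meson not_le)
    then show ?thesis
    proof cases
      case outside
      then have "Z zero \<omega> = 0" by (auto simp: Z_eq)
      then show ?thesis by simp
    next
      case drift
      have "n \<le> i" "i' \<le> n + 2 * N" using drift(2) by (auto simp: I_def)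
      then have "(\<Sum>k\<in>B. dr i i' k (\<theta> \<omega> k) (Y k \<omega>)) = (\<Sum>k=i..<i'. s * (d (\<theta> \<omega> k) - Y k \<omega>))"
        unfolding B_def dr_def by (rule sum_restrict_interval)
      also have "\<dots> = s * (\<Sum>k=i..<i'. d (\<theta> \<omega> k) - Y k \<omega>)" by (simp add: sum_distrib_left)
      also have "s * (\<delta> * real N) \<le> \<dots>" using s drift(3) by (intro mult_left_mono) auto
      finally have "exp ?L \<le> exp (- (s * \<delta> * real N) + (?L + (\<Sum>k\<in>B. dr i i' k (\<theta> \<omega> k) (Y k \<omega>))))"
        by (simp add: mult.assoc)
      then have "Z zero \<omega> \<le> E * Z (dr i i') \<omega>"
        using drift(1) by (simp add: Z_eq zero_def E_def ennreal_mult'[symmetric] exp_add[symmetric])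
      also have "\<dots> \<le> ?D"
        using member_le_sum[OF drift(2), of "\<lambda>(i, i'). E * Z (dr i i') \<omega>"] by (simp add: I_def)
      also have "\<dots> \<le> ?D + (?E + ?F)" by (rule le_iff_add[THEN iffD2]) blast
      finally show ?thesis by (simp add: add.assoc)
    next
      case entropy
      have "(\<Sum>k\<in>B. en k (\<theta> \<omega> k) (Y k \<omega>)) = s * (\<Sum>k\<in>B. l (\<theta> \<omega> k) (Y k \<omega>) - a (\<theta> \<omega> k))"
        by (simp add: en_def sum_distrib_left)
      also have "s * (\<delta> * real N) \<le> \<dots>" using s entropy(2) by (intro mult_left_mono) auto
      finally have "exp ?L \<le> exp (- (s * \<delta> * real N) + (?L + (\<Sum>k\<in>B. en k (\<theta> \<omega> k) (Y k \<omega>))))"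
        by (simp add: mult.assoc)
      then have "Z zero \<omega> \<le> ?E"
        using entropy(1) by (simp add: Z_eq zero_def E_def ennreal_mult'[symmetric] exp_add[symmetric])
      also have "\<dots> \<le> ?E + (?D + ?F)" by (rule le_iff_add[THEN iffD2]) blast
      finally show ?thesis by (simp add: ac_simps)
    next
      case typical
      have stays: "J (n + m + N) \<omega>" if "m \<le> N" for m
      proof (rule controlled_path_stays_good[where g = "\<lambda>k. J k \<omega>" and y = "\<lambda>k. Y k \<omega>" and d = d
            and dom = dom and \<delta> = \<delta> and K = K and c = c])
        show "(\<Sum>k=i..<j. d (stage (\<lambda>k. J k \<omega>) K n k) - Y k \<omega>) < \<delta> * real N"
          if "n \<le> i" "j \<le> n + 2 * N" for i j
        proof (cases "i \<le> j")
          case True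
          then show ?thesis using typical(2)[of i j] that by (auto simp: I_def \<theta>_def)
        next
          case False
          have "(n, n) \<in> I" by (simp add: I_def)
          from typical(2)[OF this] False show ?thesis by simp
        qed
      qed (use typical(1) rule[OF \<omega>] tie[OF \<omega>] d d0 K that in \<open>auto simp: \<theta>_def B_def\<close>)
      have fr: "fresh N (n + 2 * N) \<omega>"
        unfolding fresh_def
      proof
        fix k assume "k \<in> {n + 2 * N - N..<n + 2 * N}"
        then have "k = n + (k - (n + N)) + N" "k - (n + N) \<le> N" by auto
        then show "J k \<omega>" using stays by metis
      qed
      have "(\<Sum>k\<in>B. a (\<theta> \<omega> k)) \<le> a 0 * real N + a 1 * real K"
        unfolding B_def \<theta>_def using stays by (intro controlled_path_cost a) auto
      with typical(3) have "?L \<le> Q" by (simp add: Q_def sum_subtractf)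
      then have "Z zero \<omega> \<le> ?F" using typical(1) fr by (simp add: Z_eq zero_def)
      also have "\<dots> \<le> ?F + (?D + ?E)" by (rule le_iff_add[THEN iffD2]) blast
      finally show ?thesis by (simp add: ac_simps)
    qed
  qed
  define X where "X = (\<integral>\<^sup>+\<omega>. H \<omega> \<partial>M)"
  define W where "W = (\<integral>\<^sup>+\<omega>. H \<omega> * ennreal (of_bool (fresh N (n + 2 * N) \<omega>)) \<partial>M)"
  have fr_meas: "(\<lambda>\<omega>. H \<omega> * ennreal (of_bool (fresh N (n + 2 * N) \<omega>))) \<in> borel_measurable M"
  proof -
    have [measurable]: "Measurable.pred M (fresh N (n + 2 * N))"
      using measurable_F_M[OF pred_fresh[of "n + 2 * N" "n + 2 * N"]] by simp
    show ?thesis using measurable_F_M[OF H] by measurable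
  qed
  have linear: "(\<integral>\<^sup>+\<omega>. (\<Sum>p\<in>I. E * g1 p \<omega>) + E * g2 \<omega> + C * g3 \<omega> \<partial>M) =
      (\<Sum>p\<in>I. E * (\<integral>\<^sup>+\<omega>. g1 p \<omega> \<partial>M)) + E * (\<integral>\<^sup>+\<omega>. g2 \<omega> \<partial>M) + C * (\<integral>\<^sup>+\<omega>. g3 \<omega> \<partial>M)"
    if [measurable]: "\<And>p. g1 p \<in> borel_measurable M" "g2 \<in> borel_measurable M" "g3 \<in> borel_measurable M"
    for g1 :: "nat \<times> nat \<Rightarrow> 'a \<Rightarrow> ennreal" and g2 g3 C
    by (simp add: nn_integral_add nn_integral_sum nn_integral_cmult)
  have "X = (\<integral>\<^sup>+\<omega>. H \<omega> * Z zero \<omega> \<partial>M)" by (simp add: int0 X_def)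
  also have "\<dots> \<le> (\<integral>\<^sup>+\<omega>. (\<Sum>p\<in>I. E * (H \<omega> * Z (dr (fst p) (snd p)) \<omega>)) + E * (H \<omega> * Z en \<omega>) +
      ennreal (exp Q) * (H \<omega> * ennreal (of_bool (fresh N (n + 2 * N) \<omega>))) \<partial>M)"
  proof (intro nn_integral_mono)
    fix \<omega> assume "\<omega> \<in> space M"
    from mult_left_mono[OF pointwise[OF this], of "H \<omega>"]
    show "H \<omega> * Z zero \<omega> \<le> (\<Sum>p\<in>I. E * (H \<omega> * Z (dr (fst p) (snd p)) \<omega>)) + E * (H \<omega> * Z en \<omega>) +
      ennreal (exp Q) * (H \<omega> * ennreal (of_bool (fresh N (n + 2 * N) \<omega>)))"
      by (simp add: distrib_left sum_distrib_left case_prod_beta mult_ac)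
  qed
  also have "\<dots> = (\<Sum>p\<in>I. E * (\<integral>\<^sup>+\<omega>. H \<omega> * Z (dr (fst p) (snd p)) \<omega> \<partial>M)) + E * (\<integral>\<^sup>+\<omega>. H \<omega> * Z en \<omega> \<partial>M) + ennreal (exp Q) * W"
    unfolding W_def by (rule linear[OF Z_meas[OF dr_meas] Z_meas[OF en_meas] fr_meas])
  also have "\<dots> \<le> (\<Sum>p\<in>I. E * X) + E * X + ennreal (exp Q) * W"
    unfolding X_def by (intro add_mono sum_mono mult_left_mono int_dr int_en) auto
  finally have main: "X \<le> (\<Sum>p\<in>I. E * X) + E * X + ennreal (exp Q) * W" .
  have "W \<le> (\<integral>\<^sup>+\<omega>. H \<omega> * 1 \<partial>M)"
    unfolding W_def by (intro nn_integral_mono mult_left_mono) auto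
  then have "W \<le> X" by (simp add: X_def)
  moreover obtain x where x: "X = ennreal x" "0 \<le> x"
    using fin unfolding X_def[symmetric] by (cases X) auto
  ultimately obtain w where w: "W = ennreal w" "0 \<le> w" by (cases W) (auto simp: top_unique)
  have card: "real (card I) = (2 * real N + 1)\<^sup>2"
    by (simp add: I_def power2_eq_square algebra_simps)
  have "ennreal x \<le> ennreal (real (card I) * (exp (- (s * \<delta> * real N)) * x) + exp (- (s * \<delta> * real N)) * x + exp Q * w)"
    using main x w
    by (simp add: E_def ennreal_mult'[symmetric] ennreal_of_nat_eq_real_of_nat ennreal_plus[symmetric] del: ennreal_plus)
  then have "x \<le> real (card I) * (exp (- (s * \<delta> * real N)) * x) + exp (- (s * \<delta> * real N)) * x + exp Q * w"
    using x w by (subst (asm) ennreal_le_iff) auto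
  also have "\<dots> = ((2 * real N + 1)\<^sup>2 + 1) * exp (- (s * \<delta> * real N)) * x + exp Q * w"
    unfolding card by (simp add: algebra_simps)
  \<comment> \<open>The atypical events use up at most half of the mass; that half is subtracted
    from both sides, which is legitimate because \<open>fin\<close> makes \<open>x\<close> a real
    number.\<close>
  also have "\<dots> \<le> 1 / 2 * x + exp Q * w"
    using N x by (intro add_right_mono mult_right_mono) auto
  finally have "exp (- Q) * (x / 2) \<le> exp (- Q) * (exp Q * w)"
    by (intro mult_left_mono) auto
  then have "exp (- Q) / 2 * x \<le> w" by (simp add: exp_minus field_simps)
  then have "ennreal (exp (- Q) / 2) * X \<le> W"
    using x w by (simp add: ennreal_mult'[symmetric] ennreal_leI)
  then show ?thesis by (simp add: X_def W_def Q_def)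
qed

end

section \<open>Exponential moments and tilted distributions\<close>

text \<open>Convexity of \<open>exp\<close> between 0 and \<open>t * x\<close>; equivalently,
  \<open>(exp (s * x) - 1) / s\<close> is nondecreasing in \<open>s\<close>.\<close>

lemma exp_convex_combination:
  fixes x s t :: real
  assumes "0 < s" "s \<le> t"
  shows "exp (s * x) \<le> 1 + s / t * (exp (t * x) - 1)"
proof -
  have "exp ((1 - s / t) *\<^sub>R 0 + (s / t) *\<^sub>R (t * x)) \<le> (1 - s / t) * exp 0 + s / t * exp (t * x)"
    using assms by (intro convex_onD[OF exp_convex]) auto
  then show ?thesis using assms by (simp add: algebra_simps)
qed

text \<open>The right derivative at \<open>s = 0\<close> of the expectation of
  \<open>exp (s * f)\<close> is the negative mean of \<open>f\<close>. The difference quotients lie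
  between \<open>f\<close> and \<open>h t\<close>, which dominates the limit with exponential
  moments on one side only. Convexity carries the bound from one \<open>u\<close> to all smaller
  \<open>s\<close>, so that several such tests can later share one \<open>s\<close>.\<close>

lemma (in prob_space) eventually_mgf_le_one:
  assumes f: "integrable M f" and t: "0 < t" "integrable M (\<lambda>x. exp (t * f x))" and neg: "expectation f < 0"
  shows "\<forall>\<^sub>F s in at_right 0. (\<integral>\<^sup>+x. ennreal (exp (s * f x)) \<partial>M) \<le> 1"
proof -
  have [measurable]: "f \<in> borel_measurable M" using f by simp
  define h where "h s x = (exp (s * f x) - 1) / s" for s x
  define r where "r n = t / real (Suc n)" for n
  have r: "0 < r n" "r n \<le> t" for n using t by (auto simp: r_def field_simps)
  have r0: "r \<longlonglongrightarrow> 0" unfolding r_def by (rule LIMSEQ_Suc[OF lim_const_over_n])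
  have upper: "h s x \<le> h t x" if "0 < s" "s \<le> t" for s x
    using exp_convex_combination[OF that, of "f x"] that by (simp add: h_def field_simps)
  have lower: "f x \<le> h s x" if "0 < s" for s x
    using exp_ge_add_one_self[of "s * f x"] that by (simp add: h_def field_simps)
  have int_h: "integrable M (h t)" unfolding h_def using t by auto
  have lim: "(\<lambda>n. h (r n) x) \<longlonglongrightarrow> f x" for x
  proof -
    have "((\<lambda>y. exp (y * f x)) has_real_derivative f x) (at 0)"
      by (auto intro!: derivative_eq_intros)
    then have "((\<lambda>y. (exp (y * f x) - 1) / y) \<longlongrightarrow> f x) (at 0)"
      by (simp add: has_field_derivative_iff)
    moreover have "filterlim r (at 0) sequentially"
      using r0 r by (auto simp: filterlim_at less_imp_neq[symmetric] intro!: always_eventually)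
    ultimately show ?thesis unfolding h_def by (rule filterlim_compose)
  qed
  have "(\<lambda>n. expectation (h (r n))) \<longlonglongrightarrow> expectation f"
  proof (rule integral_dominated_convergence[where w = "\<lambda>x. \<bar>f x\<bar> + \<bar>h t x\<bar>"])
    show "AE x in M. norm (h (r n) x) \<le> \<bar>f x\<bar> + \<bar>h t x\<bar>" for n
      using upper[OF r] lower[OF r(1)] by (intro AE_I2) (smt (verit) real_norm_def)
    show "h (r n) \<in> borel_measurable M" for n unfolding h_def by measurable
    show "integrable M (\<lambda>x. \<bar>f x\<bar> + \<bar>h t x\<bar>)" using f int_h by auto
  qed (use lim in auto)
  then have "\<forall>\<^sub>F n in sequentially. expectation (h (r n)) < 0"
    using neg by (rule order_tendstoD)
  then obtain n where n: "expectation (h (r n)) < 0"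
    using eventually_happens'[OF sequentially_bot] by blast
  define u where "u = r n"
  have u: "0 < u" "u \<le> t" using r by (auto simp: u_def)
  have int_u: "integrable M (\<lambda>x. exp (u * f x))"
  proof (rule Bochner_Integration.integrable_bound)
    show "integrable M (\<lambda>x. 1 + u * \<bar>h t x\<bar>)" using int_h by auto
    show "AE x in M. norm (exp (u * f x)) \<le> norm (1 + u * \<bar>h t x\<bar>)"
    proof (intro AE_I2)
      fix x
      have "u * h u x \<le> u * \<bar>h t x\<bar>" using upper[OF u, of x] u by (intro mult_left_mono) auto
      moreover have "exp (u * f x) = 1 + u * h u x" using u by (simp add: h_def)
      ultimately have "exp (u * f x) \<le> 1 + u * \<bar>h t x\<bar>" by linarith
      then show "norm (exp (u * f x)) \<le> norm (1 + u * \<bar>h t x\<bar>)" using u by simp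
    qed
  qed measurable
  have "expectation (h u) = (expectation (\<lambda>x. exp (u * f x)) - 1) / u"
    unfolding h_def using int_u by (simp add: prob_space)
  with n u have le1: "expectation (\<lambda>x. exp (u * f x)) \<le> 1"
    by (simp add: u_def[symmetric] divide_less_0_iff)
  have "(\<integral>\<^sup>+x. ennreal (exp (s * f x)) \<partial>M) \<le> 1" if "0 < s" "s < u" for s
  proof -
    have "(\<integral>\<^sup>+x. ennreal (exp (s * f x)) \<partial>M) \<le> (\<integral>\<^sup>+x. ennreal (1 + s / u * (exp (u * f x) - 1)) \<partial>M)"
      using that exp_convex_combination[of s u] by (intro nn_integral_mono ennreal_leI) auto
    also have "\<dots> = ennreal (expectation (\<lambda>x. 1 + s / u * (exp (u * f x) - 1)))"
    proof (intro nn_integral_eq_integral AE_I2)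
      show "0 \<le> 1 + s / u * (exp (u * f x) - 1)" for x
        using exp_convex_combination[of s u "f x"] that by (smt (verit) exp_gt_zero)
    qed (use int_u in auto)
    also have "expectation (\<lambda>x. 1 + s / u * (exp (u * f x) - 1)) = 1 + s / u * (expectation (\<lambda>x. exp (u * f x)) - 1)"
      using int_u by (simp add: prob_space)
    also have "s / u * (expectation (\<lambda>x. exp (u * f x)) - 1) \<le> 0"
      using le1 that by (intro mult_nonneg_nonpos) auto
    then have "1 + s / u * (expectation (\<lambda>x. exp (u * f x)) - 1) \<le> 1" by simp
    finally show ?thesis by (simp add: ennreal_leI order_trans)
  qed
  then show ?thesis
    unfolding eventually_at_right_field using u by auto
qed

section \<open>Truncated moment generating functions and their tilts\<close>

lemma (in real_distribution) integrable_truncated: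
  fixes g :: "real \<Rightarrow> real"
  assumes g: "continuous_on UNIV g"
  shows "integrable M (\<lambda>y. indicator {-K..K} y * g y)"
proof -
  have "compact (g ` {-K..K})"
    using g by (intro compact_continuous_image continuous_on_subset[OF g]) auto
  then obtain C where C: "\<And>y. y \<in> {-K..K} \<Longrightarrow> \<bar>g y\<bar> \<le> C"
    using compact_imp_bounded[THEN bounded_iff[THEN iffD1]] by (metis imageI real_norm_def)
  have [measurable]: "g \<in> borel_measurable M"
    using borel_measurable_continuous_onI[OF g] by simp
  show ?thesis
  proof (rule integrable_const_bound[where B = "\<bar>C\<bar>"])
    show "AE y in M. norm (indicator {-K..K} y * g y) \<le> \<bar>C\<bar>"
      using C by (intro AE_I2) (force simp: indicator_def)
  qed measurable
qed

lemma (in real_distribution) isCont_truncated_mgf: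
  fixes g :: "real \<Rightarrow> real"
  assumes g: "continuous_on UNIV g"
  shows "isCont (\<lambda>t. \<integral>y. indicator {-K..K} y * (g y * exp (t * y)) \<partial>M) t"
proof (rule continuous_at_sequentiallyI)
  fix u :: "nat \<Rightarrow> real" assume u: "u \<longlonglongrightarrow> t"
  then obtain T where T: "\<And>n. \<bar>u n\<bar> \<le> T"
    using convergent_imp_Bseq[OF convergentI[OF u]] by (auto simp: Bseq_def)
  have [measurable]: "g \<in> borel_measurable M"
    using borel_measurable_continuous_onI[OF g] by simp
  show "(\<lambda>n. \<integral>y. indicator {-K..K} y * (g y * exp (u n * y)) \<partial>M) \<longlonglongrightarrow>
      (\<integral>y. indicator {-K..K} y * (g y * exp (t * y)) \<partial>M)"
  proof (rule integral_dominated_convergence[where w = "\<lambda>y. indicator {-K..K} y * (\<bar>g y\<bar> * exp (T * \<bar>y\<bar>))"])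
    show "AE y in M. norm (indicator {-K..K} y * (g y * exp (u n * y))) \<le> indicator {-K..K} y * (\<bar>g y\<bar> * exp (T * \<bar>y\<bar>))" for n
    proof (intro AE_I2)
      fix y
      have "u n * y \<le> \<bar>u n\<bar> * \<bar>y\<bar>" by (metis abs_ge_self abs_mult)
      also have "\<dots> \<le> T * \<bar>y\<bar>" using T by (intro mult_right_mono) auto
      finally show "norm (indicator {-K..K} y * (g y * exp (u n * y))) \<le> indicator {-K..K} y * (\<bar>g y\<bar> * exp (T * \<bar>y\<bar>))"
        by (auto simp: indicator_def abs_mult intro!: mult_left_mono)
    qed
    show "AE y in M. (\<lambda>n. indicator {-K..K} y * (g y * exp (u n * y))) \<longlonglongrightarrow> indicator {-K..K} y * (g y * exp (t * y))"
      using u by (intro AE_I2 tendsto_intros)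
    show "integrable M (\<lambda>y. indicator {-K..K} y * (\<bar>g y\<bar> * exp (T * \<bar>y\<bar>)))"
      by (intro integrable_truncated continuous_intros g)
  qed measurable
qed

lemma (in real_distribution) mass_away_from_zero:
  assumes pos: "0 < measure M {0<..}"
  obtains n :: nat where "0 < measure M {1 / real (Suc n)..real n}"
proof -
  have "\<exists>n::nat. 0 < measure M {1 / real (Suc n)..real n}"
  proof (rule ccontr)
    assume "\<not> ?thesis"
    then have "emeasure M {1 / real (Suc n)..real n} = 0" for n
      by (simp add: emeasure_eq_measure not_less measure_le_0_iff)
    then have "emeasure M (\<Union>n. {1 / real (Suc n)..real n}) = 0"
      by (intro emeasure_UN_eq_0) auto
    moreover have "{0<..} \<subseteq> (\<Union>n. {1 / real (Suc n)..real n})"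
    proof
      fix y :: real assume "y \<in> {0<..}"
      then obtain i where i: "1 / real (Suc i) < y" using nat_approx_posE[of y] by auto
      obtain j where j: "y \<le> real j" using real_arch_simple by blast
      have "1 / real (Suc (max i j)) \<le> 1 / real (Suc i)" by (intro divide_left_mono) auto
      then have "y \<in> {1 / real (Suc (max i j))..real (max i j)}" using i j by auto
      then show "y \<in> (\<Union>n. {1 / real (Suc n)..real n})" by blast
    qed
    ultimately have "emeasure M {0<..} \<le> 0"
      using emeasure_mono[of "{0<..}" "\<Union>n. {1 / real (Suc n)..real n}" M] by simp
    then show False using pos by (simp add: emeasure_eq_measure)
  qed
  then show ?thesis using that by blast
qed


text \<open>Coercivity: mass at distance \<open>\<epsilon>\<close> on either side of 0 makes the
  truncated moment generating function grow exponentially in both directions.\<close>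

lemma (in real_distribution) exp_le_truncated_mgf:
  assumes "\<epsilon> \<le> K" "0 \<le> \<epsilon>"
  shows "0 \<le> t \<Longrightarrow> measure M {\<epsilon>..K} * exp (\<epsilon> * t) \<le> (\<integral>y. indicator {-K..K} y * exp (t * y) \<partial>M)"
    and "t \<le> 0 \<Longrightarrow> measure M {-K..-\<epsilon>} * exp (- \<epsilon> * t) \<le> (\<integral>y. indicator {-K..K} y * exp (t * y) \<partial>M)"
proof -
  have int: "integrable M (\<lambda>y. indicator {-K..K} y * exp (t * y))"
    by (intro integrable_truncated continuous_intros)
  show "measure M {\<epsilon>..K} * exp (\<epsilon> * t) \<le> (\<integral>y. indicator {-K..K} y * exp (t * y) \<partial>M)" if t: "0 \<le> t"
  proof -
    have "measure M {\<epsilon>..K} * exp (\<epsilon> * t) = (\<integral>y. indicator {\<epsilon>..K} y * exp (\<epsilon> * t) \<partial>M)" by simp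
    also have "\<dots> \<le> (\<integral>y. indicator {-K..K} y * exp (t * y) \<partial>M)"
    proof (intro integral_mono int)
      fix y
      show "indicator {\<epsilon>..K} y * exp (\<epsilon> * t) \<le> indicator {-K..K} y * exp (t * y)"
        using assms t mult_left_mono[of \<epsilon> y t] by (auto simp: indicator_def mult.commute)
    qed (auto simp: emeasure_eq_measure)
    finally show ?thesis .
  qed
  show "measure M {-K..-\<epsilon>} * exp (- \<epsilon> * t) \<le> (\<integral>y. indicator {-K..K} y * exp (t * y) \<partial>M)" if t: "t \<le> 0"
  proof -
    have "measure M {-K..-\<epsilon>} * exp (- \<epsilon> * t) = (\<integral>y. indicator {-K..-\<epsilon>} y * exp (- \<epsilon> * t) \<partial>M)" by simp
    also have "\<dots> \<le> (\<integral>y. indicator {-K..K} y * exp (t * y) \<partial>M)"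
    proof (intro integral_mono int)
      fix y
      show "indicator {-K..-\<epsilon>} y * exp (- \<epsilon> * t) \<le> indicator {-K..K} y * exp (t * y)"
        using assms t mult_left_mono_neg[of y "-\<epsilon>" t] by (auto simp: indicator_def mult.commute)
    qed (auto simp: emeasure_eq_measure)
    finally show ?thesis .
  qed
qed

text \<open>
  The truncated functions are coercive in \<open>t\<close>, so that compactness makes the truncation level uniform.
\<close>

lemma (in real_distribution) exists_truncation:
  assumes \<epsilon>: "0 < \<epsilon>" "\<epsilon> \<le> K\<^sub>0" and mass: "0 < measure M {\<epsilon>..K\<^sub>0}" "0 < measure M {-K\<^sub>0..-\<epsilon>}"
    and a: "0 < a" and mgf: "\<And>t. ennreal (exp (- a)) < (\<integral>\<^sup>+y. ennreal (exp (t * y)) \<partial>M)"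
  shows "\<exists>K\<ge>K\<^sub>0. \<forall>t. exp (- a) < (\<integral>y. indicator {-K..K} y * exp (t * y) \<partial>M)"
proof (rule ccontr)
  assume contra: "\<not> ?thesis"
  define \<phi> where "\<phi> K t = (\<integral>y. indicator {-K..K} y * exp (t * y) \<partial>M)" for K t
  have "\<exists>t. \<phi> (K\<^sub>0 + real n) t \<le> exp (- a)" for n
    using contra \<epsilon> unfolding \<phi>_def by (metis le_add_same_cancel1 not_le of_nat_0_le_iff)
  then obtain t where t: "\<And>n. \<phi> (K\<^sub>0 + real n) (t n) \<le> exp (- a)" by metis
  have int: "integrable M (\<lambda>y. indicator {-K..K} y * exp (t * y))" for K t
    by (intro integrable_truncated continuous_intros)
  have \<phi>_mono: "\<phi> K u \<le> \<phi> K' u" if "K \<le> K'" for K K' u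
    unfolding \<phi>_def using that by (intro integral_mono int) (auto simp: indicator_def)
  define \<rho> where "\<rho> = min (measure M {\<epsilon>..K\<^sub>0}) (measure M {-K\<^sub>0..-\<epsilon>})"
  have \<rho>: "0 < \<rho>" using mass by (simp add: \<rho>_def)
  have "\<bar>t n\<bar> \<le> - ln \<rho> / \<epsilon>" for n
  proof -
    have "\<rho> * exp (\<epsilon> * \<bar>t n\<bar>) \<le> \<phi> K\<^sub>0 (t n)"
    proof (cases "0 \<le> t n")
      case True
      have "\<rho> * exp (\<epsilon> * \<bar>t n\<bar>) \<le> measure M {\<epsilon>..K\<^sub>0} * exp (\<epsilon> * t n)"
        using True by (auto simp: \<rho>_def intro!: mult_right_mono)
      also have "\<dots> \<le> \<phi> K\<^sub>0 (t n)"
        unfolding \<phi>_def using \<epsilon> True by (intro exp_le_truncated_mgf) auto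
      finally show ?thesis .
    next
      case False
      have "\<rho> * exp (\<epsilon> * \<bar>t n\<bar>) \<le> measure M {-K\<^sub>0..-\<epsilon>} * exp (- \<epsilon> * t n)"
        using False by (auto simp: \<rho>_def intro!: mult_right_mono)
      also have "\<dots> \<le> \<phi> K\<^sub>0 (t n)"
        unfolding \<phi>_def using \<epsilon> False by (intro exp_le_truncated_mgf) auto
      finally show ?thesis .
    qed
    also have "\<dots> \<le> \<phi> (K\<^sub>0 + real n) (t n)" by (intro \<phi>_mono) simp
    also have "\<dots> \<le> exp (- a)" by (rule t)
    also have "\<dots> \<le> 1" using a by simp
    finally have "ln (\<rho> * exp (\<epsilon> * \<bar>t n\<bar>)) \<le> 0" using \<rho> by simp
    then have "ln \<rho> + \<epsilon> * \<bar>t n\<bar> \<le> 0" using \<rho> by (simp add: ln_mult)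
    then show ?thesis using \<epsilon> by (simp add: field_simps)
  qed
  then have "bounded (range t)" by (auto simp: bounded_iff)
  then obtain u r where r: "strict_mono r" and lim: "(t \<circ> r) \<longlonglongrightarrow> u"
    using bounded_imp_convergent_subsequence by blast
  \<comment> \<open>Monotonicity in the truncation level transfers the bound from the varying level
    \<open>K\<^sub>0 + r n\<close> to the fixed level \<open>K\<^sub>0 + j\<close>, where continuity
    allows the limit along the subsequence.\<close>
  have le: "\<phi> (K\<^sub>0 + real j) u \<le> exp (- a)" for j
  proof (rule tendsto_upperbound[of "\<lambda>n. \<phi> (K\<^sub>0 + real j) ((t \<circ> r) n)" _ sequentially])
    have "isCont (\<phi> (K\<^sub>0 + real j)) u"
      using isCont_truncated_mgf[of "\<lambda>_. 1" u "K\<^sub>0 + real j"] unfolding \<phi>_def by simp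
    then show "(\<lambda>n. \<phi> (K\<^sub>0 + real j) ((t \<circ> r) n)) \<longlonglongrightarrow> \<phi> (K\<^sub>0 + real j) u"
      using lim by (rule isCont_tendsto_compose)
    show "\<forall>\<^sub>F n in sequentially. \<phi> (K\<^sub>0 + real j) ((t \<circ> r) n) \<le> exp (- a)"
      using eventually_ge_at_top[of j]
    proof eventually_elim
      case (elim n)
      then have "j \<le> r n" using seq_suble[OF r, of n] by simp
      then have "\<phi> (K\<^sub>0 + real j) (t (r n)) \<le> \<phi> (K\<^sub>0 + real (r n)) (t (r n))" by (intro \<phi>_mono) simp
      with t[of "r n"] show ?case by simp
    qed
  qed simp
  have "(\<lambda>j. \<integral>\<^sup>+y. ennreal (indicator {-(K\<^sub>0 + real j)..K\<^sub>0 + real j} y * exp (u * y)) \<partial>M) \<longlonglongrightarrow>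
      (\<integral>\<^sup>+y. ennreal (exp (u * y)) \<partial>M)"
  proof (rule nn_integral_LIMSEQ)
    show "incseq (\<lambda>j y. ennreal (indicator {-(K\<^sub>0 + real j)..K\<^sub>0 + real j} y * exp (u * y)))"
      by (intro monoI le_funI ennreal_leI) (auto simp: indicator_def)
    show "(\<lambda>j. ennreal (indicator {-(K\<^sub>0 + real j)..K\<^sub>0 + real j} y * exp (u * y))) \<longlonglongrightarrow> ennreal (exp (u * y))" for y
    proof (rule tendsto_eventually)
      have "\<forall>\<^sub>F j in sequentially. \<bar>y\<bar> - K\<^sub>0 \<le> real j"
        using eventually_ge_at_top[of "nat \<lceil>\<bar>y\<bar> - K\<^sub>0\<rceil>"] by eventually_elim linarith
      then show "\<forall>\<^sub>F j in sequentially. ennreal (indicator {-(K\<^sub>0 + real j)..K\<^sub>0 + real j} y * exp (u * y)) = ennreal (exp (u * y))"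
        by eventually_elim (auto simp: indicator_def)
    qed
  qed measurable
  moreover have "(\<integral>\<^sup>+y. ennreal (indicator {-(K\<^sub>0 + real j)..K\<^sub>0 + real j} y * exp (u * y)) \<partial>M) \<le> ennreal (exp (- a))" for j
    using le[of j] int[of "K\<^sub>0 + real j" u] unfolding \<phi>_def by (subst nn_integral_eq_integral) (auto intro: ennreal_leI)
  ultimately have "(\<integral>\<^sup>+y. ennreal (exp (u * y)) \<partial>M) \<le> ennreal (exp (- a))"
    by (intro LIMSEQ_le_const2) auto
  then show False using mgf[of u] by simp
qed

text \<open>Here \<open>m\<close> is the derivative of \<open>\<phi>\<close> in \<open>t\<close>,
  \<open>m / \<phi>\<close> is the mean of the tilted truncated law, and
  \<open>t * m / \<phi> - ln \<phi>\<close> is its relative entropy. Where the mean vanishes the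
  entropy is \<open>- ln \<phi>\<close>, which is below \<open>a\<close> by the choice of the
  truncation; a slightly larger \<open>t\<close> makes the mean positive at a cost still below
  \<open>a\<close>.\<close>

lemma (in real_distribution) exists_tilt:
  assumes pos: "0 < measure M {0<..}" and neg: "0 < measure M {..<0}"
    and a: "0 < a" and mgf: "\<And>t. ennreal (exp (- a)) < (\<integral>\<^sup>+y. ennreal (exp (t * y)) \<partial>M)"
  shows "\<exists>K t. let \<phi> = (\<integral>y. indicator {-K..K} y * exp (t * y) \<partial>M);
      m = (\<integral>y. indicator {-K..K} y * (y * exp (t * y)) \<partial>M)
    in 0 < \<phi> \<and> 0 < m \<and> t * m / \<phi> - ln \<phi> < a"
proof -
  obtain n1 where n1: "0 < measure M {1 / real (Suc n1)..real n1}"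
    using mass_away_from_zero[OF pos] .
  interpret D: real_distribution "distr M borel uminus" by (rule real_distribution_distr) simp
  have "0 < measure (distr M borel uminus) {0<..}"
    using neg by (subst measure_distr) (auto simp: vimage_def lessThan_def)
  then obtain n2 where "0 < measure (distr M borel uminus) {1 / real (Suc n2)..real n2}"
    by (rule D.mass_away_from_zero)
  also have "measure (distr M borel uminus) {1 / real (Suc n2)..real n2} = measure M {-real n2..- (1 / real (Suc n2))}"
    by (subst measure_distr) (auto intro!: arg_cong[where f = "measure M"])
  finally have n2: "0 < measure M {-real n2..- (1 / real (Suc n2))}" .
  define K0 where "K0 = max 1 (real (max n1 n2))"
  define \<epsilon> where "\<epsilon> = 1 / real (Suc (max n1 n2))"
  have \<epsilon>: "0 < \<epsilon>" "\<epsilon> \<le> 1" "1 \<le> K0" by (auto simp: \<epsilon>_def K0_def)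
  then have \<epsilon>K0: "\<epsilon> \<le> K0" by linarith
  have e12: "\<epsilon> \<le> 1 / real (Suc n1)" "\<epsilon> \<le> 1 / real (Suc n2)"
    unfolding \<epsilon>_def by (intro divide_left_mono; simp)+
  have "measure M {1 / real (Suc n1)..real n1} \<le> measure M {\<epsilon>..K0}"
    using e12 by (intro finite_measure_mono) (auto simp: K0_def)
  with n1 have mass1: "0 < measure M {\<epsilon>..K0}" by simp
  have "measure M {-real n2..- (1 / real (Suc n2))} \<le> measure M {-K0..-\<epsilon>}"
    using e12 by (intro finite_measure_mono) (auto simp: K0_def)
  with n2 have mass2: "0 < measure M {-K0..-\<epsilon>}" by simp
  obtain K where K: "K0 \<le> K" and low: "\<And>t. exp (- a) < (\<integral>y. indicator {-K..K} y * exp (t * y) \<partial>M)"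
    using exists_truncation[OF \<epsilon>(1) \<epsilon>K0 mass1 mass2 a mgf] by blast
  have \<epsilon>K: "\<epsilon> \<le> K" "0 \<le> K" using \<epsilon> \<epsilon>K0 K by auto
  define \<phi> where "\<phi> t = (\<integral>y. indicator {-K..K} y * exp (t * y) \<partial>M)" for t
  define m where "m t = (\<integral>y. indicator {-K..K} y * (y * exp (t * y)) \<partial>M)" for t
  have \<phi>_pos: "0 < \<phi> t" for t using low[of t] exp_gt_zero[of "-a"] unfolding \<phi>_def by linarith
  have cont_\<phi>: "isCont \<phi> t" for t
    using isCont_truncated_mgf[of "\<lambda>_. 1" t K] unfolding \<phi>_def by simp
  have cont_m: "isCont m t" for t
    unfolding m_def by (rule isCont_truncated_mgf) (intro continuous_intros)
  have int: "integrable M (\<lambda>y. indicator {-K..K} y * (y * exp (t * y)))" for t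
    by (intro integrable_truncated continuous_intros)
  \<comment> \<open>At \<open>T\<close> the negative part of the integral in \<open>m\<close> is at
    least \<open>- K\<close>, and the mass on \<open>{\<epsilon>..K0}\<close> outweighs it; likewise
    at \<open>- T\<close> with signs reversed. The square of \<open>\<epsilon>\<close> comes from
    bounding \<open>exp (\<epsilon> * T)\<close> below by \<open>\<epsilon> * T\<close>.\<close>
  define T where "T = max 0 (max (K / (\<epsilon>\<^sup>2 * measure M {\<epsilon>..K0})) (K / (\<epsilon>\<^sup>2 * measure M {-K0..-\<epsilon>})))"
  have T0: "0 \<le> T" by (simp add: T_def)
  have big: "K < c * (\<epsilon> * exp (\<epsilon> * T))" if "0 < c" "K / (\<epsilon>\<^sup>2 * c) \<le> T" for c
  proof -
    have "K \<le> T * (\<epsilon>\<^sup>2 * c)" using that \<epsilon> by (simp add: pos_divide_le_eq)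
    also have "\<dots> = c * \<epsilon> * (\<epsilon> * T)" by (simp add: power2_eq_square)
    also have "\<epsilon> * T < exp (\<epsilon> * T)"
      using exp_ge_add_one_self[of "\<epsilon> * T"] by linarith
    then have "c * \<epsilon> * (\<epsilon> * T) < c * \<epsilon> * exp (\<epsilon> * T)"
      using that \<epsilon> by (intro mult_strict_left_mono) auto
    finally show ?thesis by (simp add: mult.assoc)
  qed
  have mT: "0 < m T"
  proof -
    have "0 < measure M {\<epsilon>..K0} * (\<epsilon> * exp (\<epsilon> * T)) - K"
      using big[OF mass1] by (simp add: T_def)
    also have "\<dots> = (\<integral>y. indicator {\<epsilon>..K0} y * (\<epsilon> * exp (\<epsilon> * T)) - K \<partial>M)"
      by (subst Bochner_Integration.integral_diff) (auto simp: prob_space[unfolded space_eq_univ] emeasure_eq_measure)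
    also have "\<dots> \<le> m T"
      unfolding m_def
    proof (intro integral_mono int)
      fix y
      show "indicator {\<epsilon>..K0} y * (\<epsilon> * exp (\<epsilon> * T)) - K \<le> indicator {-K..K} y * (y * exp (T * y))"
      proof (cases "y \<in> {\<epsilon>..K0}")
        case True
        then have "\<epsilon> * exp (\<epsilon> * T) \<le> y * exp (T * y)"
          using \<epsilon> T0 mult_left_mono[of \<epsilon> y T] by (intro mult_mono) (auto simp: mult.commute)
        then show ?thesis using True K \<epsilon> by auto
      next
        case False
        have "- K \<le> y * exp (T * y)" if "y \<in> {-K..K}"
        proof (cases "0 \<le> y")
          case True
          then have "0 \<le> y * exp (T * y)" by simp
          then show ?thesis using \<epsilon>K by linarith
        next
          case False
          then have "y * 1 \<le> y * exp (T * y)"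
            using T0 by (intro mult_left_mono_neg) (auto simp: mult_nonneg_nonpos)
          then show ?thesis using that by simp
        qed
        then show ?thesis using False \<epsilon>K by (auto simp: indicator_def)
      qed
    qed (auto simp: emeasure_eq_measure)
    finally show ?thesis .
  qed
  have mT': "m (- T) < 0"
  proof -
    have "0 < measure M {-K0..-\<epsilon>} * (\<epsilon> * exp (\<epsilon> * T)) - K"
      using big[OF mass2] by (simp add: T_def)
    also have "\<dots> = (\<integral>y. indicator {-K0..-\<epsilon>} y * (\<epsilon> * exp (\<epsilon> * T)) - K \<partial>M)"
      by (subst Bochner_Integration.integral_diff) (auto simp: prob_space[unfolded space_eq_univ] emeasure_eq_measure)
    also have "\<dots> \<le> (\<integral>y. - (indicator {-K..K} y * (y * exp (- T * y))) \<partial>M)"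
    proof (intro integral_mono Bochner_Integration.integrable_minus int)
      fix y
      show "indicator {-K0..-\<epsilon>} y * (\<epsilon> * exp (\<epsilon> * T)) - K \<le> - (indicator {-K..K} y * (y * exp (- T * y)))"
      proof (cases "y \<in> {-K0..-\<epsilon>}")
        case True
        then have "\<epsilon> * exp (\<epsilon> * T) \<le> - y * exp (- T * y)"
          using \<epsilon> T0 mult_left_mono[of \<epsilon> "-y" T] by (intro mult_mono) (auto simp: mult.commute)
        then show ?thesis using True K \<epsilon> by auto
      next
        case False
        have "y * exp (- T * y) \<le> K" if "y \<in> {-K..K}"
        proof (cases "y \<le> 0")
          case True
          then have "y * exp (- T * y) \<le> 0" by (simp add: mult_nonpos_nonneg)
          then show ?thesis using \<epsilon>K by linarith
        next
          case False
          then have "y * exp (- T * y) \<le> y * 1"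
            using T0 by (intro mult_left_mono) (auto simp: mult_nonneg_nonneg)
          then show ?thesis using that by simp
        qed
        then show ?thesis using False \<epsilon>K by (auto simp: indicator_def)
      qed
    qed (auto simp: emeasure_eq_measure)
    also have "\<dots> = - m (- T)" unfolding m_def by simp
    finally show ?thesis by simp
  qed
  \<comment> \<open>The largest point \<open>t0\<close> with \<open>m t0 \<le> 0\<close> has
    \<open>m > 0\<close> immediately to its right, and continuity then forces
    \<open>m t0 = 0\<close>.\<close>
  have "compact {t\<in>{-T..T}. m t \<le> 0}"
  proof -
    have "closed {t. m t \<le> 0}"
      using cont_m by (intro closed_Collect_le continuous_intros) (simp add: continuous_at_imp_continuous_on)
    then have "compact ({-T..T} \<inter> {t. m t \<le> 0})" by (intro compact_Int_closed) auto
    also have "{-T..T} \<inter> {t. m t \<le> 0} = {t\<in>{-T..T}. m t \<le> 0}" by blast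
    finally show ?thesis .
  qed
  moreover have "- T \<in> {t\<in>{-T..T}. m t \<le> 0}" using mT' T0 by simp
  ultimately obtain t0 where t0: "t0 \<in> {-T..T}" "m t0 \<le> 0"
    and max: "\<And>t. t \<in> {-T..T} \<Longrightarrow> m t \<le> 0 \<Longrightarrow> t \<le> t0"
    using compact_attains_sup[of "{t\<in>{-T..T}. m t \<le> 0}"] by blast
  have "t0 < T" using t0 mT by (cases "t0 = T") auto
  have right: "\<forall>\<^sub>F t in at_right t0. 0 < m t"
    unfolding eventually_at_right_field
    using \<open>t0 < T\<close> t0 max by (intro exI[of _ T]) (metis atLeastAtMost_iff dual_order.strict_trans1 less_imp_le not_le)
  have "0 \<le> m t0"
  proof (rule tendsto_lowerbound)
    show "(m \<longlongrightarrow> m t0) (at_right t0)"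
      using cont_m[of t0] unfolding isCont_def by (rule tendsto_mono[rotated]) (simp add: at_le)
    show "\<forall>\<^sub>F t in at_right t0. 0 \<le> m t" using right by eventually_elim simp
  qed simp
  with t0 have m0: "m t0 = 0" by simp
  have "isCont (\<lambda>t. t * m t / \<phi> t - ln (\<phi> t)) t0"
    using \<phi>_pos[of t0] cont_\<phi>[of t0] cont_m[of t0]
    by (intro continuous_intros isCont_ln') auto
  then have "((\<lambda>t. t * m t / \<phi> t - ln (\<phi> t)) \<longlongrightarrow> - ln (\<phi> t0)) (at_right t0)"
    unfolding isCont_def by (simp add: m0) (rule tendsto_mono[rotated], assumption, simp add: at_le)
  moreover have "- ln (\<phi> t0) < a"
    using low[of t0] \<phi>_pos[of t0] ln_less_cancel_iff[of "exp (- a)" "\<phi> t0"] by (simp add: \<phi>_def)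
  ultimately have "\<forall>\<^sub>F t in at_right t0. t * m t / \<phi> t - ln (\<phi> t) < a"
    by (rule order_tendstoD)
  with right have "\<forall>\<^sub>F t in at_right t0. 0 < m t \<and> t * m t / \<phi> t - ln (\<phi> t) < a"
    by eventually_elim simp
  then obtain t where "0 < m t" "t * m t / \<phi> t - ln (\<phi> t) < a"
    using eventually_happens'[OF trivial_limit_at_right_real] by blast
  then show ?thesis
    using \<phi>_pos[of t] by (intro exI[of _ K] exI[of _ t]) (simp add: \<phi>_def m_def)
qed


text \<open>
  In the degenerate case \<open>measure M {0<..} = 0\<close> the threshold can only be met by steps that are
  exactly \<open>0\<close>, and conditioning on such steps is the optimal control.
\<close>

lemma (in real_distribution) exists_control:
  assumes neg: "0 < measure M {..<0}" and a: "0 < a" "a < a'"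
    and mgf: "\<And>t. ennreal (exp (- a)) < (\<integral>\<^sup>+y. ennreal (exp (t * y)) \<partial>M)"
  obtains D l d b where "D \<in> sets borel" "l \<in> borel_measurable borel" "0 \<le> b" "b < a'"
    "(\<integral>\<^sup>+y. ennreal (indicator D y * exp (l y)) \<partial>M) = 1"
    "\<forall>\<^sub>F s in at_right 0. (\<integral>\<^sup>+y. ennreal (indicator D y * exp (l y + s * (d - y))) \<partial>M) \<le> 1"
    "\<forall>\<^sub>F s in at_right 0. (\<integral>\<^sup>+y. ennreal (indicator D y * exp (l y + s * (l y - b))) \<partial>M) \<le> 1"
    "0 < d \<or> d = 0 \<and> D \<subseteq> {0} \<and> measure M {0<..} = 0"
proof (cases "measure M {0<..} = 0")
  case False
  then have pos: "0 < measure M {0<..}" by (simp add: zero_less_measure_iff)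
  obtain K t where Kt: "let \<phi> = (\<integral>y. indicator {-K..K} y * exp (t * y) \<partial>M);
      m = (\<integral>y. indicator {-K..K} y * (y * exp (t * y)) \<partial>M)
    in 0 < \<phi> \<and> 0 < m \<and> t * m / \<phi> - ln \<phi> < a"
    using exists_tilt[OF pos neg a(1) mgf] by blast
  define \<phi> where "\<phi> = (\<integral>y. indicator {-K..K} y * exp (t * y) \<partial>M)"
  define m where "m = (\<integral>y. indicator {-K..K} y * (y * exp (t * y)) \<partial>M)"
  have \<phi>: "0 < \<phi>" and m: "0 < m" and ent: "t * m / \<phi> - ln \<phi> < a"
    using Kt by (auto simp: Let_def \<phi>_def m_def)
  define l where "l y = t * y - ln \<phi>" for y
  \<comment> \<open>Half of the tilted mean for the drift, and a cost \<open>b'\<close> strictly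
    above the relative entropy: under the tilted law both \<open>d - y\<close> and
    \<open>l y - b'\<close> then have negative mean, as \<open>eventually_mgf_le_one\<close>
    requires.\<close>
  define d where "d = m / \<phi> / 2"
  define b where "b = max 0 (t * m / \<phi> - ln \<phi>)"
  define b' where "b' = (b + a') / 2"
  have b: "0 \<le> b" "b < a'" "t * m / \<phi> - ln \<phi> \<le> b" using ent a by (auto simp: b_def)
  have b': "0 \<le> b'" "b' < a'" "b < b'" using b a by (auto simp: b'_def)
  define g where "g y = indicator {-K..K} y * exp (l y)" for y :: real
  have g0: "0 \<le> g y" for y by (simp add: g_def)
  have g_eq: "g y = indicator {-K..K} y * exp (t * y) / \<phi>" for y
    using \<phi> by (simp add: g_def l_def exp_diff)
  have [measurable]: "g \<in> borel_measurable borel" "l \<in> borel_measurable borel"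
    unfolding g_def l_def by measurable
  define Q where "Q = density M (\<lambda>y. ennreal (g y))"
  have int: "integrable M (\<lambda>y. g y * h y)" if h: "continuous_on UNIV h" for h
  proof -
    have "integrable M (\<lambda>y. indicator {-K..K} y * (exp (l y) * h y))"
      unfolding l_def by (intro integrable_truncated continuous_intros h)
    then show ?thesis by (simp add: g_def mult.assoc)
  qed
  have int1: "integrable M g" using int[of "\<lambda>_. 1"] by simp
  have "integral\<^sup>L M g = (\<integral>y. indicator {-K..K} y * exp (t * y) \<partial>M) / \<phi>"
    unfolding g_eq by simp
  then have g1: "integral\<^sup>L M g = 1" using \<phi> by (simp add: \<phi>_def)
  have gy: "(\<integral>y. g y * y \<partial>M) = m / \<phi>"
  proof -
    have "(\<integral>y. g y * y \<partial>M) = (\<integral>y. indicator {-K..K} y * (y * exp (t * y)) / \<phi> \<partial>M)"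
      by (intro Bochner_Integration.integral_cong) (auto simp: g_eq)
    then show ?thesis by (simp add: m_def)
  qed
  have dens: "(\<integral>\<^sup>+y. ennreal (g y) \<partial>M) = 1"
    using nn_integral_eq_integral[OF int1] g0 g1 by simp
  interpret Q: prob_space Q
    by (rule prob_spaceI) (simp add: Q_def emeasure_density dens)
  have Q_int: "integrable Q h" if h: "continuous_on UNIV h" for h :: "real \<Rightarrow> real"
  proof -
    have "h \<in> borel_measurable M" using borel_measurable_continuous_onI[OF h] by simp
    then show ?thesis
      unfolding Q_def using int[OF h] g0 by (subst integrable_density) auto
  qed
  have Q_exp: "Q.expectation h = (\<integral>y. g y * h y \<partial>M)" if h: "continuous_on UNIV h" for h :: "real \<Rightarrow> real"
  proof -
    have "h \<in> borel_measurable M" using borel_measurable_continuous_onI[OF h] by simp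
    then show ?thesis unfolding Q_def using g0 by (subst integral_density) auto
  qed
  have Q_id: "Q.expectation (\<lambda>y. y) = m / \<phi>"
    using Q_exp[of "\<lambda>y. y"] gy by (simp add: continuous_on_id)
  have Q_nn: "(\<integral>\<^sup>+y. ennreal (exp (s * h y)) \<partial>Q) = (\<integral>\<^sup>+y. ennreal (indicator {-K..K} y * exp (l y + s * h y)) \<partial>M)"
    if h: "continuous_on UNIV h" for s h
  proof -
    have [measurable]: "h \<in> borel_measurable borel" using borel_measurable_continuous_onI[OF h] .
    have "(\<integral>\<^sup>+y. ennreal (exp (s * h y)) \<partial>Q) = (\<integral>\<^sup>+y. ennreal (g y) * ennreal (exp (s * h y)) \<partial>M)"
      unfolding Q_def by (subst nn_integral_density) auto
    also have "\<dots> = (\<integral>\<^sup>+y. ennreal (indicator {-K..K} y * exp (l y + s * h y)) \<partial>M)"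
      by (intro nn_integral_cong) (simp add: ennreal_mult'[symmetric] g0 g_def exp_add mult.assoc)
    finally show ?thesis .
  qed
  have upto: "\<forall>\<^sub>F s in at_right 0. (\<integral>\<^sup>+y. ennreal (indicator {-K..K} y * exp (l y + s * h y)) \<partial>M) \<le> 1"
    if h: "continuous_on UNIV h" and "Q.expectation h < 0" for h
    unfolding Q_nn[OF h, symmetric]
    by (rule Q.eventually_mgf_le_one[of h 1]) (use that in \<open>auto intro!: Q_int continuous_intros\<close>)
  show ?thesis
  proof (rule that[of "{-K..K}" l b' d])
    show "(\<integral>\<^sup>+y. ennreal (indicator {-K..K} y * exp (l y)) \<partial>M) = 1"
      using dens by (simp add: g_def)
    show "\<forall>\<^sub>F s in at_right 0. (\<integral>\<^sup>+y. ennreal (indicator {-K..K} y * exp (l y + s * (d - y))) \<partial>M) \<le> 1"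
    proof (rule upto)
      have "Q.expectation (\<lambda>y. d - y) = d - m / \<phi>"
        using Q_int[of "\<lambda>y. y"] Q_id by (simp add: continuous_on_id Q.prob_space)
      also have "\<dots> < 0" using m \<phi> by (simp add: d_def field_simps)
      finally show "Q.expectation (\<lambda>y. d - y) < 0" .
    qed (intro continuous_intros)
    show "\<forall>\<^sub>F s in at_right 0. (\<integral>\<^sup>+y. ennreal (indicator {-K..K} y * exp (l y + s * (l y - b'))) \<partial>M) \<le> 1"
    proof (rule upto)
      have "Q.expectation (\<lambda>y. l y - b') = t * (m / \<phi>) - ln \<phi> - b'"
        unfolding l_def using Q_int[of "\<lambda>y. y"] Q_id by (simp add: continuous_on_id Q.prob_space)
      also have "\<dots> < 0" using b b' by simp
      finally show "Q.expectation (\<lambda>y. l y - b') < 0" .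
    qed (unfold l_def, intro continuous_intros)
    show "0 < d \<or> d = 0 \<and> {-K..K} \<subseteq> {0} \<and> measure M {0<..} = 0" using m \<phi> by (simp add: d_def)
  qed (use b' in auto)
next
  case True
  define \<rho> where "\<rho> = measure M {0}"
  have nonpos: "AE y in M. y \<le> 0"
    by (rule AE_I[of _ _ "{0<..}"]) (auto simp: emeasure_eq_measure True)
  \<comment> \<open>For nonpositive \<open>y\<close>, \<open>exp (n * y)\<close> decreases to the
    indicator of 0, so the lower bound on the moment generating function passes to the atom and
    gives \<open>exp (- a) \<le> \<rho>\<close>.\<close>
  have lim: "(\<lambda>n. expectation (\<lambda>y. exp (real n * y))) \<longlonglongrightarrow> expectation (indicator {0})"
  proof (rule integral_dominated_convergence[where w = "\<lambda>_. 1"])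
    show "AE y in M. (\<lambda>n. exp (real n * y)) \<longlonglongrightarrow> indicator {0} y"
      using nonpos
    proof eventually_elim
      case (elim y)
      have "(\<lambda>n. exp y ^ n) \<longlonglongrightarrow> 0" if "y < 0" using that by (intro LIMSEQ_realpow_zero) auto
      then show ?case using elim by (cases "y = 0") (auto simp: exp_of_nat_mult)
    qed
    show "AE y in M. norm (exp (real n * y)) \<le> 1" for n
      using nonpos by eventually_elim (simp add: mult_nonneg_nonpos)
  qed auto
  have ind: "expectation (indicator {0}) = \<rho>" by (simp add: \<rho>_def)
  have "exp (- a) \<le> \<rho>"
  proof (rule tendsto_lowerbound[OF lim[unfolded ind]])
    show "\<forall>\<^sub>F n in sequentially. exp (- a) \<le> expectation (\<lambda>y. exp (real n * y))"
    proof (intro always_eventually allI)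
      fix n
      have "integrable M (\<lambda>y. exp (real n * y))"
        using nonpos by (intro integrable_const_bound[where B = 1])
          (auto elim!: eventually_mono simp: mult_nonneg_nonpos)
      then have "(\<integral>\<^sup>+y. ennreal (exp (real n * y)) \<partial>M) = ennreal (expectation (\<lambda>y. exp (real n * y)))"
        by (intro nn_integral_eq_integral) auto
      with mgf[of "real n"] show "exp (- a) \<le> expectation (\<lambda>y. exp (real n * y))"
        by (simp add: ennreal_less_iff)
    qed
  qed simp
  then have "0 < \<rho>" "ln (exp (- a)) \<le> ln \<rho>"
    using exp_gt_zero[of "- a"] by (auto simp del: ln_exp exp_gt_zero)
  then have \<rho>: "0 < \<rho>" "- ln \<rho> \<le> a" by auto
  have point: "(\<integral>\<^sup>+y. ennreal (indicator {0} y * exp (- ln \<rho> + h y)) \<partial>M) = ennreal (exp (h 0))" for h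
  proof -
    have "(\<integral>\<^sup>+y. ennreal (indicator {0} y * exp (- ln \<rho> + h y)) \<partial>M) =
        (\<integral>\<^sup>+y. ennreal (exp (- ln \<rho> + h 0)) * indicator {0} y \<partial>M)"
      by (intro nn_integral_cong) (auto simp: indicator_def)
    also have "\<dots> = ennreal (exp (- ln \<rho> + h 0)) * ennreal \<rho>"
      by (subst nn_integral_cmult) (auto simp: \<rho>_def emeasure_eq_measure)
    also have "\<dots> = ennreal (exp (h 0))"
      using \<rho> by (simp add: ennreal_mult'[symmetric] exp_add exp_diff exp_minus)
    finally show ?thesis .
  qed
  show ?thesis
  proof (rule that[of "{0}" "\<lambda>_. - ln \<rho>" a 0])
    show "(\<integral>\<^sup>+y. ennreal (indicator {0} y * exp (- ln \<rho>)) \<partial>M) = 1"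
      using point[of "\<lambda>_. 0"] by simp
    show "\<forall>\<^sub>F s in at_right 0. (\<integral>\<^sup>+y. ennreal (indicator {0} y * exp (- ln \<rho> + s * (0 - y))) \<partial>M) \<le> 1"
      using point[of "\<lambda>y. s * (0 - y)" for s] by simp
    show "\<forall>\<^sub>F s in at_right 0. (\<integral>\<^sup>+y. ennreal (indicator {0} y * exp (- ln \<rho> + s * (- ln \<rho> - a))) \<partial>M) \<le> 1"
      using eventually_at_right_less[of "0::real"]
    proof eventually_elim
      case (elim s)
      then have "s * (- ln \<rho> - a) \<le> 0" using \<rho> by (intro mult_nonneg_nonpos) auto
      then show ?case using point[of "\<lambda>y. s * (- ln \<rho> - a)"] by simp
    qed
  qed (use a True in auto)
qed

section \<open>From occupation times to averages\<close>

lemma integrable_exp_shift: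
  fixes c t :: real
  assumes "integrable M (\<lambda>x. exp (t * x))"
  shows "integrable M (\<lambda>x. exp (t * (x - c)))"
proof -
  have "integrable M (\<lambda>x. exp (- (t * c)) * exp (t * x))" using assms by simp
  then show ?thesis by (simp add: exp_add[symmetric] algebra_simps)
qed

text \<open>Subtracting from each increment the mean of its current regime leaves fluctuations of
  order \<open>o(T)\<close>, bounded from above and below. The subtracted means differ from the good
  one only at bad times, each time by the distance of the two means.\<close>

lemma (in switching_walk) average_bound:
  fixes \<kappa> :: real
  defines "m \<equiv> \<lambda>i. \<integral>y. y \<partial>R i"
  assumes int: "\<And>i. integrable (R i) (\<lambda>y. y)"
    and t: "0 < t" "\<And>i. integrable (R i) (\<lambda>y. exp (t * y))" "\<And>i. integrable (R i) (\<lambda>y. exp (- t * y))"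
    and frac: "AE \<omega> in M. \<forall>\<epsilon>>0. \<forall>\<^sub>F T in sequentially. (\<Sum>n<T. of_bool (\<not> J n \<omega>)) \<le> (\<kappa> + \<epsilon>) * real T"
  shows "AE \<omega> in M. \<forall>\<epsilon>>0. \<forall>\<^sub>F T in sequentially.
    \<bar>(\<Sum>n<T. Y n \<omega>) - real T * m True\<bar> \<le> (\<kappa> * \<bar>m False - m True\<bar> + \<epsilon>) * real T"
proof -
  have upper: "AE \<omega> in M. \<forall>\<epsilon>>0. \<forall>\<^sub>F T in sequentially. (\<Sum>n<T. (\<lambda>i y. y - m i) (J n \<omega>) (Y n \<omega>)) \<le> \<epsilon> * real T"
  proof (rule regime_strong_law)
    fix i :: bool and \<epsilon> :: real assume \<epsilon>: "0 < \<epsilon>"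
    interpret Ri: real_distribution "R i" by (rule R)
    show "\<forall>\<^sub>F s in at_right 0. (\<integral>\<^sup>+y. ennreal (exp (s * (y - m i - \<epsilon>))) \<partial>R i) \<le> 1"
    proof (rule Ri.eventually_mgf_le_one[OF _ t(1)])
      show "integrable (R i) (\<lambda>y. exp (t * (y - m i - \<epsilon>)))"
        using integrable_exp_shift[OF t(2), of i "m i + \<epsilon>"] by (simp add: diff_diff_add)
      show "Ri.expectation (\<lambda>y. y - m i - \<epsilon>) < 0"
        using int \<epsilon> by (simp add: Ri.prob_space[unfolded space_R] m_def)
    qed (use int in auto)
  qed auto
  have lower: "AE \<omega> in M. \<forall>\<epsilon>>0. \<forall>\<^sub>F T in sequentially. (\<Sum>n<T. (\<lambda>i y. m i - y) (J n \<omega>) (Y n \<omega>)) \<le> \<epsilon> * real T"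
  proof (rule regime_strong_law)
    fix i :: bool and \<epsilon> :: real assume \<epsilon>: "0 < \<epsilon>"
    interpret Ri: real_distribution "R i" by (rule R)
    show "\<forall>\<^sub>F s in at_right 0. (\<integral>\<^sup>+y. ennreal (exp (s * (m i - y - \<epsilon>))) \<partial>R i) \<le> 1"
    proof (rule Ri.eventually_mgf_le_one[OF _ t(1)])
      show "integrable (R i) (\<lambda>y. exp (t * (m i - y - \<epsilon>)))"
        using integrable_exp_shift[OF t(3), of i "m i - \<epsilon>"] by (simp add: algebra_simps)
      show "Ri.expectation (\<lambda>y. m i - y - \<epsilon>) < 0"
        using int \<epsilon> by (simp add: Ri.prob_space[unfolded space_R] m_def)
    qed (use int in auto)
  qed auto
  from upper lower frac show ?thesis
  proof eventually_elim
    case (elim \<omega>)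
    show ?case
    proof (intro allI impI)
      fix \<epsilon> :: real assume \<epsilon>: "0 < \<epsilon>"
      define \<Delta> where "\<Delta> = \<bar>m False - m True\<bar>"
      define e where "e = \<epsilon> / (1 + \<Delta>)"
      have \<Delta>: "0 \<le> \<Delta>" by (simp add: \<Delta>_def)
      have e: "0 < e" "e * (1 + \<Delta>) = \<epsilon>" using \<epsilon> \<Delta> by (auto simp: e_def)
      from elim e have "\<forall>\<^sub>F T in sequentially. (\<Sum>n<T. (\<lambda>i y. y - m i) (J n \<omega>) (Y n \<omega>)) \<le> e * real T"
        "\<forall>\<^sub>F T in sequentially. (\<Sum>n<T. (\<lambda>i y. m i - y) (J n \<omega>) (Y n \<omega>)) \<le> e * real T"
        "\<forall>\<^sub>F T in sequentially. (\<Sum>n<T. of_bool (\<not> J n \<omega>)) \<le> (\<kappa> + e) * real T"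
        by blast+
      then show "\<forall>\<^sub>F T in sequentially.
          \<bar>(\<Sum>n<T. Y n \<omega>) - real T * m True\<bar> \<le> (\<kappa> * \<bar>m False - m True\<bar> + \<epsilon>) * real T"
      proof eventually_elim
        case (elim T)
        have "\<bar>(\<Sum>n<T. Y n \<omega> - m (J n \<omega>))\<bar> \<le> e * real T"
          using elim(1,2) by (simp add: sum_subtractf)
        moreover have "\<bar>(\<Sum>n<T. m (J n \<omega>) - m True)\<bar> \<le> (\<kappa> + e) * real T * \<Delta>"
        proof -
          have "\<bar>(\<Sum>n<T. m (J n \<omega>) - m True)\<bar> \<le> (\<Sum>n<T. \<bar>m (J n \<omega>) - m True\<bar>)"
            by (rule sum_abs)
          also have "\<dots> = (\<Sum>n<T. of_bool (\<not> J n \<omega>) * \<Delta>)"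
            by (intro sum.cong) (auto simp: \<Delta>_def)
          also have "\<dots> = (\<Sum>n<T. of_bool (\<not> J n \<omega>)) * \<Delta>" by (simp add: sum_distrib_right)
          also have "\<dots> \<le> (\<kappa> + e) * real T * \<Delta>" using elim(3) \<Delta> by (intro mult_right_mono)
          finally show ?thesis .
        qed
        moreover have "(\<Sum>n<T. Y n \<omega>) - real T * m True =
            (\<Sum>n<T. Y n \<omega> - m (J n \<omega>)) + (\<Sum>n<T. m (J n \<omega>) - m True)"
          by (simp add: sum_subtractf)
        ultimately have "\<bar>(\<Sum>n<T. Y n \<omega>) - real T * m True\<bar> \<le> e * real T + (\<kappa> + e) * real T * \<Delta>"
          by linarith
        also have "\<dots> = (\<kappa> * \<Delta> + e * (1 + \<Delta>)) * real T" by (simp add: algebra_simps)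
        finally show ?case unfolding e(2) by (simp add: \<Delta>_def)
      qed
    qed
  qed
qed

section \<open>Choice of the constants of the control\<close>

text \<open>Otherwise the mean would be at most half of itself. The positive mass makes it possible
  to condition good increments on being at least half their mean.\<close>

lemma (in real_distribution) mass_above_half_mean:
  assumes int: "integrable M (\<lambda>y. y)" and pos: "0 < expectation (\<lambda>y. y)"
  shows "0 < measure M {expectation (\<lambda>y. y) / 2..}"
proof (rule ccontr)
  assume "\<not> ?thesis"
  then have "emeasure M {expectation (\<lambda>y. y) / 2..} = 0"
    by (simp add: emeasure_eq_measure not_less measure_le_0_iff)
  then have "AE y in M. y \<le> expectation (\<lambda>y. y) / 2"
    by (intro AE_I[of _ _ "{expectation (\<lambda>y. y) / 2..}"]) auto
  then have "expectation (\<lambda>y. y) \<le> expectation (\<lambda>_. expectation (\<lambda>y. y) / 2)"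
    using int by (intro integral_mono_AE) auto
  then show False using pos by (simp add: prob_space[unfolded space_eq_univ])
qed

text \<open>Polynomially many window endpoints against one exponential. The constant 10 comes from
  \<open>2 * N + 1 \<le> 3 * N\<close> and \<open>1 \<le> N\<^sup>2\<close>.\<close>

lemma square_times_exp_le_half:
  fixes x :: real
  assumes "0 < x"
  shows "\<forall>\<^sub>F N in sequentially. ((2 * real N + 1)\<^sup>2 + 1) * exp (- (x * real N)) \<le> 1 / 2"
proof -
  define y where "y = exp (- (x / 2))"
  have "(\<lambda>N. real N * y ^ N) \<longlonglongrightarrow> 0"
    by (rule powser_times_n_limit_0) (use assms in \<open>simp add: y_def\<close>)
  then have "(\<lambda>N. 10 * (real N * y ^ N)\<^sup>2) \<longlonglongrightarrow> 10 * 0\<^sup>2" by (intro tendsto_intros)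
  then have "\<forall>\<^sub>F N in sequentially. 10 * (real N * y ^ N)\<^sup>2 < 1 / 2" by (rule order_tendstoD) simp
  then show ?thesis
    using eventually_ge_at_top[of 1]
  proof eventually_elim
    case (elim N)
    have "(2 * real N + 1)\<^sup>2 + 1 \<le> 10 * (real N)\<^sup>2"
    proof -
      have "(2 * real N + 1)\<^sup>2 \<le> (3 * real N)\<^sup>2" "1 \<le> (real N)\<^sup>2"
        using elim power_mono[of "2 * real N + 1" "3 * real N" 2] power_mono[of 1 "real N" 2] by auto
      then show ?thesis by (simp add: power_mult_distrib)
    qed
    then have "((2 * real N + 1)\<^sup>2 + 1) * exp (- (x * real N)) \<le> 10 * (real N)\<^sup>2 * exp (- (x * real N))"
      by (intro mult_right_mono) auto
    also have "\<dots> = 10 * (real N * y ^ N)\<^sup>2"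
      by (simp add: y_def exp_of_nat_mult[symmetric] power2_eq_square exp_add[symmetric])
    finally show ?case using elim by linarith
  qed
qed

text \<open>Stages 0, 1 and 2 use the control of the bad law, the good law conditioned on
  \<open>{c..}\<close> and the unchanged good law. Each drift and entropy test succeeds for all
  small \<open>s\<close>, so a single \<open>s\<close> serves them all. Of the objects chosen here
  only \<open>K\<close> depends on \<open>N\<close>.\<close>

lemma exists_parameters:
  fixes R :: "bool \<Rightarrow> real measure"
  assumes R: "\<And>i. real_distribution (R i)" and int: "\<And>i. integrable (R i) (\<lambda>y. y)"
    and good: "0 < (\<integral>y. y \<partial>R True)" and bad: "(\<integral>y. y \<partial>R False) < 0"
    and t: "0 < t" "integrable (R True) (\<lambda>y. exp (- t * y))"
    and a: "0 < a" "a < a'"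
    and mgf: "\<And>t. ennreal (exp (- a)) < (\<integral>\<^sup>+y. ennreal (exp (t * y)) \<partial>R False)"
  obtains s c \<delta> :: real and l :: "nat \<Rightarrow> real \<Rightarrow> real" and d b :: "nat \<Rightarrow> real"
    and dom :: "nat \<Rightarrow> real set" and K :: "nat \<Rightarrow> nat"
  where "0 < s" "\<And>j. dom j \<in> sets borel" "\<And>j. l j \<in> borel_measurable borel"
    "\<And>j. j \<in> {0, 1, 2} \<Longrightarrow> (\<integral>\<^sup>+y. ennreal (indicator (dom j) y * exp (l j y)) \<partial>R (j \<noteq> 0)) = 1"
    "\<And>j. j \<in> {0, 1, 2} \<Longrightarrow>
      (\<integral>\<^sup>+y. ennreal (indicator (dom j) y * exp (l j y + s * (d j - y))) \<partial>R (j \<noteq> 0)) \<le> 1"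
    "\<And>j. j \<in> {0, 1, 2} \<Longrightarrow>
      (\<integral>\<^sup>+y. ennreal (indicator (dom j) y * exp (l j y + s * (l j y - b j))) \<partial>R (j \<noteq> 0)) \<le> 1"
    "d 1 = c" "d 2 = c" "dom 1 = {c..}" "0 < c" "\<delta> \<le> c"
    "0 < d 0 \<and> \<delta> \<le> d 0 \<or> d 0 = 0 \<and> dom 0 \<subseteq> {0} \<and> measure (R False) {0<..} = 0"
    "\<And>N. 2 * \<delta> * real N \<le> c * real (K N)" "0 \<le> b 0" "0 \<le> b 1" "b 2 = 0"
    "\<forall>\<^sub>F N in sequentially. ((2 * real N + 1)\<^sup>2 + 1) * exp (- (s * \<delta> * real N)) \<le> 1 / 2"
    "\<forall>\<^sub>F N in sequentially. b 0 * real N + b 1 * real (K N) + \<delta> * real N \<le> a' * real N"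
proof -
  interpret T: real_distribution "R True" by (rule R)
  interpret B: real_distribution "R False" by (rule R)
  have neg: "0 < measure (R False) {..<0}"
  proof (rule ccontr)
    assume "\<not> ?thesis"
    then have "emeasure (R False) {..<0} = 0"
      by (simp add: B.emeasure_eq_measure not_less measure_le_0_iff)
    then have "AE y in R False. 0 \<le> y"
      by (intro AE_I[of _ _ "{..<0}"]) auto
    then have "0 \<le> (\<integral>y. y \<partial>R False)" by (rule integral_nonneg_AE)
    then show False using bad by simp
  qed
  obtain D l0 d0 b0 where D: "D \<in> sets borel" "l0 \<in> borel_measurable borel" "0 \<le> b0" "b0 < a'"
    "(\<integral>\<^sup>+y. ennreal (indicator D y * exp (l0 y)) \<partial>R False) = 1"
    "\<forall>\<^sub>F s in at_right 0. (\<integral>\<^sup>+y. ennreal (indicator D y * exp (l0 y + s * (d0 - y))) \<partial>R False) \<le> 1"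
    "\<forall>\<^sub>F s in at_right 0. (\<integral>\<^sup>+y. ennreal (indicator D y * exp (l0 y + s * (l0 y - b0))) \<partial>R False) \<le> 1"
    "0 < d0 \<or> d0 = 0 \<and> D \<subseteq> {0} \<and> measure (R False) {0<..} = 0"
    by (rule B.exists_control[OF neg a mgf])
  define c where "c = (\<integral>y. y \<partial>R True) / 2"
  have c: "0 < c" using good by (simp add: c_def)
  define \<rho> where "\<rho> = measure (R True) {c..}"
  have \<rho>: "0 < \<rho>" "\<rho> \<le> 1"
    using T.mass_above_half_mean[OF int good] by (auto simp: \<rho>_def c_def)
  define h where "h = - ln \<rho>"
  have h: "0 \<le> h" using \<rho> by (simp add: h_def)
  have "\<forall>\<^sub>F s in at_right 0. (\<integral>\<^sup>+y. ennreal (exp (s * (c - y))) \<partial>R True) \<le> 1"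
  proof (rule T.eventually_mgf_le_one[OF _ t(1)])
    show "integrable (R True) (\<lambda>y. exp (t * (c - y)))"
      using integrable_exp_shift[OF t(2), of c] by (simp add: algebra_simps)
    show "T.expectation (\<lambda>y. c - y) < 0"
      using int good by (simp add: T.prob_space[unfolded T.space_eq_univ] c_def)
  qed (use int in auto)
  with D(6,7) eventually_at_right_less[of "0::real"]
  have "\<forall>\<^sub>F s in at_right 0. 0 < s \<and> (\<integral>\<^sup>+y. ennreal (exp (s * (c - y))) \<partial>R True) \<le> 1 \<and>
    (\<integral>\<^sup>+y. ennreal (indicator D y * exp (l0 y + s * (d0 - y))) \<partial>R False) \<le> 1 \<and>
    (\<integral>\<^sup>+y. ennreal (indicator D y * exp (l0 y + s * (l0 y - b0))) \<partial>R False) \<le> 1"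
    by eventually_elim simp
  then obtain s where s: "0 < s" "(\<integral>\<^sup>+y. ennreal (exp (s * (c - y))) \<partial>R True) \<le> 1"
    "(\<integral>\<^sup>+y. ennreal (indicator D y * exp (l0 y + s * (d0 - y))) \<partial>R False) \<le> 1"
    "(\<integral>\<^sup>+y. ennreal (indicator D y * exp (l0 y + s * (l0 y - b0))) \<partial>R False) \<le> 1"
    using eventually_happens'[OF trivial_limit_at_right_real] by blast
  define G where "G = (a' - b0) / 2"
  have G: "0 < G" using D by (simp add: G_def)
  \<comment> \<open>About \<open>2 * \<delta> * N / c\<close> forced steps at cost \<open>h\<close>
    and the fluctuation allowance \<open>\<delta> * N\<close> add up to
    \<open>\<delta> * (1 + 2 * h / c) * N\<close>, apart from an extra \<open>h\<close> for rounding
    \<open>K\<close> up. The room \<open>a' - b0\<close> is \<open>2 * G\<close>: one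
    \<open>G * N\<close> pays for this sum, the other for the rounding once \<open>N\<close> is
    large.\<close>
  define \<delta> where "\<delta> = min (min c (if 0 < d0 then d0 else c)) (G / (1 + 2 * h / c))"
  have den: "0 < 1 + 2 * h / c" using h c by (intro add_pos_nonneg) auto
  have \<delta>: "0 < \<delta>" "\<delta> \<le> c" "0 < d0 \<Longrightarrow> \<delta> \<le> d0" "\<delta> \<le> G / (1 + 2 * h / c)"
    using c G den unfolding \<delta>_def by auto
  have \<delta>G: "\<delta> * (1 + 2 * h / c) \<le> G" using \<delta>(4) den by (simp only: pos_le_divide_eq)
  define K where "K N = nat \<lceil>2 * \<delta> * real N / c\<rceil>" for N
  have K: "2 * \<delta> * real N / c \<le> real (K N)" "real (K N) \<le> 2 * \<delta> * real N / c + 1" for N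
  proof -
    have "0 \<le> 2 * \<delta> * real N / c" using \<delta> c by simp
    then show "2 * \<delta> * real N / c \<le> real (K N)" "real (K N) \<le> 2 * \<delta> * real N / c + 1"
      unfolding K_def by linarith+
  qed
  define dom where "dom j = (if j = 0 then D else if j = 1 then {c..} else UNIV)" for j :: nat
  define l where "l j y = (if j = 0 then l0 y else if j = 1 then h else 0)" for j :: nat and y
  define d where "d j = (if j = 0 then d0 else c)" for j :: nat
  define b where "b j = (if j = 0 then b0 else if j = 1 then h else 0)" for j :: nat
  have forced: "(\<integral>\<^sup>+y. ennreal (indicator {c..} y * exp h) \<partial>R True) = 1"
  proof -
    have "(\<integral>\<^sup>+y. ennreal (indicator {c..} y * exp h) \<partial>R True) = (\<integral>\<^sup>+y. ennreal (exp h) * indicator {c..} y \<partial>R True)"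
      by (intro nn_integral_cong) (auto simp: indicator_def)
    also have "\<dots> = ennreal (exp h) * ennreal \<rho>"
      by (subst nn_integral_cmult) (auto simp: \<rho>_def T.emeasure_eq_measure)
    also have "\<dots> = 1" using \<rho> by (simp add: h_def exp_minus ennreal_mult'[symmetric])
    finally show ?thesis .
  qed
  have forced_drift: "(\<integral>\<^sup>+y. ennreal (indicator {c..} y * exp (h + s * (c - y))) \<partial>R True) \<le> 1"
    unfolding forced[symmetric]
    by (intro nn_integral_mono ennreal_leI) (use s in \<open>auto simp: indicator_def mult_nonneg_nonpos\<close>)
  show ?thesis
  proof (rule that[of s dom l d b c \<delta> K])
    show "dom j \<in> sets borel" "l j \<in> borel_measurable borel" for j
      using D by (auto simp: dom_def l_def[abs_def])
    show "(\<integral>\<^sup>+y. ennreal (indicator (dom j) y * exp (l j y)) \<partial>R (j \<noteq> 0)) = 1" if "j \<in> {0, 1, 2}" for j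
      using that D(5) forced T.emeasure_space_1 by (auto simp: dom_def l_def)
    show "(\<integral>\<^sup>+y. ennreal (indicator (dom j) y * exp (l j y + s * (d j - y))) \<partial>R (j \<noteq> 0)) \<le> 1" if "j \<in> {0, 1, 2}" for j
      using that s forced_drift by (auto simp: dom_def l_def d_def)
    show "(\<integral>\<^sup>+y. ennreal (indicator (dom j) y * exp (l j y + s * (l j y - b j))) \<partial>R (j \<noteq> 0)) \<le> 1" if "j \<in> {0, 1, 2}" for j
      using that s forced T.emeasure_space_1 by (auto simp: dom_def l_def b_def)
    show "0 < d 0 \<and> \<delta> \<le> d 0 \<or> d 0 = 0 \<and> dom 0 \<subseteq> {0} \<and> measure (R False) {0<..} = 0"
      using D(8) \<delta> by (auto simp: d_def dom_def)
    show "2 * \<delta> * real N \<le> c * real (K N)" for N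
      using K(1)[of N] c by (simp add: pos_divide_le_eq mult.commute)
    show "\<forall>\<^sub>F N in sequentially. ((2 * real N + 1)\<^sup>2 + 1) * exp (- (s * \<delta> * real N)) \<le> 1 / 2"
      by (rule square_times_exp_le_half) (use s \<delta> in simp)
    show "\<forall>\<^sub>F N in sequentially. b 0 * real N + b 1 * real (K N) + \<delta> * real N \<le> a' * real N"
      using eventually_ge_at_top[of "nat \<lceil>h / G\<rceil>"]
    proof eventually_elim
      case (elim N)
      then have "h / G \<le> real N" by linarith
      then have hN: "h \<le> G * real N" using G by (simp add: pos_divide_le_eq mult.commute)
      have "b 0 * real N + b 1 * real (K N) + \<delta> * real N \<le> b0 * real N + h * (2 * \<delta> * real N / c + 1) + \<delta> * real N"
        unfolding b_def using K(2)[of N] h by (auto intro!: mult_left_mono)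
      also have "\<dots> = b0 * real N + \<delta> * (1 + 2 * h / c) * real N + h" by (simp add: algebra_simps)
      also have "\<dots> \<le> b0 * real N + G * real N + G * real N"
        using \<delta>G hN by (intro add_mono mult_right_mono) auto
      also have "\<dots> = a' * real N" by (simp add: G_def algebra_simps)
      finally show ?case .
    qed
  qed (use s c \<delta> D h in \<open>auto simp: d_def dom_def b_def\<close>)
qed

section \<open>The instantaneous process\<close>

lemma (in real_distribution) moment_gen_shift:
  "(\<integral>\<^sup>+x. ennreal (exp (t * (x - r))) \<partial>M) = ennreal (exp (- (t * r))) * moment_gen M t"
proof -
  have "(\<integral>\<^sup>+x. ennreal (exp (t * (x - r))) \<partial>M) = (\<integral>\<^sup>+x. ennreal (exp (- (t * r))) * ennreal (exp (t * x)) \<partial>M)"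
    by (simp add: ennreal_mult'[symmetric] exp_add[symmetric] algebra_simps)
  then show ?thesis unfolding moment_gen_def by (subst (asm) nn_integral_cmult) auto
qed

lemma ext_ln_less_iff: "ext_ln m < ereal x \<longleftrightarrow> m < ennreal (exp x)"
proof (cases m)
  case (real u)
  then show ?thesis
    using ln_less_cancel_iff[of u "exp x"] by (cases "u = 0") (auto simp: ext_ln_def ennreal_less_iff)
qed (simp add: ext_ln_def)

lemma less_ext_ln_iff: "ereal x < ext_ln m \<longleftrightarrow> ennreal (exp x) < m"
proof (cases m)
  case (real u)
  then show ?thesis
    using ln_less_cancel_iff[of "exp x" u] by (cases "u = 0") (auto simp: ext_ln_def ennreal_less_iff)
qed (simp add: ext_ln_def)

lemma ennreal_mult_exp_less_iff:
  "ennreal (exp y) < ennreal (exp x) * m \<longleftrightarrow> ennreal (exp (y - x)) < m"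
  "ennreal (exp x) * m < ennreal (exp y) \<longleftrightarrow> m < ennreal (exp (y - x))"
proof -
  have "ennreal (exp y) = ennreal (exp x) * ennreal (exp (y - x))"
    by (simp add: ennreal_mult'[symmetric] exp_add[symmetric])
  moreover have "ennreal (exp x) * u < ennreal (exp x) * v \<longleftrightarrow> u < v" for u v
  proof -
    have c: "ennreal (exp (- x)) * (ennreal (exp x) * w) = w" for w
      by (simp add: mult.assoc[symmetric] ennreal_mult'[symmetric] exp_add[symmetric])
    have "u \<le> v" if "ennreal (exp x) * u \<le> ennreal (exp x) * v" for u v
      using mult_left_mono[OF that, of "ennreal (exp (- x))"] by (simp add: c)
    then show ?thesis by (metis mult_left_mono not_le zero_le)
  qed
  ultimately show "ennreal (exp y) < ennreal (exp x) * m \<longleftrightarrow> ennreal (exp (y - x)) < m"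
    "ennreal (exp x) * m < ennreal (exp y) \<longleftrightarrow> m < ennreal (exp (y - x))" by simp_all
qed

text \<open>Rates enter the proof in two ways. The tilt needs a bound at every \<open>t\<close>,
  which the supremum supplies; Chernoff's bound, through \<open>less_legendre_imp\<close>, needs one
  \<open>t\<close> whose value exceeds the chosen level.\<close>

lemma (in real_distribution) legendre_less_imp:
  assumes "legendre_transform M r < ereal a"
  shows "ennreal (exp (- a)) < (\<integral>\<^sup>+x. ennreal (exp (t * (x - r))) \<partial>M)"
proof -
  have "ereal (t * r) - ext_ln (moment_gen M t) \<le> legendre_transform M r"
    unfolding legendre_transform_def by (rule SUP_upper) simp
  with assms have "ereal (t * r) - ext_ln (moment_gen M t) < ereal a" by simp
  then have "ereal (t * r - a) < ext_ln (moment_gen M t)"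
    by (cases "ext_ln (moment_gen M t)") auto
  then show ?thesis
    unfolding moment_gen_shift less_ext_ln_iff ennreal_mult_exp_less_iff by (simp add: algebra_simps)
qed

lemma (in real_distribution) less_legendre_imp:
  assumes "ereal b < legendre_transform M r"
  shows "\<exists>t. (\<integral>\<^sup>+x. ennreal (exp (t * (x - r))) \<partial>M) < ennreal (exp (- b))"
proof -
  obtain t where "ereal b < ereal (t * r) - ext_ln (moment_gen M t)"
    using assms unfolding legendre_transform_def less_SUP_iff by blast
  then have "ext_ln (moment_gen M t) < ereal (t * r - b)"
    by (cases "ext_ln (moment_gen M t)") auto
  then show ?thesis
    unfolding moment_gen_shift ext_ln_less_iff ennreal_mult_exp_less_iff
    by (intro exI[of _ t]) (simp add: algebra_simps)
qed

lemma (in real_distribution) legendre_nonneg: "0 \<le> legendre_transform M r"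
proof -
  have "ext_ln (moment_gen M 0) = 0"
    using emeasure_space_1 by (simp add: moment_gen_def ext_ln_def)
  then have "0 = ereal (0 * r) - ext_ln (moment_gen M 0)" by simp
  also have "\<dots> \<le> legendre_transform M r"
    unfolding legendre_transform_def by (rule SUP_upper) simp
  finally show ?thesis .
qed

text \<open>By \<open>exp x \<ge> 1 + x\<close>, a nonnegative exponent gives at least 1 when the
  mean is positive. This fixes the sign of the exponent in Chernoff's bound for a nonpositive
  sum.\<close>

lemma (in real_distribution) mgf_less_one_imp_neg:
  assumes int: "integrable M (\<lambda>y. y)" and pos: "0 < expectation (\<lambda>y. y)"
    and less: "(\<integral>\<^sup>+y. ennreal (exp (t * y)) \<partial>M) < 1"
  shows "t < 0"
proof (rule ccontr)
  assume "\<not> t < 0"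
  have int_exp: "integrable M (\<lambda>y. exp (t * y))"
    using less by (intro integrableI_nonneg) (auto intro: order.strict_trans)
  have "1 \<le> 1 + t * expectation (\<lambda>y. y)" using \<open>\<not> t < 0\<close> pos by simp
  also have "\<dots> = expectation (\<lambda>y. 1 + t * y)"
    using int by (simp add: prob_space[unfolded space_eq_univ])
  also have "\<dots> \<le> expectation (\<lambda>y. exp (t * y))"
    using int int_exp by (intro integral_mono exp_ge_add_one_self) auto
  finally have "1 \<le> (\<integral>\<^sup>+y. ennreal (exp (t * y)) \<partial>M)"
    using int_exp by (subst nn_integral_eq_integral) auto
  then show False using less by simp
qed

section \<open>Reduction of the instantaneous process to a switching walk\<close>

context instantaneous_process
begin

lemma sets_past: "sets (past M X J n) \<subseteq> sets M"
  using subalgebra_past[of n] by (simp add: subalgebra_def)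

lemma space_past [simp]: "space (past M X J n) = space M"
  by (simp add: past_def)

lemma measurable_past_component:
  assumes "k \<le> n"
  shows "(\<lambda>\<omega>. (X k \<omega>, J k \<omega>)) \<in> measurable (past M X J n) (borel \<Otimes>\<^sub>M count_space UNIV)"
proof -
  let ?f = "\<lambda>\<omega>. \<lambda>k\<in>{..n}. (X k \<omega>, J k \<omega>)"
  have "?f \<in> measurable (past M X J n) (Pi\<^sub>M {..n} (\<lambda>_. borel \<Otimes>\<^sub>M count_space UNIV))"
    unfolding past_def by (rule measurable_vimage_algebra1) (auto simp: space_PiM space_pair_measure)
  from measurable_compose[OF this measurable_component_singleton[of k]] assms
  show ?thesis by simp
qed

lemma measurable_past:
  assumes "k \<le> n"
  shows "X k \<in> borel_measurable (past M X J n)" "J k \<in> measurable (past M X J n) (count_space UNIV)"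
  using measurable_compose[OF measurable_past_component[OF assms] measurable_fst]
    measurable_compose[OF measurable_past_component[OF assms] measurable_snd] by simp_all

lemma sets_past_Suc: "sets (past M X J n) \<subseteq> sets (past M X J (Suc n))"
proof -
  have "(\<lambda>\<omega>. \<lambda>k\<in>{..n}. (X k \<omega>, J k \<omega>)) \<in>
      measurable (past M X J (Suc n)) (Pi\<^sub>M {..n} (\<lambda>_. borel \<Otimes>\<^sub>M count_space UNIV))"
    by (intro measurable_restrict measurable_past_component) auto
  then have "(\<lambda>\<omega>. \<omega>) \<in> measurable (past M X J (Suc n)) (past M X J n)"
    unfolding past_def[of M X J n] by (intro measurable_vimage_algebra2) auto
  then show ?thesis
    by (auto dest!: measurable_sets simp: Int_absorb2 sets.sets_into_space) (metis Int_absorb2 sets.sets_into_space space_past)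
qed

text \<open>The defining property of conditional expectation, integrated over \<open>A\<close>;
  there the regime, and hence the conditional probability, is constant.\<close>

lemma increment_law:
  assumes A: "A \<in> sets (past M X J n)" and i: "\<And>\<omega>. \<omega> \<in> A \<Longrightarrow> J n \<omega> = i" and B: "B \<in> sets borel"
  shows "measure M {\<omega>\<in>A. X (Suc n) \<omega> - X n \<omega> \<in> B} = measure M A * measure (P i) B"
proof -
  note [measurable] = X_measurable
  have AM: "A \<in> sets M" using A sets_past by blast
  interpret S: finite_measure_subalgebra M "past M X J n"
    by unfold_locales (rule subalgebra_past)
  let ?f = "\<lambda>\<omega>. indicator B (X (Suc n) \<omega> - X n \<omega>) :: real"
  have int: "integrable M ?f"
    using B by (intro integrable_const_bound[where B = 1]) auto
  have "measure M {\<omega>\<in>A. X (Suc n) \<omega> - X n \<omega> \<in> B} = (\<integral>\<omega>\<in>A. ?f \<omega> \<partial>M)"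
  proof -
    have "{\<omega>\<in>A. X (Suc n) \<omega> - X n \<omega> \<in> B} = A \<inter> ((\<lambda>\<omega>. X (Suc n) \<omega> - X n \<omega>) -` B \<inter> space M)"
      using sets.sets_into_space[OF AM] by auto
    also have "\<dots> \<in> sets M"
      using AM B by (intro sets.Int measurable_sets[of _ M borel]) auto
    finally have m: "{\<omega>\<in>A. X (Suc n) \<omega> - X n \<omega> \<in> B} \<in> sets M" .
    have "(\<integral>\<omega>\<in>A. ?f \<omega> \<partial>M) = (\<integral>\<omega>. indicator {\<omega>\<in>A. X (Suc n) \<omega> - X n \<omega> \<in> B} \<omega> \<partial>M)"
      unfolding set_lebesgue_integral_def
      by (intro Bochner_Integration.integral_cong) (auto simp: indicator_def)
    also have "\<dots> = measure M {\<omega>\<in>A. X (Suc n) \<omega> - X n \<omega> \<in> B}"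
      using m sets.sets_into_space[OF m] by (simp add: Int_absorb2)
    finally show ?thesis by simp
  qed
  also have "\<dots> = (\<integral>\<omega>\<in>A. real_cond_exp M (past M X J n) ?f \<omega> \<partial>M)"
    by (rule S.real_cond_exp_intA[OF int A])
  also have "\<dots> = (\<integral>\<omega>\<in>A. measure (P i) B \<partial>M)"
  proof (rule set_lebesgue_integral_cong_AE)
    show "AE \<omega>\<in>A in M. real_cond_exp M (past M X J n) ?f \<omega> = measure (P i) B"
      using increment[OF B, of n] by eventually_elim (auto simp: i)
  qed (use AM in auto)
  also have "\<dots> = measure M A * measure (P i) B"
    using AM by (simp add: set_integral_const emeasure_eq_measure)
  finally show ?thesis .
qed

lemma regime_01:
  assumes "i\<^sub>0 \<in> {0, 1}" "1 \<le> N" "\<omega> \<in> space M"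
  shows "J n \<omega> \<in> {0, 1}"
proof (induction n)
  case 0
  then show ?case using J_start[of \<omega> 0] assms by simp
next
  case (Suc n)
  show ?case
  proof (cases "Suc n < N")
    case True
    then show ?thesis using J_start[of \<omega> "Suc n"] assms by simp
  next
    case False
    then show ?thesis
      using Suc J_from_0[of \<omega> "Suc n"] J_from_1[of \<omega> "Suc n"] assms by (auto split: if_splits)
  qed
qed

text \<open>The two transition rules coincide once the previous regime is known to be 0 or 1, so
  from time \<open>N\<close> on the regime is a function of the last \<open>N\<close> increments
  alone. Ties go to regime 1.\<close>

lemma regime_eq:
  assumes "i\<^sub>0 \<in> {0, 1}" "1 \<le> N" "\<omega> \<in> space M"
  shows "J (n + N) \<omega> = (if real N * r \<le> X (n + N) \<omega> - X n \<omega> then 1 else 0)"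
proof -
  have "(X (n + N) \<omega> - X n \<omega>) / real N < r \<longleftrightarrow> \<not> real N * r \<le> X (n + N) \<omega> - X n \<omega>"
    using assms by (simp add: pos_divide_less_eq not_le mult.commute)
  moreover have "J (n + N - 1) \<omega> = 0 \<or> J (n + N - 1) \<omega> = 1"
    using regime_01[OF assms, of "n + N - 1"] by auto
  ultimately show ?thesis
    using J_from_0[of \<omega> "n + N"] J_from_1[of \<omega> "n + N"] assms by (auto simp: not_le)
qed

lemma switching_walk_instantaneous:
  assumes start: "i\<^sub>0 \<in> {0, 1}" "1 \<le> N" and P: "real_distribution (P 0)" "real_distribution (P 1)"
    and gb: "{g, b} = {0, 1}"
  shows "switching_walk M (past M X J) (\<lambda>n \<omega>. J n \<omega> = g) (\<lambda>n \<omega>. \<sigma> * (X (Suc n) \<omega> - X n \<omega> - r))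
    (\<lambda>i. distr (P (if i then g else b)) borel (\<lambda>x. \<sigma> * (x - r)))"
proof (intro switching_walk.intro switching_walk_axioms.intro)
  show "prob_space M" by (rule prob_space_axioms)
  have Pgb: "real_distribution (P (if i then g else b))" for i
    using gb P by (cases i) (auto simp: doubleton_eq_iff)
  show "subalgebra M (past M X J n)" for n by (rule subalgebra_past)
  show "sets (past M X J n) \<subseteq> sets (past M X J (Suc n))" for n by (rule sets_past_Suc)
  show "(\<lambda>\<omega>. J n \<omega> = g) \<in> measurable (past M X J n) (count_space UNIV)" for n
    using measurable_past(2)[of n n] by measurable
  show "(\<lambda>\<omega>. \<sigma> * (X (Suc n) \<omega> - X n \<omega> - r)) \<in> borel_measurable (past M X J (Suc n))" for n
    using measurable_past(1)[of n "Suc n"] measurable_past(1)[of "Suc n" "Suc n"] by measurable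
  show "real_distribution (distr (P (if i then g else b)) borel (\<lambda>x. \<sigma> * (x - r)))" for i
  proof -
    interpret Q: real_distribution "P (if i then g else b)" by (rule Pgb)
    show ?thesis by (rule Q.real_distribution_distr) measurable
  qed
  fix n i A and B :: "real set"
  assume A: "A \<in> sets (past M X J n)" and i: "\<And>\<omega>. \<omega> \<in> A \<Longrightarrow> (J n \<omega> = g) = i" and B: "B \<in> sets borel"
  interpret Q: real_distribution "P (if i then g else b)" by (rule Pgb)
  define B' where "B' = (\<lambda>x. \<sigma> * (x - r)) -` B"
  have B': "B' \<in> sets borel"
    using B measurable_sets[of "\<lambda>x. \<sigma> * (x - r)" borel borel B] by (simp add: B'_def)
  \<comment> \<open>The Boolean regime records only whether \<open>J n\<close> equals
    \<open>g\<close>; since only 0 and 1 occur, its negation identifies \<open>b\<close>.\<close>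
  have J: "J n \<omega> = (if i then g else b)" if "\<omega> \<in> A" for \<omega>
  proof -
    have "\<omega> \<in> space M" using that sets.sets_into_space[OF A] by auto
    then have "J n \<omega> \<in> {g, b}" unfolding gb by (rule regime_01[OF start])
    then show ?thesis using i[OF that] by auto
  qed
  have "measure M {\<omega>\<in>A. X (Suc n) \<omega> - X n \<omega> \<in> B'} = measure M A * measure (P (if i then g else b)) B'"
    by (rule increment_law[OF A J B'])
  moreover have "emeasure (distr (P (if i then g else b)) borel (\<lambda>x. \<sigma> * (x - r))) B = emeasure (P (if i then g else b)) B'"
    using B by (subst emeasure_distr) (auto simp: B'_def)
  moreover have "{\<omega>\<in>A. \<sigma> * (X (Suc n) \<omega> - X n \<omega> - r) \<in> B} = {\<omega>\<in>A. X (Suc n) \<omega> - X n \<omega> \<in> B'}"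
    by (auto simp: B'_def)
  ultimately show "emeasure M {\<omega>\<in>A. \<sigma> * (X (Suc n) \<omega> - X n \<omega> - r) \<in> B} =
      emeasure M A * emeasure (distr (P (if i then g else b)) borel (\<lambda>x. \<sigma> * (x - r))) B"
    by (simp add: emeasure_eq_measure Q.emeasure_eq_measure ennreal_mult')
qed

lemma sum_increments:
  "(\<Sum>k=n..<n+m. \<sigma> * (X (Suc k) \<omega> - X k \<omega> - r)) = \<sigma> * (X (n + m) \<omega> - X n \<omega> - real m * r)"
  by (induction m) (simp_all add: algebra_simps)

end

section \<open>Passage to the limit in the window length\<close>

lemma limsup_liminf_tendsto:
  fixes x :: "nat \<Rightarrow> nat \<Rightarrow> real"
  assumes e: "e \<longlonglongrightarrow> 0"
    and close: "\<forall>\<^sub>F N in sequentially. \<forall>\<^sub>F n in sequentially. \<bar>x N n - c\<bar> \<le> e N"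
  shows "(\<lambda>N. limsup (\<lambda>n. ereal (x N n))) \<longlonglongrightarrow> ereal c"
    and "(\<lambda>N. liminf (\<lambda>n. ereal (x N n))) \<longlonglongrightarrow> ereal c"
proof -
  have lo: "(\<lambda>N. ereal (c - e N)) \<longlonglongrightarrow> ereal c" and hi: "(\<lambda>N. ereal (c + e N)) \<longlonglongrightarrow> ereal c"
    using tendsto_diff[OF tendsto_const e, of c] tendsto_add[OF tendsto_const e, of c] by simp_all
  have ge: "\<forall>\<^sub>F N in sequentially. ereal (c - e N) \<le> liminf (\<lambda>n. ereal (x N n))"
    using close
  proof eventually_elim
    case (elim N)
    show ?case by (rule Liminf_bounded) (use elim in \<open>eventually_elim, simp\<close>)
  qed
  have le: "\<forall>\<^sub>F N in sequentially. limsup (\<lambda>n. ereal (x N n)) \<le> ereal (c + e N)"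
    using close
  proof eventually_elim
    case (elim N)
    show ?case by (rule Limsup_bounded) (use elim in \<open>eventually_elim, simp\<close>)
  qed
  have mid: "liminf (\<lambda>n. ereal (x N n)) \<le> limsup (\<lambda>n. ereal (x N n))" for N
    by (rule Liminf_le_Limsup) simp
  show "(\<lambda>N. limsup (\<lambda>n. ereal (x N n))) \<longlonglongrightarrow> ereal c"
    by (rule tendsto_sandwich[OF _ le lo hi]) (use ge mid in \<open>auto elim!: eventually_mono intro: order_trans\<close>)
  show "(\<lambda>N. liminf (\<lambda>n. ereal (x N n))) \<longlonglongrightarrow> ereal c"
    by (rule tendsto_sandwich[OF ge _ lo hi]) (use le mid in \<open>auto elim!: eventually_mono intro: order_trans\<close>)
qed

text \<open>This is \<open>2 * N * q / p + q\<close> from \<open>regime_fraction\<close> with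
  \<open>p = exp (- a * N) / 2\<close> and \<open>q = exp (- b * N)\<close>.\<close>

lemma occupation_bound_tendsto:
  fixes a b :: real
  assumes "a < b" "0 < b"
  shows "(\<lambda>N. 2 * real N * exp (- (b * real N)) / (exp (- (a * real N)) / 2) + exp (- (b * real N))) \<longlonglongrightarrow> 0"
proof -
  have "(\<lambda>N. 4 * (real N * exp (- (b - a)) ^ N) + exp (- b) ^ N) \<longlonglongrightarrow> 4 * 0 + 0"
    using assms by (intro tendsto_add tendsto_mult tendsto_const powser_times_n_limit_0 LIMSEQ_realpow_zero) auto
  moreover have "4 * (real N * exp (- (b - a)) ^ N) + exp (- b) ^ N =
      2 * real N * exp (- (b * real N)) / (exp (- (a * real N)) / 2) + exp (- (b * real N))" for N
    by (simp add: exp_of_nat_mult[symmetric] exp_diff[symmetric] exp_minus field_simps) (simp add: exp_add[symmetric] algebra_simps)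
  ultimately show ?thesis by simp
qed

text \<open>
  The two cases are mirror images: with \<open>\<sigma> = 1\<close> the regime with the smaller rate of escape is \<open>1\<close>,
  with \<open>\<sigma> = -1\<close> it is \<open>0\<close>. After centring at \<open>r\<close> and multiplying by \<open>\<sigma>\<close>, the good regime \<open>g\<close> always has
  positive drift; only the convention for ties depends on the orientation.
\<close>

lemma dominant_regime:
  fixes P :: "nat \<Rightarrow> real measure" and \<mu> :: "nat \<Rightarrow> real" and r \<sigma> :: real and i\<^sub>0 g b :: nat
    and M :: "'a measure" and X :: "nat \<Rightarrow> nat \<Rightarrow> 'a \<Rightarrow> real" and J :: "nat \<Rightarrow> nat \<Rightarrow> 'a \<Rightarrow> nat"
  assumes distributions: "\<And>i. i \<in> {0, 1} \<Longrightarrow> real_distribution (P i)"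
    and finite_means: "\<And>i. i \<in> {0, 1} \<Longrightarrow> integrable (P i) (\<lambda>x. x)"
    and means: "\<And>i. i \<in> {0, 1} \<Longrightarrow> \<mu> i = (\<integral>x. x \<partial>P i)"
    and A: "\<mu> 0 < r" "r < \<mu> 1"
    and B: "measure (P 1) {..<r} > 0"
    and C: "\<exists>t\<^sub>0>0. \<forall>i\<in>{0, 1}. moment_gen (P i) t\<^sub>0 < \<infinity> \<and> moment_gen (P i) (- t\<^sub>0) < \<infinity>"
    and start: "i\<^sub>0 \<in> {0, 1}"
    and processes: "\<And>N. N \<ge> 1 \<Longrightarrow> instantaneous_process M P r i\<^sub>0 N (X N) (J N)"
    and orientation: "g = 1 \<and> b = 0 \<and> \<sigma> = 1 \<or> g = 0 \<and> b = 1 \<and> \<sigma> = -1"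
    and rates: "legendre_transform (P b) r < legendre_transform (P g) r"
  shows "AE \<omega> in M.
    (\<lambda>N. limsup (\<lambda>n. ereal (X N n \<omega> / real n))) \<longlonglongrightarrow> ereal (\<mu> g) \<and>
    (\<lambda>N. liminf (\<lambda>n. ereal (X N n \<omega> / real n))) \<longlonglongrightarrow> ereal (\<mu> g)"
proof -
  have gb: "g \<in> {0, 1}" "b \<in> {0, 1}" "{g, b} = {0, 1}" using orientation by auto
  have \<sigma>: "\<sigma> * \<sigma> = 1" "\<bar>\<sigma>\<bar> = 1" using orientation by auto
  interpret Pg: real_distribution "P g" by (rule distributions[OF gb(1)])
  interpret Pb: real_distribution "P b" by (rule distributions[OF gb(2)])
  define R where "R i = distr (P (if i then g else b)) borel (\<lambda>x. \<sigma> * (x - r))" for i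
  define p where "p i = (if i then g else b)" for i
  have R_p: "R i = distr (P (p i)) borel (\<lambda>x. \<sigma> * (x - r))" for i by (simp add: R_def p_def)
  have p01: "p i \<in> {0, 1}" for i using gb by (simp add: p_def)
  have sets_P: "sets (P (p i)) = sets borel" for i
    using distributions[OF p01] by (simp add: real_distribution.events_eq_borel)
  have m\<sigma>: "(\<lambda>x. \<sigma> * (x - r)) \<in> measurable (P (p i)) borel" for i
    using sets_P[of i] by (simp cong: measurable_cong_sets)
  have R: "real_distribution (R i)" for i
  proof -
    interpret Q: real_distribution "P (p i)" by (rule distributions[OF p01])
    show ?thesis unfolding R_p by (rule Q.real_distribution_distr) measurable
  qed
  have R_nn: "(\<integral>\<^sup>+y. ennreal (exp (t * y)) \<partial>R i) = (\<integral>\<^sup>+x. ennreal (exp ((t * \<sigma>) * (x - r))) \<partial>P (p i))" for i t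
    unfolding R_p by (subst nn_integral_distr[OF m\<sigma>]) (simp_all add: mult.assoc)
  have R_int: "integrable (R i) (\<lambda>y. y)" for i
  proof -
    interpret Q: real_distribution "P (p i)" by (rule distributions[OF p01])
    have "integrable (P (p i)) (\<lambda>x. \<sigma> * (x - r))"
      by (intro Bochner_Integration.integrable_mult_right Bochner_Integration.integrable_diff
          finite_means[OF p01] Q.integrable_const)
    then show ?thesis
      unfolding R_p by (rule integrable_distr_eq[OF m\<sigma> measurable_ident, unfolded id_def, THEN iffD2])
  qed
  have R_mean: "(\<integral>y. y \<partial>R i) = \<sigma> * (\<mu> (p i) - r)" for i
  proof -
    interpret Q: real_distribution "P (p i)" by (rule distributions[OF p01])
    have "(\<integral>y. y \<partial>R i) = (\<integral>x. \<sigma> * (x - r) \<partial>P (p i))"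
      unfolding R_p by (rule integral_distr[OF m\<sigma>]) simp
    then show ?thesis
      using finite_means[OF p01, of i] means[OF p01, of i] by (simp add: Q.prob_space[unfolded Q.space_eq_univ])
  qed
  have good: "0 < (\<integral>y. y \<partial>R True)" and bad: "(\<integral>y. y \<partial>R False) < 0"
    unfolding R_mean using orientation A by (auto simp: p_def)
  obtain t where t: "0 < t" and tfin: "\<And>i. i \<in> {0, 1} \<Longrightarrow> moment_gen (P i) t < \<infinity> \<and> moment_gen (P i) (- t) < \<infinity>"
    using C by blast
  have R_exp: "integrable (R i) (\<lambda>y. exp (u * y))" if u: "u = t \<or> u = - t" for i u
  proof (rule integrableI_nonneg)
    interpret Q: real_distribution "P (p i)" by (rule distributions[OF p01])
    have "moment_gen (P (p i)) (u * \<sigma>) < \<infinity>"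
      using tfin[OF p01[of i]] u orientation by auto
    then show "(\<integral>\<^sup>+y. ennreal (exp (u * y)) \<partial>R i) < \<infinity>"
      unfolding R_nn Q.moment_gen_shift by (simp add: ennreal_mult_less_top)
  qed (auto simp: R_p)
  \<comment> \<open>Three levels strictly between the rates: \<open>x1\<close> is the bound used for
    tilting the bad law, \<open>x2\<close> is the whole cost per step of an escape including forced
    steps and fluctuations, and \<open>x3\<close> is the Chernoff exponent of a crossing. The gap
    \<open>x2 < x3\<close> makes the occupation bound vanish.\<close>
  obtain x1 where x1: "legendre_transform (P b) r < ereal x1" "ereal x1 < legendre_transform (P g) r"
    using ereal_dense2[OF rates] by blast
  obtain x2 where x2: "x1 < x2" "ereal x2 < legendre_transform (P g) r"
    using ereal_dense2[OF x1(2)] by auto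
  obtain x3 where x3: "x2 < x3" "ereal x3 < legendre_transform (P g) r"
    using ereal_dense2[OF x2(2)] by auto
  have "0 < ereal x1" using Pb.legendre_nonneg x1(1) by (rule order_le_less_trans)
  then have x1_pos: "0 < x1" by simp
  have bad_mgf: "ennreal (exp (- x1)) < (\<integral>\<^sup>+y. ennreal (exp (u * y)) \<partial>R False)" for u
    unfolding R_nn p_def using Pb.legendre_less_imp[OF x1(1)] by simp
  obtain u where "(\<integral>\<^sup>+x. ennreal (exp (u * (x - r))) \<partial>P g) < ennreal (exp (- x3))"
    using Pg.less_legendre_imp[OF x3(2)] by blast
  then have good_mgf: "(\<integral>\<^sup>+y. ennreal (exp ((u * \<sigma>) * y)) \<partial>R True) < ennreal (exp (- x3))"
    unfolding R_nn p_def using \<sigma> by (simp add: mult.assoc)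
  define \<tau> where "\<tau> = - (u * \<sigma>)"
  have \<tau>: "0 \<le> \<tau>"
  proof -
    interpret RT: real_distribution "R True" by (rule R)
    have "ennreal (exp (- x3)) \<le> 1" using x1_pos x2 x3 by simp
    with good_mgf have "u * \<sigma> < 0"
      by (intro RT.mgf_less_one_imp_neg R_int good) (rule less_le_trans)
    then show ?thesis by (simp add: \<tau>_def)
  qed
  have good_mgf': "(\<integral>\<^sup>+y. ennreal (exp (- (\<tau> * y))) \<partial>R True) \<le> ennreal (exp (- x3))"
    using good_mgf by (simp add: \<tau>_def)
  have R_exp': "integrable (R True) (\<lambda>y. exp (- t * y))" by (rule R_exp) simp
  obtain s c \<delta> :: real and l :: "nat \<Rightarrow> real \<Rightarrow> real" and d h :: "nat \<Rightarrow> real"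
    and dom :: "nat \<Rightarrow> real set" and K :: "nat \<Rightarrow> nat" where
    params: "0 < s" "\<And>j. dom j \<in> sets borel" "\<And>j. l j \<in> borel_measurable borel"
    "\<And>j. j \<in> {0, 1, 2} \<Longrightarrow> (\<integral>\<^sup>+y. ennreal (indicator (dom j) y * exp (l j y)) \<partial>R (j \<noteq> 0)) = 1"
    "\<And>j. j \<in> {0, 1, 2} \<Longrightarrow>
      (\<integral>\<^sup>+y. ennreal (indicator (dom j) y * exp (l j y + s * (d j - y))) \<partial>R (j \<noteq> 0)) \<le> 1"
    "\<And>j. j \<in> {0, 1, 2} \<Longrightarrow>
      (\<integral>\<^sup>+y. ennreal (indicator (dom j) y * exp (l j y + s * (l j y - h j))) \<partial>R (j \<noteq> 0)) \<le> 1"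
    and ctl: "d 1 = c" "d 2 = c" "dom 1 = {c..}" "0 < c" "\<delta> \<le> c"
    and d0: "0 < d 0 \<and> \<delta> \<le> d 0 \<or> d 0 = 0 \<and> dom 0 \<subseteq> {0} \<and> measure (R False) {0<..} = 0"
    and K: "\<And>N. 2 * \<delta> * real N \<le> c * real (K N)" and h: "0 \<le> h 0" "0 \<le> h 1" "h 2 = (0::real)"
    and ev1: "\<forall>\<^sub>F N in sequentially. ((2 * real N + 1)\<^sup>2 + 1) * exp (- (s * \<delta> * real N)) \<le> 1 / 2"
    and ev2: "\<forall>\<^sub>F N in sequentially. h 0 * real N + h 1 * real (K N) + \<delta> * real N \<le> x2 * real N"
    by (rule exists_parameters[OF R R_int good bad t R_exp' x1_pos x2(1) bad_mgf]) (rule that, assumption+)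
  define \<kappa> where "\<kappa> N = 2 * real N * exp (- (x3 * real N)) / (exp (- (x2 * real N)) / 2) + exp (- (x3 * real N))" for N
  have \<kappa>: "\<kappa> \<longlonglongrightarrow> 0"
    unfolding \<kappa>_def[abs_def] using x1_pos x2 x3 by (intro occupation_bound_tendsto) auto
  define \<Delta> where "\<Delta> = \<bar>(\<integral>y. y \<partial>R False) - (\<integral>y. y \<partial>R True)\<bar>"
  \<comment> \<open>The term \<open>1 / N\<close> is the error allowed in the limit over
    \<open>n\<close>; any positive sequence tending to 0 would do.\<close>
  define e where "e N = \<kappa> N * \<Delta> + 1 / real N" for N
  have e: "e \<longlonglongrightarrow> 0"
    unfolding e_def[abs_def] using tendsto_add[OF tendsto_mult[OF \<kappa> tendsto_const[of \<Delta>]] lim_1_over_n] by simp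
  define ok where "ok N \<longleftrightarrow> 1 \<le> N \<and> ((2 * real N + 1)\<^sup>2 + 1) * exp (- (s * \<delta> * real N)) \<le> 1 / 2 \<and>
    h 0 * real N + h 1 * real (K N) + \<delta> * real N \<le> x2 * real N" for N
  have ok: "\<forall>\<^sub>F N in sequentially. ok N"
    using ev1 ev2 eventually_ge_at_top[of 1] unfolding ok_def by eventually_elim simp
  have single: "AE \<omega> in M. \<forall>\<^sub>F n in sequentially. \<bar>X N n \<omega> / real n - \<mu> g\<bar> \<le> e N" if N: "ok N" for N
  proof -
    have N1: "1 \<le> N" using N by (simp add: ok_def)
    interpret I: instantaneous_process M P r i\<^sub>0 N "X N" "J N" by (rule processes[OF N1])
    define Y where "Y n \<omega> = \<sigma> * (X N (Suc n) \<omega> - X N n \<omega> - r)" for n \<omega>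
    interpret W: switching_walk M "past M (X N) (J N)" "\<lambda>n \<omega>. J N n \<omega> = g" Y R
      unfolding Y_def[abs_def] R_def[abs_def]
      by (rule I.switching_walk_instantaneous[OF start N1 _ _ gb(3)]) (use distributions in auto)
    have sum_Y: "(\<Sum>k=n..<n+N. Y k \<omega>) = \<sigma> * (X N (n + N) \<omega> - X N n \<omega> - real N * r)" for n \<omega>
      unfolding Y_def by (rule I.sum_increments)
    have enter: "J N (n + N) \<omega> = g" if "\<omega> \<in> space M" "0 < (\<Sum>k=n..<n+N. Y k \<omega>)" for n \<omega>
      using that orientation I.regime_eq[OF start N1, of \<omega> n] by (auto simp: sum_Y)
    have leave: "(\<Sum>k=n..<n+N. Y k \<omega>) \<le> 0" if "\<omega> \<in> space M" "\<not> J N (n + N) \<omega> = g" for n \<omega>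
      using that enter[of \<omega> n] not_le by blast
    \<comment> \<open>For \<open>g = 1\<close> ties are decided in favour of \<open>g\<close>. For
      \<open>g = 0\<close> they go against it, but the bad law \<open>P 1\<close> charges
      \<open>{..<r}\<close>, which the reflection turns into the positive half-line, so the
      degenerate control with \<open>d 0 = 0\<close> cannot occur.\<close>
    have tie: "J N (n + N) \<omega> = g" if "\<omega> \<in> space M" "\<not> 0 < d 0" "0 \<le> (\<Sum>k=n..<n+N. Y k \<omega>)" for n \<omega>
    proof (cases "g = 1")
      case True
      then show ?thesis
        using that orientation I.regime_eq[OF start N1, of \<omega> n] by (auto simp: sum_Y)
    next
      case False
      then have gb0: "g = 0" "b = 1" "\<sigma> = -1" using orientation by auto
      have "(\<lambda>x. \<sigma> * (x - r)) -` {0<..} = {..<r}" using gb0 by auto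
      then have "measure (R False) {0<..} = measure (P 1) {..<r}"
        unfolding R_p using m\<sigma>[of False] gb0 Pb.space_eq_univ by (subst measure_distr) (auto simp: p_def)
      then show ?thesis using d0 that B by auto
    qed
    have frac: "AE \<omega> in M. \<forall>\<epsilon>>0. \<forall>\<^sub>F T in sequentially.
        (\<Sum>n<T. of_bool (\<not> J N n \<omega> = g)) \<le> (\<kappa> N + \<epsilon>) * real T"
      unfolding \<kappa>_def
    proof (rule W.regime_fraction[OF N1])
      show "exp (- (x2 * real N)) / 2 \<le> 1" "exp (- (x3 * real N)) \<le> 1"
        using exp_le_one_iff[of "- (x2 * real N)"] exp_le_one_iff[of "- (x3 * real N)"] x1_pos x2(1) x3(1)
        by (auto intro: order_trans[of _ 1 2])
      fix n and H :: "'a \<Rightarrow> ennreal"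
      assume H: "H \<in> borel_measurable (past M (X N) (J N) n)" and fin: "(\<integral>\<^sup>+\<omega>. H \<omega> \<partial>M) < \<infinity>"
      have "exp (- (x2 * real N)) / 2 \<le> exp (- (h 0 * real N + h 1 * real (K N) + \<delta> * real N)) / 2"
        using N by (simp add: ok_def)
      then have "ennreal (exp (- (x2 * real N)) / 2) * (\<integral>\<^sup>+\<omega>. H \<omega> \<partial>M) \<le>
          ennreal (exp (- (h 0 * real N + h 1 * real (K N) + \<delta> * real N)) / 2) * (\<integral>\<^sup>+\<omega>. H \<omega> \<partial>M)"
        by (intro mult_right_mono ennreal_leI) auto
      also have "\<dots> \<le> (\<integral>\<^sup>+\<omega>. H \<omega> * ennreal (of_bool (W.fresh N (n + 2 * N) \<omega>)) \<partial>M)"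
        by (rule W.escape_ge[OF params, where c = c])
          (use enter tie ctl d0 K h N H fin in \<open>auto simp: ok_def\<close>)
      finally show "ennreal (exp (- (x2 * real N)) / 2) * (\<integral>\<^sup>+\<omega>. H \<omega> \<partial>M) \<le>
          (\<integral>\<^sup>+\<omega>. H \<omega> * ennreal (of_bool (W.fresh N (n + 2 * N) \<omega>)) \<partial>M)" .
      show "(\<integral>\<^sup>+\<omega>. H \<omega> * ennreal (of_bool (W.fresh N (n + N) \<omega> \<and> \<not> J N (n + N) \<omega> = g)) \<partial>M) \<le>
          ennreal (exp (- (x3 * real N))) * (\<integral>\<^sup>+\<omega>. H \<omega> \<partial>M)"
        by (rule W.crossing_le[OF \<tau> good_mgf' leave H])
    qed auto
    have "AE \<omega> in M. \<forall>\<epsilon>>0. \<forall>\<^sub>F T in sequentially.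
        \<bar>(\<Sum>n<T. Y n \<omega>) - real T * (\<integral>y. y \<partial>R True)\<bar> \<le> (\<kappa> N * \<Delta> + \<epsilon>) * real T"
      unfolding \<Delta>_def
      by (rule W.average_bound[OF R_int t R_exp[OF disjI1[OF refl]] R_exp[OF disjI2[OF refl]] frac])
    then show ?thesis
      using AE_space
    proof eventually_elim
      case (elim \<omega>)
      have "0 < 1 / real N" using N1 by simp
      with elim(1) have "\<forall>\<^sub>F T in sequentially.
          \<bar>(\<Sum>n<T. Y n \<omega>) - real T * (\<integral>y. y \<partial>R True)\<bar> \<le> e N * real T"
        unfolding e_def by blast
      then show ?case
        using eventually_gt_at_top[of 0]
      proof eventually_elim
        case (elim T)
        have "(\<Sum>n<T. Y n \<omega>) = \<sigma> * (X N T \<omega> - real T * r)"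
          using I.sum_increments[where n = 0 and m = T] I.X_zero[OF \<open>\<omega> \<in> space M\<close>]
          by (simp add: Y_def atLeast0LessThan)
        then have "(\<Sum>n<T. Y n \<omega>) - real T * (\<integral>y. y \<partial>R True) = \<sigma> * (real T * (X N T \<omega> / real T - \<mu> g))"
          using elim(2) by (simp add: R_mean p_def field_simps)
        then have "\<bar>(\<Sum>n<T. Y n \<omega>) - real T * (\<integral>y. y \<partial>R True)\<bar> = real T * \<bar>X N T \<omega> / real T - \<mu> g\<bar>"
          using \<sigma> by (simp add: abs_mult)
        with elim show ?case by (simp add: mult.commute)
      qed
    qed
  qed
  \<comment> \<open>Only countably many \<open>N\<close> occur, so the exceptional sets unite to a
    null set whatever the joint law of the processes for different \<open>N\<close>.\<close>
  have "AE \<omega> in M. \<forall>N. ok N \<longrightarrow> (\<forall>\<^sub>F n in sequentially. \<bar>X N n \<omega> / real n - \<mu> g\<bar> \<le> e N)"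
    unfolding AE_all_countable using single by auto
  then show ?thesis
  proof eventually_elim
    case (elim \<omega>)
    have "\<forall>\<^sub>F N in sequentially. \<forall>\<^sub>F n in sequentially. \<bar>X N n \<omega> / real n - \<mu> g\<bar> \<le> e N"
      using ok by eventually_elim (use elim in blast)
    then show ?case by (intro conjI limsup_liminf_tendsto[OF e])
  qed
qed

theorem theorem2:
  fixes P :: "nat \<Rightarrow> real measure" and \<mu> :: "nat \<Rightarrow> real" and r\<^sub>1 :: real and i\<^sub>0 :: nat
    and M :: "'a measure"
    and X :: "nat \<Rightarrow> nat \<Rightarrow> 'a \<Rightarrow> real" and J :: "nat \<Rightarrow> nat \<Rightarrow> 'a \<Rightarrow> nat"
  assumes distributions: "\<And>i. i \<in> {0, 1} \<Longrightarrow> real_distribution (P i)"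
    and finite_means: "\<And>i. i \<in> {0, 1} \<Longrightarrow> integrable (P i) (\<lambda>x. x)"
    and means: "\<And>i. i \<in> {0, 1} \<Longrightarrow> \<mu> i = (\<integral>x. x \<partial>P i)"
    and A: "\<mu> 0 < r\<^sub>1" "r\<^sub>1 < \<mu> 1"
    and B: "measure (P 0) {r\<^sub>1..} > 0" "measure (P 1) {..<r\<^sub>1} > 0"
    and C: "\<exists>t\<^sub>0>0. \<forall>i\<in>{0, 1}. moment_gen (P i) t\<^sub>0 < \<infinity> \<and> moment_gen (P i) (- t\<^sub>0) < \<infinity>"
    and start: "i\<^sub>0 \<in> {0, 1}"
    and processes: "\<And>N. N \<ge> 1 \<Longrightarrow> instantaneous_process M P r\<^sub>1 i\<^sub>0 N (X N) (J N)"
  shows "(legendre_transform (P 0) r\<^sub>1 > legendre_transform (P 1) r\<^sub>1 \<longrightarrow>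
      (AE \<omega> in M.
        (\<lambda>N. limsup (\<lambda>n. ereal (X N n \<omega> / real n))) \<longlonglongrightarrow> ereal (\<mu> 0) \<and>
        (\<lambda>N. liminf (\<lambda>n. ereal (X N n \<omega> / real n))) \<longlonglongrightarrow> ereal (\<mu> 0))) \<and>
    (legendre_transform (P 1) r\<^sub>1 > legendre_transform (P 0) r\<^sub>1 \<longrightarrow>
      (AE \<omega> in M.
        (\<lambda>N. limsup (\<lambda>n. ereal (X N n \<omega> / real n))) \<longlonglongrightarrow> ereal (\<mu> 1) \<and>
        (\<lambda>N. liminf (\<lambda>n. ereal (X N n \<omega> / real n))) \<longlonglongrightarrow> ereal (\<mu> 1)))"
  using dominant_regime[OF distributions finite_means means A B(2) C start processes, of 0 1 "-1"]
    dominant_regime[OF distributions finite_means means A B(2) C start processes, of 1 0 1]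
  by simp

end
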